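(* Let $G$ be a finite group, $p$ a prime, and $H$ a normal subgroup of $G$ of index $p$, with $G/H=\langle xH\rangle$ for some $x\in G$. Let $F$ be an algebraically closed field of characteristic $0$ or of characteristic prime to the order of $G$. Let $\eta$ be an irreducible $F$-representation of $H$. (1) If $\eta\not\cong\eta^x$, then $\rho:=\eta\uparrow_H^G$ is irreducible, $\rho\downarrow_H^G\cong\eta\oplus\eta^x\oplus\cdots\oplus\eta^{x^{p-1}}$, and $$e_\rho=e_\eta+e_{\eta^x}+\cdots+e_{\eta^{x^{p-1}}}.$$ (2) If $\eta\cong\eta^x$, then $\eta$ extends to $p$ distinct irreducible $F$-representations $\rho_0,\rho_1,\dots,\rho_{p-1}$ of $G$, one has $\eta\uparrow_H^G\cong\rho_0\oplus\rho_1\oplus\cdots\oplus\rho_{p-1}$, and $e_\eta=e_{\rho_0}+e_{\rho_1}+\cdots+e_{\rho_{p-1}}$. Moreover, there exists $y\in G\setminus H$ such that $\overline{C(y)}^{\,p}e_\eta=\lambda e_\eta$ with $\lambda\in F\setminus\{0\}$; and for such $y$, if $\mu\in F$ is a $p$-th root of $\lambda$, $\zeta\in F$ is a primitive $p$-th root of unity and $c=\overline{C(y)}e_\eta/\mu$, then with a suitable labelling of the $\rho_i$, $$e_{\rho_i}=e_{\zeta^i c}\,e_\eta,\qquad i=0,1,\dots,p-1.$$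
   Context: Representations are finite-dimensional; "distinct" means pairwise inequivalent. For an irreducible $F$-representation $\rho$ of a finite group, $e_\rho$ denotes the unique primitive central idempotent of the group algebra over $F$ that acts as the identity on $\rho$. For $x\in G$, $\eta^x$ is the conjugate representation $h\mapsto\eta(xhx^{-1})$ of $H$. $\uparrow_H^G$ and $\downarrow_H^G$ denote induction and restriction; $\eta$ extends to $\rho$ means $\rho\downarrow_H^G\cong\eta$. For $y\in G$, $\overline{C(y)}\in F[G]$ is the sum of the elements of the conjugacy class of $y$ in $G$. For an element $X$, $e_X=(1+X+\cdots+X^{p-1})/p$. *)

theory Defs
  imports
    "HOL-Algebra.Coset"
    "HOL-Algebra.Generated_Groups"
    "HOL-Algebra.Module"
    "Jordan_Normal_Form.VS_Connect"
begin

text \<open>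
  Finite-dimensional representations are matrix representations. A representation is a function on
  the type of group elements whose values outside the carrier are irrelevant, so the restriction of
  a representation of \<open>G\<close> to a subgroup \<open>H\<close> is the same function, regarded as a representation of
  \<open>G\<lparr>carrier := H\<rparr>\<close>.
\<close>

definition representation ::
    "('g, 'm) monoid_scheme \<Rightarrow> nat \<Rightarrow> ('g \<Rightarrow> 'f::field mat) \<Rightarrow> bool" where
  "representation G n \<rho> \<longleftrightarrow> \<rho> \<in> hom G (units_of (ring_mat TYPE('f) n ()))"

definition irreducible_representation ::
    "('g, 'm) monoid_scheme \<Rightarrow> nat \<Rightarrow> ('g \<Rightarrow> 'f::field mat) \<Rightarrow> bool" where
  "irreducible_representation G n \<rho> \<longleftrightarrow>
     representation G n \<rho> \<and> n > 0 \<and>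
     (\<forall>W. VectorSpace.subspace class_ring W (module_vec TYPE('f) n) \<longrightarrow>
          (\<forall>g\<in>carrier G. \<forall>v\<in>W. \<rho> g *\<^sub>v v \<in> W) \<longrightarrow>
          W = {0\<^sub>v n} \<or> W = carrier_vec n)"

definition equivalent_representations ::
    "('g, 'm) monoid_scheme \<Rightarrow> ('g \<Rightarrow> 'f::field mat) \<Rightarrow> ('g \<Rightarrow> 'f mat) \<Rightarrow> bool" where
  "equivalent_representations G \<rho> \<sigma> \<longleftrightarrow>
     (\<exists>P Q. \<forall>g\<in>carrier G. similar_mat_wit (\<rho> g) (\<sigma> g) P Q)"

definition direct_sum_representation ::
    "nat \<Rightarrow> (nat \<Rightarrow> 'g \<Rightarrow> 'f::field mat) \<Rightarrow> 'g \<Rightarrow> 'f mat" where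
  "direct_sum_representation k \<rho> g = diag_block_mat (map (\<lambda>i. \<rho> i g) [0..<k])"

definition conjugate_representation ::
    "('g, 'm) monoid_scheme \<Rightarrow> 'g \<Rightarrow> ('g \<Rightarrow> 'f::field mat) \<Rightarrow> 'g \<Rightarrow> 'f mat" where
  "conjugate_representation G x \<eta> h = \<eta> (x \<otimes>\<^bsub>G\<^esub> h \<otimes>\<^bsub>G\<^esub> inv\<^bsub>G\<^esub> x)"

definition left_transversal :: "('g, 'm) monoid_scheme \<Rightarrow> 'g set \<Rightarrow> 'g list \<Rightarrow> bool" where
  "left_transversal G H ts \<longleftrightarrow>
     set ts \<subseteq> carrier G \<and>
     (\<forall>g\<in>carrier G. \<exists>!i. i < length ts \<and> g \<in> ts ! i <#\<^bsub>G\<^esub> H)"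

text \<open>
  The matrix of the left \<open>F[G]\<close>-module \<open>F[G] \<otimes>\<^bsub>F[H]\<^esub> V\<close> in the basis of the vectors
  \<open>t \<otimes> v\<close>, with \<open>t\<close> in the transversal \<open>ts\<close> and \<open>v\<close> in the basis of \<open>V\<close>: the block at position
  \<open>(i, j)\<close> is \<open>\<eta> (t\<^sub>i\<inverse> g t\<^sub>j)\<close> if \<open>t\<^sub>i\<inverse> g t\<^sub>j\<close> lies in \<open>H\<close>, and \<open>0\<close> otherwise. Different transversals
  give equivalent representations.
\<close>

definition induced_representation ::
    "('g, 'm) monoid_scheme \<Rightarrow> 'g set \<Rightarrow> 'g list \<Rightarrow> nat \<Rightarrow> ('g \<Rightarrow> 'f::field mat) \<Rightarrow> 'g \<Rightarrow> 'f mat"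
  where
  "induced_representation G H ts n \<eta> g =
     mat (length ts * n) (length ts * n) (\<lambda>(r, s).
       let h = inv\<^bsub>G\<^esub> (ts ! (r div n)) \<otimes>\<^bsub>G\<^esub> g \<otimes>\<^bsub>G\<^esub> (ts ! (s div n))
       in if h \<in> H then \<eta> h $$ (r mod n, s mod n) else 0)"

text \<open>
  Elements of the group algebra vanish outside the carrier of the group, so the algebra of a
  subgroup is literally contained in that of the group.
\<close>

definition group_algebra ::
    "('g, 'm) monoid_scheme \<Rightarrow> ('f::field, 'g \<Rightarrow> 'f) module" where
  "group_algebra G =
     \<lparr>carrier = {a. \<forall>g. g \<notin> carrier G \<longrightarrow> a g = 0},
      mult = (\<lambda>a b g. \<Sum>(h, k) | h \<in> carrier G \<and> k \<in> carrier G \<and> h \<otimes>\<^bsub>G\<^esub> k = g. a h * b k),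
      one = (\<lambda>g. if g = \<one>\<^bsub>G\<^esub> then 1 else 0),
      zero = (\<lambda>g. 0),
      add = (\<lambda>a b g. a g + b g),
      smult = (\<lambda>c a g. c * a g)\<rparr>"

definition class_sum :: "('g, 'm) monoid_scheme \<Rightarrow> 'g \<Rightarrow> 'g \<Rightarrow> 'f::field" where
  "class_sum G y =
     (\<lambda>z. if z \<in> {g \<otimes>\<^bsub>G\<^esub> y \<otimes>\<^bsub>G\<^esub> inv\<^bsub>G\<^esub> g | g. g \<in> carrier G} then 1 else 0)"

definition algebra_action ::
    "('g, 'm) monoid_scheme \<Rightarrow> nat \<Rightarrow> ('g \<Rightarrow> 'f::field mat) \<Rightarrow> ('g \<Rightarrow> 'f) \<Rightarrow> 'f mat" where
  "algebra_action G n \<rho> a = mat n n (\<lambda>(i, j). \<Sum>g\<in>carrier G. a g * \<rho> g $$ (i, j))"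

definition central_idempotent :: "('a, 'm) ring_scheme \<Rightarrow> 'a \<Rightarrow> bool" where
  "central_idempotent A e \<longleftrightarrow>
     e \<in> carrier A \<and> e \<otimes>\<^bsub>A\<^esub> e = e \<and> (\<forall>a\<in>carrier A. e \<otimes>\<^bsub>A\<^esub> a = a \<otimes>\<^bsub>A\<^esub> e)"

definition primitive_central_idempotent :: "('a, 'm) ring_scheme \<Rightarrow> 'a \<Rightarrow> bool" where
  "primitive_central_idempotent A e \<longleftrightarrow>
     central_idempotent A e \<and> e \<noteq> \<zero>\<^bsub>A\<^esub> \<and>
     (\<forall>e1 e2. central_idempotent A e1 \<longrightarrow> central_idempotent A e2 \<longrightarrow>
        e1 \<otimes>\<^bsub>A\<^esub> e2 = \<zero>\<^bsub>A\<^esub> \<longrightarrow> e = e1 \<oplus>\<^bsub>A\<^esub> e2 \<longrightarrow> e1 = \<zero>\<^bsub>A\<^esub> \<or> e2 = \<zero>\<^bsub>A\<^esub>)"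

definition representation_idempotent ::
    "('g, 'm) monoid_scheme \<Rightarrow> nat \<Rightarrow> ('g \<Rightarrow> 'f::field mat) \<Rightarrow> 'g \<Rightarrow> 'f" where
  "representation_idempotent G n \<rho> =
     (THE e. primitive_central_idempotent (group_algebra G) e \<and> algebra_action G n \<rho> e = 1\<^sub>m n)"

definition averaging_element :: "('f::field, 'a) module \<Rightarrow> nat \<Rightarrow> 'a \<Rightarrow> 'a" where
  "averaging_element A p X = inverse (of_nat p) \<odot>\<^bsub>A\<^esub> (\<Oplus>\<^bsub>A\<^esub>k\<in>{..<p}. X [^]\<^bsub>A\<^esub> k)"

definition primitive_root_of_unity :: "nat \<Rightarrow> 'f::field \<Rightarrow> bool" where
  "primitive_root_of_unity p \<zeta> \<longleftrightarrow> \<zeta> ^ p = 1 \<and> (\<forall>k. 0 < k \<and> k < p \<longrightarrow> \<zeta> ^ k \<noteq> 1)"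

end

theory Submission
  imports Defs "Jordan_Normal_Form.Char_Poly" "HOL-Algebra.Multiplicative_Group"
begin

text \<open>
  By Schur orthogonality the idempotent of an irreducible \<open>\<rho>\<close> of degree \<open>n\<close> is
  \<open>n / |G| \<Sum>\<^sub>g \<chi>(g\<inverse>) g\<close>, and multiplying it by \<open>a\<close> gives \<open>n / |G| \<Sum>\<^sub>g tr (\<rho>(g\<inverse>) \<rho>(a)) g\<close>,
  which depends only on \<open>\<rho>(a)\<close>. This yields primitivity and uniqueness without Wedderburn's
  theorem, and turns every identity between idempotents into an identity between characters.

  If \<open>\<eta>\<close> and \<open>\<eta>\<^sup>x\<close> are inequivalent, then all conjugates by representatives of \<open>G/H\<close> are pairwise
  inequivalent, and orthogonality produces the matrix units of one diagonal block of the induced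
  representation from \<open>F[H]\<close>; the transversal permutes the blocks transitively.

  If \<open>\<eta>\<close> and \<open>\<eta>\<^sup>x\<close> are equivalent, Schur's lemma gives a matrix \<open>M\<close> with \<open>M\<^sup>p = \<eta>(x\<^sup>p)\<close> that
  implements conjugation by \<open>x\<close>, and the extensions are \<open>x\<^sup>k h \<mapsto> (\<zeta>\<^sup>i M)\<^sup>k \<eta>(h)\<close>. A class sum
  outside \<open>H\<close> acts on them by scalars in the ratio \<open>\<zeta>\<^sup>k\<^sup>i\<close>, so after division by \<open>\<mu>\<close> the scalars
  run once through all \<open>p\<close>-th roots of unity.
\<close>

section \<open>Schur's lemma and orthogonality\<close>

text \<open>In positive characteristic the inner product of a character with itself sees
  multiplicities only modulo the characteristic, so it cannot certify that the induced
  representation is irreducible; matrix units in the image of F[H] can. In the invariant case the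
  extensions are twists of one another by the linear characters of G/H, and their characters differ
  only at elements outside H where the character of one extension is nonzero. Such an element does
  double duty: it separates the extensions, and it makes its class sum act by nonzero scalars. The
  p-th power of the class sum forgets the roots of unity and acts by one common scalar, which is the
  origin of \<lambda>. Since the idempotent of \<eta> is the sum of the idempotents of the
  extensions, its product with an element acting on each extension as a scalar is determined by
  these p scalars. The averaging element has scalar 1 where its argument acts as 1 and scalar 0
  where its argument acts as another p-th root of unity; it therefore isolates one
  extension.\<close>

lemma square_mult_carrier_mat [simp, intro]:
  "A \<in> carrier_mat n n \<Longrightarrow> B \<in> carrier_mat n n \<Longrightarrow> A * B \<in> carrier_mat n n"
  by (rule mult_carrier_mat)

text \<open>The general law has four dimensions that rewriting would have to guess; with a single
  one, fixing \<open>n\<close> makes every side condition a membership in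
  \<open>carrier_mat n n\<close>.\<close>

lemma square_mult_assoc:
  "A \<in> carrier_mat n n \<Longrightarrow> B \<in> carrier_mat n n \<Longrightarrow> C \<in> carrier_mat n n \<Longrightarrow>
    A * B * C = A * (B * C)"
  by (rule assoc_mult_mat)

text \<open>Invertibility of the values comes for free: the image of the inverse element is an
  inverse matrix. Later proofs can therefore work with plain square matrices.\<close>

lemma (in group) representation_iff:
  fixes \<rho> :: "'a \<Rightarrow> 'f::field mat"
  shows "representation G n \<rho> \<longleftrightarrow>
    (\<forall>g\<in>carrier G. \<rho> g \<in> carrier_mat n n) \<and> \<rho> \<one> = 1\<^sub>m n \<and>
    (\<forall>g\<in>carrier G. \<forall>h\<in>carrier G. \<rho> (g \<otimes> h) = \<rho> g * \<rho> h)" (is "_ \<longleftrightarrow> ?R")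
proof
  let ?U = "units_of (ring_mat TYPE('f) n ())"
  interpret M: ring "ring_mat TYPE('f) n ()" by (rule ring_mat)
  {
    assume "representation G n \<rho>"
    then have h: "\<rho> \<in> hom G ?U" by (simp add: representation_def)
    have "\<rho> \<one> = \<one>\<^bsub>?U\<^esub>" by (rule hom_one[OF h is_group M.units_group])
    moreover have "\<rho> g \<in> Units (ring_mat TYPE('f) n ())" if "g \<in> carrier G" for g
      using hom_in_carrier[OF h that] by (simp add: units_of_def)
    then have "\<rho> g \<in> carrier_mat n n" if "g \<in> carrier G" for g
      using that M.Units_closed by (fastforce simp: ring_mat_def)
    ultimately show ?R
      using hom_mult[OF h] by (auto simp: units_of_def ring_mat_def)
  next
    assume r: ?R
    have "\<rho> g \<in> Units (ring_mat TYPE('f) n ())" if g: "g \<in> carrier G" for g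
    proof -
      have "\<rho> (inv g) * \<rho> g = 1\<^sub>m n" "\<rho> g * \<rho> (inv g) = 1\<^sub>m n"
        using r g by (metis inv_closed l_inv, metis inv_closed r_inv)
      then show ?thesis using r g by (auto simp: Units_def ring_mat_def)
    qed
    then show "representation G n \<rho>"
      using r by (auto simp: representation_def hom_def units_of_def ring_mat_def)
  }
qed

lemma
  assumes "group G" "representation G n \<rho>"
  shows representation_carrier: "g \<in> carrier G \<Longrightarrow> \<rho> g \<in> carrier_mat n n"
    and representation_one: "\<rho> \<one>\<^bsub>G\<^esub> = 1\<^sub>m n"
    and representation_mult:
      "g \<in> carrier G \<Longrightarrow> h \<in> carrier G \<Longrightarrow> \<rho> (g \<otimes>\<^bsub>G\<^esub> h) = \<rho> g * \<rho> h"
  using assms group.representation_iff[OF assms(1), of n \<rho>] by blast+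

lemma representation_inv:
  assumes "group G" "representation G n \<rho>" "g \<in> carrier G"
  shows "\<rho> (inv\<^bsub>G\<^esub> g) * \<rho> g = 1\<^sub>m n" "\<rho> g * \<rho> (inv\<^bsub>G\<^esub> g) = 1\<^sub>m n"
proof -
  interpret group G by fact
  show "\<rho> (inv\<^bsub>G\<^esub> g) * \<rho> g = 1\<^sub>m n" "\<rho> g * \<rho> (inv\<^bsub>G\<^esub> g) = 1\<^sub>m n"
    using representation_mult[OF assms(1,2), symmetric] representation_one[OF assms(1,2)] assms(3)
    by simp_all
qed

lemma subspace_module_vec_iff:
  "VectorSpace.subspace class_ring W (module_vec TYPE('f::field) n) \<longleftrightarrow>
    W \<subseteq> carrier_vec n \<and> 0\<^sub>v n \<in> W \<and> (\<forall>v\<in>W. \<forall>w\<in>W. v + w \<in> W) \<and> (\<forall>c. \<forall>v\<in>W. c \<cdot>\<^sub>v v \<in> W)"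
  unfolding VectorSpace.subspace_def submodule_def
  using vec_vs[where 'a='f and n=n] vec_module[where 'a='f and n=n]
  by (auto simp: module_vec_simps class_ring_simps)

lemma irreducible_representation_iff:
  fixes \<rho> :: "'g \<Rightarrow> 'f::field mat"
  shows "irreducible_representation G n \<rho> \<longleftrightarrow>
     representation G n \<rho> \<and> n > 0 \<and>
     (\<forall>W. W \<subseteq> carrier_vec n \<longrightarrow> 0\<^sub>v n \<in> W \<longrightarrow> (\<forall>v\<in>W. \<forall>w\<in>W. v + w \<in> W) \<longrightarrow>
        (\<forall>c. \<forall>v\<in>W. c \<cdot>\<^sub>v v \<in> W) \<longrightarrow> (\<forall>g\<in>carrier G. \<forall>v\<in>W. \<rho> g *\<^sub>v v \<in> W) \<longrightarrow>
          W = {0\<^sub>v n} \<or> W = carrier_vec n)"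
  unfolding irreducible_representation_def subspace_module_vec_iff by blast

text \<open>The kernel of Y is stable under \<rho>. By irreducibility it is trivial, so the
  determinant is nonzero, or it is the whole space and Y vanishes.\<close>

lemma intertwiner_zero_or_det_nonzero:
  fixes \<rho> \<sigma> :: "'g \<Rightarrow> 'f::field mat"
  assumes "group G" and irr: "irreducible_representation G n \<rho>"
    and Y: "Y \<in> carrier_mat n n" and s: "\<And>g. g \<in> carrier G \<Longrightarrow> \<sigma> g \<in> carrier_mat n n"
    and int: "\<And>g. g \<in> carrier G \<Longrightarrow> \<sigma> g * Y = Y * \<rho> g"
  shows "Y = 0\<^sub>m n n \<or> det Y \<noteq> 0"
proof (rule disjCI)
  assume "\<not> det Y \<noteq> 0"
  then obtain v where v: "v \<in> carrier_vec n" "v \<noteq> 0\<^sub>v n" "Y *\<^sub>v v = 0\<^sub>v n"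
    using det_0_iff_vec_prod_zero_field[OF Y] by auto
  define W where "W = {v \<in> carrier_vec n. Y *\<^sub>v v = 0\<^sub>v n}"
  have rep: "representation G n \<rho>" using irr by (simp add: irreducible_representation_def)
  have "\<rho> g *\<^sub>v w \<in> W" if "g \<in> carrier G" "w \<in> W" for g w
  proof -
    have r: "\<rho> g \<in> carrier_mat n n" using representation_carrier[OF assms(1) rep that(1)] .
    have w: "w \<in> carrier_vec n" "Y *\<^sub>v w = 0\<^sub>v n" using that by (auto simp: W_def)
    have "Y *\<^sub>v (\<rho> g *\<^sub>v w) = (Y * \<rho> g) *\<^sub>v w" using Y r w by simp
    also have "\<dots> = \<sigma> g *\<^sub>v (Y *\<^sub>v w)" using int[OF that(1)] Y s[OF that(1)] w(1) by (metis assoc_mult_mat_vec)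
    also have "\<dots> = 0\<^sub>v n" using w s[OF that(1)] by auto
    finally show ?thesis using r w by (simp add: W_def)
  qed
  moreover have "W \<subseteq> carrier_vec n" "0\<^sub>v n \<in> W" "\<forall>v\<in>W. \<forall>w\<in>W. v + w \<in> W"
      "\<forall>c. \<forall>v\<in>W. c \<cdot>\<^sub>v v \<in> W"
    using Y by (auto simp: W_def mult_add_distrib_mat_vec[of _ n n] mult_mat_vec[of _ n n])
  ultimately have "W = {0\<^sub>v n} \<or> W = carrier_vec n"
    using irr unfolding irreducible_representation_iff by blast
  moreover have "v \<in> W" using v by (simp add: W_def)
  ultimately have W: "W = carrier_vec n" using v by blast
  show "Y = 0\<^sub>m n n"
  proof (rule eq_matI)
    fix i j assume ij: "i < dim_row (0\<^sub>m n n :: 'f mat)" "j < dim_col (0\<^sub>m n n :: 'f mat)"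
    have "unit_vec n j \<in> W" using W by simp
    then have "(Y *\<^sub>v unit_vec n j) $ i = 0" using ij by (simp add: W_def)
    then show "Y $$ (i, j) = 0\<^sub>m n n $$ (i, j)" using ij Y by simp
  qed (use Y in auto)
qed

text \<open>Over an algebraically closed field Y has an eigenvalue e, and Y - e is an intertwiner
  with vanishing determinant, hence zero by the previous dichotomy.\<close>

lemma schur_scalar:
  fixes \<rho> :: "'g \<Rightarrow> 'f::alg_closed_field mat"
  assumes "group G" and irr: "irreducible_representation G n \<rho>"
    and Y: "Y \<in> carrier_mat n n"
    and int: "\<And>g. g \<in> carrier G \<Longrightarrow> \<rho> g * Y = Y * \<rho> g"
  obtains c where "Y = c \<cdot>\<^sub>m 1\<^sub>m n"
proof -
  have rep: "representation G n \<rho>" and n: "n > 0"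
    using irr by (auto simp: irreducible_representation_def)
  have "degree (char_poly Y) > 0" using degree_monic_char_poly[OF Y] n by simp
  then obtain e where "poly (char_poly Y) e = 0" using alg_closed_imp_poly_has_root by blast
  then have "eigenvalue Y e" using eigenvalue_root_char_poly[OF Y] by simp
  then obtain v where v: "v \<in> carrier_vec n" "v \<noteq> 0\<^sub>v n" "Y *\<^sub>v v = e \<cdot>\<^sub>v v"
    using Y by (auto simp: eigenvalue_def eigenvector_def)
  define Z where "Z = Y - e \<cdot>\<^sub>m 1\<^sub>m n"
  have Z: "Z \<in> carrier_mat n n" unfolding Z_def by (rule minus_carrier_mat) simp
  have "Z *\<^sub>v v = Y *\<^sub>v v - e \<cdot>\<^sub>m 1\<^sub>m n *\<^sub>v v"
    unfolding Z_def using Y v by (intro minus_mult_distrib_mat_vec) auto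
  also have "e \<cdot>\<^sub>m 1\<^sub>m n *\<^sub>v v = e \<cdot>\<^sub>v v"
    using v(1) by (intro eq_vecI) auto
  finally have "Z *\<^sub>v v = 0\<^sub>v n" using v by simp
  then have det: "det Z = 0" using det_0_iff_vec_prod_zero_field[OF Z] v by auto
  have comm: "\<rho> g * Z = Z * \<rho> g" if "g \<in> carrier G" for g
  proof -
    have r: "\<rho> g \<in> carrier_mat n n" using representation_carrier[OF assms(1) rep that] .
    have "\<rho> g * (e \<cdot>\<^sub>m 1\<^sub>m n) = e \<cdot>\<^sub>m \<rho> g" "(e \<cdot>\<^sub>m 1\<^sub>m n) * \<rho> g = e \<cdot>\<^sub>m \<rho> g"
      using r by (simp_all add: mult_smult_distrib[of _ n n _ n] mult_smult_assoc_mat[of _ n n _ n])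
    then show ?thesis using int[OF that] r Y
      by (simp add: Z_def mult_minus_distrib_mat[of _ n n] minus_mult_distrib_mat[of _ n n])
  qed
  have "Z = 0\<^sub>m n n \<or> det Z \<noteq> 0"
    by (rule intertwiner_zero_or_det_nonzero[OF assms(1) irr Z representation_carrier[OF assms(1) rep] comm])
  with det have "Z = 0\<^sub>m n n" by simp
  then have "Y = e \<cdot>\<^sub>m 1\<^sub>m n"
    using Y unfolding Z_def mat_eq_iff by auto
  then show ?thesis by (rule that)
qed

text \<open>A nonzero intertwiner is invertible and would itself be an equivalence. One common
  degree is enough because only conjugates of a single representation are compared later.\<close>

lemma schur_zero:
  fixes \<rho> \<sigma> :: "'g \<Rightarrow> 'f::field mat"
  assumes "group G" and irr: "irreducible_representation G n \<rho>" and rep: "representation G n \<sigma>"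
    and ne: "\<not> equivalent_representations G \<sigma> \<rho>"
    and Y: "Y \<in> carrier_mat n n"
    and int: "\<And>g. g \<in> carrier G \<Longrightarrow> \<sigma> g * Y = Y * \<rho> g"
  shows "Y = 0\<^sub>m n n"
proof (rule ccontr)
  assume "Y \<noteq> 0\<^sub>m n n"
  then have "det Y \<noteq> 0"
    using intertwiner_zero_or_det_nonzero[OF assms(1) irr Y representation_carrier[OF assms(1) rep] int]
    by blast
  then obtain Q where Q: "Q \<in> carrier_mat n n" "Y * Q = 1\<^sub>m n" "Q * Y = 1\<^sub>m n"
    using det_non_zero_imp_unit[OF Y] by (auto simp: Units_def ring_mat_def)
  have "similar_mat_wit (\<sigma> g) (\<rho> g) Y Q" if "g \<in> carrier G" for g
  proof (rule similar_mat_witI[of _ _ n])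
    have c: "\<sigma> g \<in> carrier_mat n n" "\<rho> g \<in> carrier_mat n n"
      using that representation_carrier[OF assms(1)] rep irr
      by (auto simp: irreducible_representation_def)
    have "Y * \<rho> g * Q = \<sigma> g * Y * Q" using int[OF that] by simp
    also have "\<dots> = \<sigma> g" using c Q Y by (simp add: square_mult_assoc[of _ n])
    finally show "\<sigma> g = Y * \<rho> g * Q" by simp
    show "\<sigma> g \<in> carrier_mat n n" "\<rho> g \<in> carrier_mat n n" by fact+
  qed (use Q Y in auto)
  then show False using ne by (auto simp: equivalent_representations_def)
qed

text \<open>The zero matrix depends on the dimension, so the sum is formed entry by entry with the
  dimension as a parameter; an empty index set then gives the zero matrix of the right size.\<close>

definition mat_sum :: "nat \<Rightarrow> 's set \<Rightarrow> ('s \<Rightarrow> 'f::comm_ring_1 mat) \<Rightarrow> 'f mat" where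
  "mat_sum n S f = mat n n (\<lambda>(i, j). \<Sum>s\<in>S. f s $$ (i, j))"

lemma mat_sum_carrier [simp]: "mat_sum n S f \<in> carrier_mat n n"
  by (simp add: mat_sum_def)

lemma mat_sum_dim [simp]: "dim_row (mat_sum n S f) = n" "dim_col (mat_sum n S f) = n"
  by (simp_all add: mat_sum_def)

lemma mat_sum_index: "i < n \<Longrightarrow> j < n \<Longrightarrow> mat_sum n S f $$ (i, j) = (\<Sum>s\<in>S. f s $$ (i, j))"
  by (simp add: mat_sum_def)

lemma mat_sum_cong: "(\<And>s. s \<in> S \<Longrightarrow> f s = g s) \<Longrightarrow> mat_sum n S f = mat_sum n S g"
  by (simp add: mat_sum_def)

lemma mat_sum_reindex:
  assumes "bij_betw b T S"
  shows "mat_sum n S f = mat_sum n T (\<lambda>t. f (b t))"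
  unfolding mat_sum_def by (simp add: sum.reindex_bij_betw[OF assms, symmetric])

lemma index_mult_mat_sum:
  assumes "A \<in> carrier_mat n m" "B \<in> carrier_mat m k" "i < n" "j < k"
  shows "(A * B) $$ (i, j) = (\<Sum>l<m. A $$ (i, l) * B $$ (l, j))"
  using assms by (simp add: scalar_prod_def atLeast0LessThan)

lemma mult_mat_sum:
  assumes "A \<in> carrier_mat n n" "\<And>s. s \<in> S \<Longrightarrow> f s \<in> carrier_mat n n"
  shows "A * mat_sum n S f = mat_sum n S (\<lambda>s. A * f s)"
proof (rule eq_matI)
  fix i j assume ij: "i < dim_row (mat_sum n S (\<lambda>s. A * f s))" "j < dim_col (mat_sum n S (\<lambda>s. A * f s))"
  then have "(A * mat_sum n S f) $$ (i, j) = (\<Sum>l<n. A $$ (i, l) * (\<Sum>s\<in>S. f s $$ (l, j)))"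
    using assms by (subst index_mult_mat_sum[of _ n n _ n]) (auto simp: mat_sum_index)
  also have "\<dots> = (\<Sum>s\<in>S. \<Sum>l<n. A $$ (i, l) * f s $$ (l, j))"
    by (simp add: sum_distrib_left sum.swap[of _ S])
  also have "\<dots> = mat_sum n S (\<lambda>s. A * f s) $$ (i, j)"
    using ij assms
    by (auto simp: mat_sum_index index_mult_mat_sum[of _ n n _ n] simp del: index_mult_mat intro!: sum.cong)
  finally show "(A * mat_sum n S f) $$ (i, j) = mat_sum n S (\<lambda>s. A * f s) $$ (i, j)" .
qed (use assms in auto)

lemma mat_sum_mult:
  assumes "A \<in> carrier_mat n n" "\<And>s. s \<in> S \<Longrightarrow> f s \<in> carrier_mat n n"
  shows "mat_sum n S f * A = mat_sum n S (\<lambda>s. f s * A)"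
proof (rule eq_matI)
  fix i j assume ij: "i < dim_row (mat_sum n S (\<lambda>s. f s * A))" "j < dim_col (mat_sum n S (\<lambda>s. f s * A))"
  then have "(mat_sum n S f * A) $$ (i, j) = (\<Sum>l<n. (\<Sum>s\<in>S. f s $$ (i, l)) * A $$ (l, j))"
    using assms by (subst index_mult_mat_sum[of _ n n _ n]) (auto simp: mat_sum_index)
  also have "\<dots> = (\<Sum>s\<in>S. \<Sum>l<n. f s $$ (i, l) * A $$ (l, j))"
    by (simp add: sum_distrib_right sum.swap[of _ S])
  also have "\<dots> = mat_sum n S (\<lambda>s. f s * A) $$ (i, j)"
    using ij assms
    by (auto simp: mat_sum_index index_mult_mat_sum[of _ n n _ n] simp del: index_mult_mat intro!: sum.cong)
  finally show "(mat_sum n S f * A) $$ (i, j) = mat_sum n S (\<lambda>s. f s * A) $$ (i, j)" .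
qed (use assms in auto)

text \<open>Lets stability under group elements be transferred to elements of the group algebra, and
  a vector be expanded in coordinates inside a subspace.\<close>

lemma mat_sum_mult_vec_mem:
  fixes f :: "'s \<Rightarrow> 'f::field mat"
  assumes "finite S" "\<And>s. s \<in> S \<Longrightarrow> f s \<in> carrier_mat n n" "v \<in> carrier_vec n"
    and "0\<^sub>v n \<in> W" "\<forall>v\<in>W. \<forall>w\<in>W. v + w \<in> W" "\<And>s. s \<in> S \<Longrightarrow> f s *\<^sub>v v \<in> W"
  shows "mat_sum n S f *\<^sub>v v \<in> W"
  using assms(1,2,6)
proof (induction S rule: finite_induct)
  case empty
  have "mat_sum n {} f *\<^sub>v v = 0\<^sub>v n"
    using assms(3) by (intro eq_vecI) (auto simp: mat_sum_def scalar_prod_def)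
  then show ?case using assms(4) by simp
next
  case (insert s S)
  have "mat_sum n (insert s S) f = f s + mat_sum n S f"
    using insert by (intro eq_matI) (auto simp: mat_sum_def)
  then have "mat_sum n (insert s S) f *\<^sub>v v = f s *\<^sub>v v + mat_sum n S f *\<^sub>v v"
    using insert assms(3) by (simp add: add_mult_distrib_mat_vec[of _ n n])
  then show ?case using insert assms(5) by auto
qed

section \<open>Averaging over a finite group and Schur orthogonality\<close>

locale finite_group = group +
  assumes finite_carrier: "finite (carrier G)"
begin

lemma bij_betw_mult_left: "h \<in> carrier G \<Longrightarrow> bij_betw (\<lambda>g. h \<otimes> g) (carrier G) (carrier G)"
  by (rule bij_betwI[of _ _ _ "\<lambda>g. inv h \<otimes> g"]) (auto simp: m_assoc[symmetric])

lemma bij_betw_inv: "bij_betw (\<lambda>g. inv g) (carrier G) (carrier G)"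
  by (rule bij_betwI[of _ _ _ "\<lambda>g. inv g"]) auto

text \<open>Left multiplication by h permutes the group, and the h absorbed by \<sigma> reappears on
  the right because \<open>\<rho> (inv g) = \<rho> (inv (h \<otimes> g)) * \<rho> h\<close>.\<close>

lemma average_intertwines:
  fixes \<rho> \<sigma> :: "'a \<Rightarrow> 'f::field mat"
  assumes r: "representation G n \<rho>" and s: "representation G n \<sigma>"
    and X: "X \<in> carrier_mat n n" and h: "h \<in> carrier G"
  shows "\<sigma> h * mat_sum n (carrier G) (\<lambda>g. \<sigma> g * X * \<rho> (inv g)) =
         mat_sum n (carrier G) (\<lambda>g. \<sigma> g * X * \<rho> (inv g)) * \<rho> h"
proof -
  note rc = representation_carrier[OF is_group r] and sc = representation_carrier[OF is_group s]
  have "\<sigma> h * mat_sum n (carrier G) (\<lambda>g. \<sigma> g * X * \<rho> (inv g)) =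
      mat_sum n (carrier G) (\<lambda>g. \<sigma> h * (\<sigma> g * X * \<rho> (inv g)))"
    using rc sc X h by (intro mult_mat_sum) (auto intro!: mult_carrier_mat)
  also have "\<dots> = mat_sum n (carrier G) (\<lambda>g. \<sigma> (h \<otimes> g) * X * \<rho> (inv (h \<otimes> g)) * \<rho> h)"
  proof (rule mat_sum_cong)
    fix g assume g: "g \<in> carrier G"
    have "\<rho> (inv g) = \<rho> (inv (h \<otimes> g)) * \<rho> h"
      using g h by (subst representation_mult[OF is_group r, symmetric])
        (auto simp: inv_mult_group m_assoc)
    then show "\<sigma> h * (\<sigma> g * X * \<rho> (inv g)) = \<sigma> (h \<otimes> g) * X * \<rho> (inv (h \<otimes> g)) * \<rho> h"
      using g h rc sc X
      by (simp add: representation_mult[OF is_group s] square_mult_assoc[of _ n])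
  qed
  also have "\<dots> = mat_sum n (carrier G) (\<lambda>g. \<sigma> g * X * \<rho> (inv g) * \<rho> h)"
    using mat_sum_reindex[OF bij_betw_mult_left[OF h], of n "\<lambda>g. \<sigma> g * X * \<rho> (inv g) * \<rho> h"] by simp
  also have "\<dots> = mat_sum n (carrier G) (\<lambda>g. \<sigma> g * X * \<rho> (inv g)) * \<rho> h"
    using rc sc X h by (intro mat_sum_mult[symmetric]) (auto intro!: mult_carrier_mat)
  finally show ?thesis .
qed

end

text \<open>The middle factor is the matrix unit at (j, k). Averaging it in place of a general X
  turns Schur's lemma into relations between matrix coefficients.\<close>

lemma mult_matrix_unit_index:
  fixes A B :: "'f::comm_ring_1 mat"
  assumes "A \<in> carrier_mat n n" "B \<in> carrier_mat n n" "i < n" "j < n" "k < n" "l < n"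
  shows "(A * mat n n (\<lambda>(a, b). if a = j \<and> b = k then 1 else 0) * B) $$ (i, l) = A $$ (i, j) * B $$ (k, l)"
proof -
  let ?E = "mat n n (\<lambda>(a, b). if a = j \<and> b = k then 1 else 0) :: 'f mat"
  have "(A * ?E) $$ (i, b) = (if b = k then A $$ (i, j) else 0)" if "b < n" for b
  proof -
    have "(A * ?E) $$ (i, b) = (\<Sum>a<n. A $$ (i, a) * (if a = j \<and> b = k then 1 else 0))"
      using assms that by (subst index_mult_mat_sum[of _ n n _ n]) auto
    also have "\<dots> = (\<Sum>a<n. if a = j then (if b = k then A $$ (i, j) else 0) else 0)"
      by (intro sum.cong) auto
    finally show ?thesis using assms by simp
  qed
  moreover have "(A * ?E * B) $$ (i, l) = (\<Sum>b<n. (A * ?E) $$ (i, b) * B $$ (b, l))"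
    using assms by (intro index_mult_mat_sum) auto
  moreover have "(\<Sum>b<n. (A * ?E) $$ (i, b) * B $$ (b, l)) =
      (\<Sum>b<n. (if b = k then A $$ (i, j) * B $$ (k, l) else 0))"
    by (rule sum.cong) (simp_all add: calculation(1) del: index_mult_mat)
  ultimately have "(A * ?E * B) $$ (i, l) = (\<Sum>b<n. (if b = k then A $$ (i, j) * B $$ (k, l) else 0))"
    by (simp only:)
  then show ?thesis using assms by simp
qed

context finite_group
begin

lemma schur_orthogonality_inequivalent:
  fixes \<rho> \<sigma> :: "'a \<Rightarrow> 'f::field mat"
  assumes r: "irreducible_representation G n \<rho>" and s: "representation G n \<sigma>"
    and ne: "\<not> equivalent_representations G \<sigma> \<rho>"
    and i: "i < n" "j < n" "k < n" "l < n"
  shows "(\<Sum>g\<in>carrier G. \<sigma> g $$ (i, j) * \<rho> (inv g) $$ (k, l)) = 0"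
proof -
  let ?E = "mat n n (\<lambda>(a, b). if a = j \<and> b = k then 1 else 0) :: 'f mat"
  have rr: "representation G n \<rho>" using r by (simp add: irreducible_representation_def)
  have "mat_sum n (carrier G) (\<lambda>g. \<sigma> g * ?E * \<rho> (inv g)) = 0\<^sub>m n n"
    by (rule schur_zero[OF is_group r s ne]) (auto intro!: average_intertwines rr s)
  then have "mat_sum n (carrier G) (\<lambda>g. \<sigma> g * ?E * \<rho> (inv g)) $$ (i, l) = 0" using i by simp
  then show ?thesis using i
    by (simp add: mat_sum_index mult_matrix_unit_index representation_carrier[OF is_group rr]
        representation_carrier[OF is_group s] del: index_mult_mat cong: sum.cong)
qed

text \<open>The factor n stays on the left so that nothing is divided by it; that n is nonzero in
  the field when |G| is becomes a consequence.\<close>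

lemma schur_orthogonality:
  fixes \<rho> :: "'a \<Rightarrow> 'f::alg_closed_field mat"
  assumes r: "irreducible_representation G n \<rho>"
    and i: "i < n" "j < n" "k < n" "l < n"
  shows "of_nat n * (\<Sum>g\<in>carrier G. \<rho> g $$ (i, j) * \<rho> (inv g) $$ (k, l)) =
    (if i = l \<and> j = k then of_nat (Coset.order G) else 0)"
proof -
  have rr: "representation G n \<rho>" using r by (simp add: irreducible_representation_def)
  note rc = representation_carrier[OF is_group rr]
  define S where "S = (\<lambda>i j k l. \<Sum>g\<in>carrier G. \<rho> g $$ (i, j) * \<rho> (inv g) $$ (k, l))"
  \<comment> \<open>For fixed inner indices j, k the sums are the entries of one averaged matrix,
    and that matrix is scalar.\<close>
  have "\<exists>c. \<forall>i<n. \<forall>l<n. S i j k l = (if i = l then c else 0)" if jk: "j < n" "k < n" for j k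
  proof -
    let ?E = "mat n n (\<lambda>(a, b). if a = j \<and> b = k then 1 else 0) :: 'f mat"
    let ?Y = "mat_sum n (carrier G) (\<lambda>g. \<rho> g * ?E * \<rho> (inv g))"
    obtain c where c: "?Y = c \<cdot>\<^sub>m 1\<^sub>m n"
      by (rule schur_scalar[OF is_group r, of ?Y]) (auto intro!: average_intertwines rr)
    have "S i j k l = (if i = l then c else 0)" if il: "i < n" "l < n" for i l
    proof -
      have "S i j k l = ?Y $$ (i, l)"
        using jk il rc by (simp add: S_def mat_sum_index mult_matrix_unit_index del: index_mult_mat cong: sum.cong)
      then show ?thesis using c il by simp
    qed
    then show ?thesis by blast
  qed
  then obtain c where c: "\<And>i j k l. i < n \<Longrightarrow> j < n \<Longrightarrow> k < n \<Longrightarrow> l < n \<Longrightarrow>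
      S i j k l = (if i = l then c j k else 0)" by metis
  \<comment> \<open>Inverting g exchanges the two index pairs, so the scalar \<open>c j k\<close>
    inherits a delta in j and k from the one in i and l.\<close>
  have sym: "S i j k l = S k l i j" for i j k l
    unfolding S_def by (subst sum.reindex_bij_betw[OF bij_betw_inv, symmetric])
      (auto intro!: sum.cong simp: mult.commute)
  have c0: "c j k = (if j = k then c 0 0 else 0)" if "j < n" "k < n" for j k
  proof -
    have "0 < n" using that by simp
    then show ?thesis using c[of 0 j k 0] c[of k 0 0 j] sym[of 0 j k 0] that by auto
  qed
  have "of_nat n * c 0 0 = of_nat (Coset.order G)"
  proof -
    have n: "0 < n" using i by simp
    \<comment> \<open>Summing over the inner index contracts to an entry of
      \<open>\<rho> g * \<rho> (inv g)\<close>, the identity; this fixes the remaining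
      constant.\<close>
    have "(\<Sum>j<n. S 0 j j 0) = (\<Sum>g\<in>carrier G. (\<rho> g * \<rho> (inv g)) $$ (0, 0))"
      unfolding S_def using n rc
      by (subst sum.swap) (simp add: index_mult_mat_sum[of _ n n _ n] del: index_mult_mat cong: sum.cong)
    also have "\<dots> = (\<Sum>g\<in>carrier G. 1)"
      using n by (simp add: representation_inv[OF is_group rr] del: index_mult_mat cong: sum.cong)
    finally have "(\<Sum>j<n. S 0 j j 0) = of_nat (Coset.order G)" by (simp add: Coset.order_def)
    moreover have "(\<Sum>j<n. S 0 j j 0) = (\<Sum>j<n. c 0 0)"
    proof (rule sum.cong[OF refl])
      fix j assume "j \<in> {..<n}"
      then show "S 0 j j 0 = c 0 0" using c[OF n _ _ n, of j j] c0[of j j] by simp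
    qed
    ultimately show ?thesis by simp
  qed
  then have "of_nat n * S i j k l = (if i = l \<and> j = k then of_nat (Coset.order G) else 0)"
    using c[OF i] c0[OF i(2,3)] by auto
  then show ?thesis by (simp only: S_def)
qed

end

section \<open>The group algebra and the central idempotent of a representation\<close>

lemma smult_smult_mat: "a \<cdot>\<^sub>m (b \<cdot>\<^sub>m A) = (a * b :: 'f::comm_ring_1) \<cdot>\<^sub>m A"
  by (rule eq_matI) (simp_all add: mult.assoc)

lemma one_smult_mat [simp]: "(1 :: 'f::comm_ring_1) \<cdot>\<^sub>m A = A"
  by (rule eq_matI) simp_all

lemma (in group) mult_inv_cancel:
  assumes "a \<in> carrier G" "b \<in> carrier G"
  shows "a \<otimes> inv b \<otimes> b = a" "a \<otimes> b \<otimes> inv b = a" "inv a \<otimes> (a \<otimes> b) = b" "a \<otimes> (inv a \<otimes> b) = b"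
  using assms by (simp_all add: m_assoc) (simp_all add: m_assoc[symmetric])

section \<open>Convolution in the group algebra\<close>

context finite_group
begin

lemma group_algebra_mult_eq:
  "a \<otimes>\<^bsub>group_algebra G\<^esub> b =
    (\<lambda>g. if g \<in> carrier G then \<Sum>h\<in>carrier G. a h * b (inv h \<otimes> g) else 0)"
proof
  fix g
  have "(\<Sum>(h, k) | h \<in> carrier G \<and> k \<in> carrier G \<and> h \<otimes> k = g. a h * b k) =
      (if g \<in> carrier G then \<Sum>h\<in>carrier G. a h * b (inv h \<otimes> g) else 0)"
  proof (cases "g \<in> carrier G")
    case True
    have "(\<Sum>h\<in>carrier G. a h * b (inv h \<otimes> g)) =
        (\<Sum>(h, k) | h \<in> carrier G \<and> k \<in> carrier G \<and> h \<otimes> k = g. a h * b k)"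
      by (rule sum.reindex_bij_witness[of _ fst "\<lambda>h. (h, inv h \<otimes> g)"])
        (use True in \<open>auto simp: m_assoc[symmetric] inv_solve_left\<close>)
    then show ?thesis using True by simp
  next
    case False
    have "(\<Sum>(h, k) | h \<in> carrier G \<and> k \<in> carrier G \<and> h \<otimes> k = g. a h * b k) = 0"
      by (rule sum.neutral) (use False in auto)
    then show ?thesis using False by simp
  qed
  then show "(a \<otimes>\<^bsub>group_algebra G\<^esub> b) g =
      (if g \<in> carrier G then \<Sum>h\<in>carrier G. a h * b (inv h \<otimes> g) else 0)"
    by (simp add: group_algebra_def)
qed

text \<open>This form solves h k = g for h, the previous one for k. Having both makes associativity
  a swap of two sums and centrality of a class function a comparison of summands.\<close>

lemma group_algebra_mult_eq':
  assumes "g \<in> carrier G"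
  shows "(a \<otimes>\<^bsub>group_algebra G\<^esub> b) g = (\<Sum>k\<in>carrier G. a (g \<otimes> inv k) * b k)"
proof -
  have "(\<Sum>h\<in>carrier G. a h * b (inv h \<otimes> g)) = (\<Sum>k\<in>carrier G. a (g \<otimes> inv k) * b k)"
    by (rule sum.reindex_bij_witness[of _ "\<lambda>k. g \<otimes> inv k" "\<lambda>h. inv h \<otimes> g"])
      (use assms in \<open>auto simp: inv_mult_group mult_inv_cancel\<close>)
  then show ?thesis using assms by (simp add: group_algebra_mult_eq)
qed

end

lemma group_algebra_simps:
  "carrier (group_algebra G) = {a. \<forall>g. g \<notin> carrier G \<longrightarrow> a g = 0}"
  "\<zero>\<^bsub>group_algebra G\<^esub> = (\<lambda>g. 0)"
  "\<one>\<^bsub>group_algebra G\<^esub> = (\<lambda>g. if g = \<one>\<^bsub>G\<^esub> then 1 else 0)"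
  "a \<oplus>\<^bsub>group_algebra G\<^esub> b = (\<lambda>g. a g + b g)"
  "c \<odot>\<^bsub>group_algebra G\<^esub> a = (\<lambda>g. c * a g)"
  by (simp_all add: group_algebra_def)

context finite_group
begin

lemma group_algebra_ring: "ring (group_algebra G :: ('f::field, 'a \<Rightarrow> 'f) module)" (is "ring ?A")
proof (rule ringI)
  show "abelian_group ?A"
  proof (rule abelian_groupI)
    fix a :: "'a \<Rightarrow> 'f" assume "a \<in> carrier ?A"
    then show "\<exists>b\<in>carrier ?A. b \<oplus>\<^bsub>?A\<^esub> a = \<zero>\<^bsub>?A\<^esub>"
      by (intro bexI[of _ "\<lambda>g. - a g"]) (auto simp: group_algebra_simps)
  qed (auto simp: group_algebra_simps algebra_simps)
  show "Group.monoid ?A"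
  proof (rule monoidI)
    fix a b c :: "'a \<Rightarrow> 'f"
    show "a \<otimes>\<^bsub>?A\<^esub> b \<otimes>\<^bsub>?A\<^esub> c = a \<otimes>\<^bsub>?A\<^esub> (b \<otimes>\<^bsub>?A\<^esub> c)"
    proof
      fix g
      show "(a \<otimes>\<^bsub>?A\<^esub> b \<otimes>\<^bsub>?A\<^esub> c) g = (a \<otimes>\<^bsub>?A\<^esub> (b \<otimes>\<^bsub>?A\<^esub> c)) g"
      proof (cases "g \<in> carrier G")
        case True
        have "(a \<otimes>\<^bsub>?A\<^esub> b \<otimes>\<^bsub>?A\<^esub> c) g =
            (\<Sum>k\<in>carrier G. \<Sum>h\<in>carrier G. a h * (b (inv h \<otimes> (g \<otimes> inv k)) * c k))"
          using True unfolding group_algebra_mult_eq'[OF True]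
          by (auto intro!: sum.cong simp: group_algebra_mult_eq sum_distrib_right mult.assoc)
        also have "\<dots> = (\<Sum>h\<in>carrier G. \<Sum>k\<in>carrier G. a h * (b (inv h \<otimes> (g \<otimes> inv k)) * c k))"
          by (rule sum.swap)
        also have "\<dots> = (\<Sum>h\<in>carrier G. a h * (b \<otimes>\<^bsub>?A\<^esub> c) (inv h \<otimes> g))"
        proof (rule sum.cong[OF refl])
          fix h assume h: "h \<in> carrier G"
          then have "inv h \<otimes> g \<in> carrier G" using True by simp
          then show "(\<Sum>k\<in>carrier G. a h * (b (inv h \<otimes> (g \<otimes> inv k)) * c k)) =
              a h * (b \<otimes>\<^bsub>?A\<^esub> c) (inv h \<otimes> g)"
            using True h by (simp add: group_algebra_mult_eq' sum_distrib_left m_assoc cong: sum.cong)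
        qed
        finally show ?thesis using True by (simp add: group_algebra_mult_eq)
      qed (simp add: group_algebra_mult_eq)
    qed
  next
    fix a :: "'a \<Rightarrow> 'f" assume a: "a \<in> carrier ?A"
    show "\<one>\<^bsub>?A\<^esub> \<otimes>\<^bsub>?A\<^esub> a = a"
    proof
      fix g
      have "(\<Sum>h\<in>carrier G. (if h = \<one> then 1 else 0) * a (inv h \<otimes> g)) =
          (\<Sum>h\<in>carrier G. if h = \<one> then a (inv h \<otimes> g) else 0)"
        by (intro sum.cong) auto
      then show "(\<one>\<^bsub>?A\<^esub> \<otimes>\<^bsub>?A\<^esub> a) g = a g"
        using a finite_carrier by (auto simp: group_algebra_mult_eq group_algebra_simps)
    qed
    show "a \<otimes>\<^bsub>?A\<^esub> \<one>\<^bsub>?A\<^esub> = a"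
    proof
      fix g
      show "(a \<otimes>\<^bsub>?A\<^esub> \<one>\<^bsub>?A\<^esub>) g = a g"
      proof (cases "g \<in> carrier G")
        case True
        have "(\<Sum>k\<in>carrier G. a (g \<otimes> inv k) * (if k = \<one> then 1 else 0)) =
            (\<Sum>k\<in>carrier G. if k = \<one> then a (g \<otimes> inv k) else 0)"
          by (intro sum.cong) auto
        then show ?thesis
          using True finite_carrier by (simp add: group_algebra_mult_eq' group_algebra_simps)
      qed (use a in \<open>simp add: group_algebra_mult_eq group_algebra_simps\<close>)
    qed
  qed (auto simp: group_algebra_mult_eq group_algebra_simps)
qed (auto simp: group_algebra_mult_eq group_algebra_simps sum.distrib algebra_simps)

lemma group_algebra_finsum:
  fixes f :: "'i \<Rightarrow> 'a \<Rightarrow> 'f::field"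
  assumes "finite I" "\<And>i. i \<in> I \<Longrightarrow> f i \<in> carrier (group_algebra G)"
  shows "(\<Oplus>\<^bsub>group_algebra G\<^esub>i\<in>I. f i) = (\<lambda>g. \<Sum>i\<in>I. f i g)"
proof -
  interpret A: ring "group_algebra G :: ('f, 'a \<Rightarrow> 'f) module" by (rule group_algebra_ring)
  show ?thesis using assms
    by (induction I rule: finite_induct)
      (simp_all add: A.finsum_insert Pi_def, simp_all add: group_algebra_simps)
qed

section \<open>The action of the group algebra on a representation\<close>

lemma algebra_action_eq_mat_sum:
  assumes "representation G n \<rho>"
  shows "algebra_action G n \<rho> a = mat_sum n (carrier G) (\<lambda>g. a g \<cdot>\<^sub>m \<rho> g)"
proof (rule eq_matI)
  fix i j assume "i < dim_row (mat_sum n (carrier G) (\<lambda>g. a g \<cdot>\<^sub>m \<rho> g))"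
    "j < dim_col (mat_sum n (carrier G) (\<lambda>g. a g \<cdot>\<^sub>m \<rho> g))"
  then have ij: "i < n" "j < n" by simp_all
  have "(a g \<cdot>\<^sub>m \<rho> g) $$ (i, j) = a g * \<rho> g $$ (i, j)" if "g \<in> carrier G" for g
    using representation_carrier[OF is_group assms that] ij by simp
  then show "algebra_action G n \<rho> a $$ (i, j) = mat_sum n (carrier G) (\<lambda>g. a g \<cdot>\<^sub>m \<rho> g) $$ (i, j)"
    using ij by (simp add: algebra_action_def mat_sum_index)
qed (simp_all add: algebra_action_def)

lemma algebra_action_carrier [simp]: "algebra_action G n \<rho> a \<in> carrier_mat n n"
  by (simp add: algebra_action_def)

lemma algebra_action_mult:
  fixes \<rho> :: "'a \<Rightarrow> 'f::field mat"
  assumes r: "representation G n \<rho>"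
  shows "algebra_action G n \<rho> (a \<otimes>\<^bsub>group_algebra G\<^esub> b) = algebra_action G n \<rho> a * algebra_action G n \<rho> b"
proof (rule eq_matI)
  note rc = representation_carrier[OF is_group r]
  fix i j assume "i < dim_row (algebra_action G n \<rho> a * algebra_action G n \<rho> b)"
    "j < dim_col (algebra_action G n \<rho> a * algebra_action G n \<rho> b)"
  then have ij: "i < n" "j < n" by (simp_all add: algebra_action_def)
  have "algebra_action G n \<rho> a * algebra_action G n \<rho> b =
      mat_sum n (carrier G) (\<lambda>h. (a h \<cdot>\<^sub>m \<rho> h) * algebra_action G n \<rho> b)"
    unfolding algebra_action_eq_mat_sum[OF r, of a] using rc by (intro mat_sum_mult) auto
  also have "\<dots> = mat_sum n (carrier G) (\<lambda>h. mat_sum n (carrier G) (\<lambda>k. (a h \<cdot>\<^sub>m \<rho> h) * (b k \<cdot>\<^sub>m \<rho> k)))"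
    unfolding algebra_action_eq_mat_sum[OF r, of b] using rc by (intro mat_sum_cong mult_mat_sum) auto
  finally have "(algebra_action G n \<rho> a * algebra_action G n \<rho> b) $$ (i, j) =
      (\<Sum>h\<in>carrier G. \<Sum>k\<in>carrier G. ((a h \<cdot>\<^sub>m \<rho> h) * (b k \<cdot>\<^sub>m \<rho> k)) $$ (i, j))"
    using ij by (simp add: mat_sum_index)
  also have "\<dots> = (\<Sum>h\<in>carrier G. \<Sum>k\<in>carrier G. a h * b k * \<rho> (h \<otimes> k) $$ (i, j))"
  proof (intro sum.cong refl)
    fix h k assume hk: "h \<in> carrier G" "k \<in> carrier G"
    then have "(a h \<cdot>\<^sub>m \<rho> h) * (b k \<cdot>\<^sub>m \<rho> k) = (a h * b k) \<cdot>\<^sub>m \<rho> (h \<otimes> k)"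
      using rc[OF hk(1)] rc[OF hk(2)]
      by (simp add: representation_mult[OF is_group r] mult_smult_distrib[of _ n n _ n]
          mult_smult_assoc_mat[of _ n n _ n] smult_smult_mat mult.commute)
    then show "((a h \<cdot>\<^sub>m \<rho> h) * (b k \<cdot>\<^sub>m \<rho> k)) $$ (i, j) = a h * b k * \<rho> (h \<otimes> k) $$ (i, j)"
      using rc[of "h \<otimes> k"] hk ij by (simp del: index_mult_mat)
  qed
  also have "\<dots> = (\<Sum>h\<in>carrier G. \<Sum>g\<in>carrier G. a h * b (inv h \<otimes> g) * \<rho> g $$ (i, j))"
  proof (rule sum.cong[OF refl])
    fix h assume h: "h \<in> carrier G"
    show "(\<Sum>k\<in>carrier G. a h * b k * \<rho> (h \<otimes> k) $$ (i, j)) =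
        (\<Sum>g\<in>carrier G. a h * b (inv h \<otimes> g) * \<rho> g $$ (i, j))"
      using h by (subst sum.reindex_bij_betw[OF bij_betw_mult_left[OF h], symmetric])
        (auto intro!: sum.cong simp: m_assoc[symmetric])
  qed
  also have "\<dots> = algebra_action G n \<rho> (a \<otimes>\<^bsub>group_algebra G\<^esub> b) $$ (i, j)"
    using ij by (subst sum.swap)
      (simp add: algebra_action_def group_algebra_mult_eq sum_distrib_right cong: sum.cong)
  finally show "algebra_action G n \<rho> (a \<otimes>\<^bsub>group_algebra G\<^esub> b) $$ (i, j) =
      (algebra_action G n \<rho> a * algebra_action G n \<rho> b) $$ (i, j)" by simp
qed (simp_all add: algebra_action_def)

lemma algebra_action_single:
  fixes \<rho> :: "'a \<Rightarrow> 'f::field mat"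
  assumes r: "representation G n \<rho>" and g: "g \<in> carrier G"
  shows "algebra_action G n \<rho> (\<lambda>h. if h = g then 1 else 0) = \<rho> g"
proof (rule eq_matI)
  note rc = representation_carrier[OF is_group r g]
  fix i j assume "i < dim_row (\<rho> g)" "j < dim_col (\<rho> g)"
  then have ij: "i < n" "j < n" using rc by auto
  have "(\<Sum>h\<in>carrier G. (if h = g then 1 else 0) * \<rho> h $$ (i, j)) =
      (\<Sum>h\<in>carrier G. if h = g then \<rho> h $$ (i, j) else 0)"
    by (intro sum.cong) auto
  then show "algebra_action G n \<rho> (\<lambda>h. if h = g then 1 else 0) $$ (i, j) = \<rho> g $$ (i, j)"
    using ij g finite_carrier by (simp add: algebra_action_def)
qed (use representation_carrier[OF is_group r g] in \<open>auto simp: algebra_action_def\<close>)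

text \<open>Commuting with the basis element at g becomes commuting with \<rho> g once the action is
  applied, so Schur's lemma takes over.\<close>

lemma central_acts_as_scalar:
  fixes \<rho> :: "'a \<Rightarrow> 'f::alg_closed_field mat"
  assumes r: "irreducible_representation G n \<rho>"
    and c: "\<And>b. b \<in> carrier (group_algebra G) \<Longrightarrow>
      a \<otimes>\<^bsub>group_algebra G\<^esub> b = b \<otimes>\<^bsub>group_algebra G\<^esub> a"
  obtains w where "algebra_action G n \<rho> a = w \<cdot>\<^sub>m 1\<^sub>m n"
proof (rule schur_scalar[OF is_group r algebra_action_carrier])
  have rr: "representation G n \<rho>" using r by (simp add: irreducible_representation_def)
  fix g assume g: "g \<in> carrier G"
  let ?d = "\<lambda>h. if h = g then 1 else 0 :: 'f"
  have "?d \<in> carrier (group_algebra G)" using g by (auto simp: group_algebra_simps)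
  then have "algebra_action G n \<rho> (a \<otimes>\<^bsub>group_algebra G\<^esub> ?d) =
      algebra_action G n \<rho> (?d \<otimes>\<^bsub>group_algebra G\<^esub> a)" using c by simp
  then show "\<rho> g * algebra_action G n \<rho> a = algebra_action G n \<rho> a * \<rho> g"
    by (simp add: algebra_action_mult[OF rr] algebra_action_single[OF rr g])
qed

text \<open>The two convolution formulas evaluate f at \<open>g \<otimes> inv k\<close> and at
  \<open>inv k \<otimes> g\<close>, which a class function does not distinguish.\<close>

lemma class_function_central:
  assumes "\<And>g h. g \<in> carrier G \<Longrightarrow> h \<in> carrier G \<Longrightarrow> f (g \<otimes> h) = f (h \<otimes> g)"
  shows "f \<otimes>\<^bsub>group_algebra G\<^esub> a = a \<otimes>\<^bsub>group_algebra G\<^esub> f"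
proof
  fix g
  show "(f \<otimes>\<^bsub>group_algebra G\<^esub> a) g = (a \<otimes>\<^bsub>group_algebra G\<^esub> f) g"
  proof (cases "g \<in> carrier G")
    case True
    have "(\<Sum>k\<in>carrier G. f (g \<otimes> inv k) * a k) = (\<Sum>k\<in>carrier G. a k * f (inv k \<otimes> g))"
      using assms True by (intro sum.cong) (auto simp: mult.commute)
    then show ?thesis
      using True by (simp add: group_algebra_mult_eq'[of g f] group_algebra_mult_eq[of a])
  qed (simp add: group_algebra_mult_eq)
qed

end

section \<open>Characters and the idempotents they define\<close>

definition character :: "nat \<Rightarrow> ('g \<Rightarrow> 'f::comm_ring_1 mat) \<Rightarrow> 'g \<Rightarrow> 'f" where
  "character n \<rho> g = (\<Sum>i<n. \<rho> g $$ (i, i))"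

lemma trace_mult_commute:
  fixes A B :: "'f::comm_ring_1 mat"
  assumes "A \<in> carrier_mat n n" "B \<in> carrier_mat n n"
  shows "(\<Sum>i<n. (A * B) $$ (i, i)) = (\<Sum>i<n. (B * A) $$ (i, i))"
proof -
  have "(\<Sum>i<n. (A * B) $$ (i, i)) = (\<Sum>i<n. \<Sum>l<n. A $$ (i, l) * B $$ (l, i))"
    using assms by (intro sum.cong) (auto simp: index_mult_mat_sum[of _ n n _ n] simp del: index_mult_mat)
  also have "\<dots> = (\<Sum>l<n. \<Sum>i<n. B $$ (l, i) * A $$ (i, l))"
    by (subst sum.swap) (simp add: mult.commute)
  also have "\<dots> = (\<Sum>i<n. (B * A) $$ (i, i))"
    using assms by (intro sum.cong) (auto simp: index_mult_mat_sum[of _ n n _ n] simp del: index_mult_mat)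
  finally show ?thesis .
qed

text \<open>The value 0 outside the carrier lets the idempotent of a representation of H be read
  unchanged as an element of F[G].\<close>

definition character_idempotent ::
    "('g, 'm) monoid_scheme \<Rightarrow> nat \<Rightarrow> ('g \<Rightarrow> 'f::field mat) \<Rightarrow> 'g \<Rightarrow> 'f" where
  "character_idempotent G n \<rho> g =
    (if g \<in> carrier G then of_nat n / of_nat (Coset.order G) * character n \<rho> (inv\<^bsub>G\<^esub> g) else 0)"

context finite_group
begin

lemma character_mult_commute:
  assumes "representation G n \<rho>" "g \<in> carrier G" "h \<in> carrier G"
  shows "character n \<rho> (g \<otimes> h) = character n \<rho> (h \<otimes> g)"
  using assms trace_mult_commute[of "\<rho> g" n "\<rho> h"] representation_carrier[OF is_group assms(1)]
  by (simp add: character_def representation_mult[OF is_group] del: index_mult_mat)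

lemma character_idempotent_carrier: "character_idempotent G n \<rho> \<in> carrier (group_algebra G)"
  by (simp add: character_idempotent_def group_algebra_simps)

lemma character_idempotent_central:
  assumes "representation G n \<rho>"
  shows "character_idempotent G n \<rho> \<otimes>\<^bsub>group_algebra G\<^esub> a = a \<otimes>\<^bsub>group_algebra G\<^esub> character_idempotent G n \<rho>"
  by (rule class_function_central)
    (simp add: character_idempotent_def inv_mult_group character_mult_commute[OF assms])

text \<open>The coefficient of the product at g is, up to n / |G|, the trace of
  \<open>\<rho> (inv g)\<close> times the action of a. For a scalar action w this is w times the
  character value, so the product is determined by the action on \<rho> alone.\<close>

lemma mult_character_idempotent:
  fixes \<rho> :: "'a \<Rightarrow> 'f::field mat"
  assumes r: "representation G n \<rho>" and a: "algebra_action G n \<rho> a = w \<cdot>\<^sub>m 1\<^sub>m n"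
  shows "a \<otimes>\<^bsub>group_algebra G\<^esub> character_idempotent G n \<rho> =
    w \<odot>\<^bsub>group_algebra G\<^esub> character_idempotent G n \<rho>"
proof
  note rc = representation_carrier[OF is_group r]
  fix g
  show "(a \<otimes>\<^bsub>group_algebra G\<^esub> character_idempotent G n \<rho>) g =
    (w \<odot>\<^bsub>group_algebra G\<^esub> character_idempotent G n \<rho>) g"
  proof (cases "g \<in> carrier G")
    case True
    let ?c = "of_nat n / of_nat (Coset.order G) :: 'f"
    have "(a \<otimes>\<^bsub>group_algebra G\<^esub> character_idempotent G n \<rho>) g =
        (\<Sum>h\<in>carrier G. a h * (?c * character n \<rho> (inv g \<otimes> h)))"
      using True by (auto intro!: sum.cong simp: group_algebra_mult_eq character_idempotent_def inv_mult_group)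
    also have "\<dots> = ?c * (\<Sum>h\<in>carrier G. \<Sum>i<n. a h * \<rho> (inv g \<otimes> h) $$ (i, i))"
      by (simp add: character_def sum_distrib_left mult_ac)
    also have "(\<Sum>h\<in>carrier G. \<Sum>i<n. a h * \<rho> (inv g \<otimes> h) $$ (i, i)) =
        (\<Sum>i<n. mat_sum n (carrier G) (\<lambda>h. \<rho> (inv g) * (a h \<cdot>\<^sub>m \<rho> h)) $$ (i, i))"
    proof (subst sum.swap, intro sum.cong refl)
      fix i assume i: "i \<in> {..<n}"
      have "a h * \<rho> (inv g \<otimes> h) $$ (i, i) = (\<rho> (inv g) * (a h \<cdot>\<^sub>m \<rho> h)) $$ (i, i)"
        if h: "h \<in> carrier G" for h
      proof -
        have "\<rho> (inv g) * (a h \<cdot>\<^sub>m \<rho> h) = a h \<cdot>\<^sub>m \<rho> (inv g \<otimes> h)"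
          using True h rc by (simp add: representation_mult[OF is_group r] mult_smult_distrib[of _ n n _ n])
        moreover have "\<rho> (inv g \<otimes> h) \<in> carrier_mat n n" using True h rc by simp
        ultimately show ?thesis using i by simp
      qed
      then show "(\<Sum>h\<in>carrier G. a h * \<rho> (inv g \<otimes> h) $$ (i, i)) =
          mat_sum n (carrier G) (\<lambda>h. \<rho> (inv g) * (a h \<cdot>\<^sub>m \<rho> h)) $$ (i, i)"
        using i by (simp add: mat_sum_index del: index_mult_mat cong: sum.cong)
    qed
    also have "mat_sum n (carrier G) (\<lambda>h. \<rho> (inv g) * (a h \<cdot>\<^sub>m \<rho> h)) = \<rho> (inv g) * algebra_action G n \<rho> a"
      unfolding algebra_action_eq_mat_sum[OF r] using True rc by (intro mult_mat_sum[symmetric]) auto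
    also have "\<dots> = w \<cdot>\<^sub>m \<rho> (inv g)"
      using True rc[of "inv g"] by (simp add: a mult_smult_distrib[of _ n n _ n])
    also have "(\<Sum>i<n. (w \<cdot>\<^sub>m \<rho> (inv g)) $$ (i, i)) = w * character n \<rho> (inv g)"
      using rc[of "inv g"] True by (simp add: character_def sum_distrib_left)
    finally show ?thesis
      using True by (simp add: character_idempotent_def[of G n \<rho> g] group_algebra_simps mult_ac)
  qed (simp add: group_algebra_mult_eq group_algebra_simps character_idempotent_def)
qed

text \<open>In the (i, j) entry the character contributes the diagonal coefficients (k, k);
  orthogonality leaves only k = i = j, with the value |G| cancelling the denominator.\<close>

lemma algebra_action_character_idempotent:
  fixes \<rho> :: "'a \<Rightarrow> 'f::alg_closed_field mat"
  assumes r: "irreducible_representation G n \<rho>" and ord: "of_nat (Coset.order G) \<noteq> (0 :: 'f)"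
  shows "algebra_action G n \<rho> (character_idempotent G n \<rho>) = 1\<^sub>m n"
proof (rule eq_matI)
  fix i j assume "i < dim_row (1\<^sub>m n :: 'f mat)" "j < dim_col (1\<^sub>m n :: 'f mat)"
  then have ij: "i < n" "j < n" by auto
  have "algebra_action G n \<rho> (character_idempotent G n \<rho>) $$ (i, j) =
      of_nat n / of_nat (Coset.order G) *
        (\<Sum>g\<in>carrier G. \<Sum>k<n. \<rho> g $$ (i, j) * \<rho> (inv g) $$ (k, k))"
    using ij by (simp add: algebra_action_def character_idempotent_def character_def
      sum_distrib_left sum_distrib_right mult_ac cong: sum.cong)
  also have "\<dots> = (\<Sum>k<n. of_nat n * (\<Sum>g\<in>carrier G. \<rho> g $$ (i, j) * \<rho> (inv g) $$ (k, k)))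
      / of_nat (Coset.order G)"
    by (subst sum.swap) (simp add: sum_distrib_left sum_divide_distrib)
  also have "\<dots> = (\<Sum>k<n. if k = i then if j = i then of_nat (Coset.order G) else 0 else 0)
      / of_nat (Coset.order G)"
    using ij by (intro arg_cong2[where f="(/)"] sum.cong refl) (auto simp: schur_orthogonality[OF r])
  also have "\<dots> = 1\<^sub>m n $$ (i, j)" using ij ord by auto
  finally show "algebra_action G n \<rho> (character_idempotent G n \<rho>) $$ (i, j) = 1\<^sub>m n $$ (i, j)" .
qed (simp_all add: algebra_action_def)

text \<open>If e splits as e1 + e2, then e1 = e1 e = w e, where w is the scalar by which e1 acts; w
  is an idempotent of a field, so it is 0 or 1. If f is another primitive central idempotent acting
  as the identity, then f e = e, so f = e + (f - e) is an orthogonal central splitting in which e is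
  nonzero, and f - e vanishes.\<close>

theorem representation_idempotent_eq:
  fixes \<rho> :: "'a \<Rightarrow> 'f::alg_closed_field mat"
  assumes r: "irreducible_representation G n \<rho>" and ord: "of_nat (Coset.order G) \<noteq> (0 :: 'f)"
  shows "representation_idempotent G n \<rho> = character_idempotent G n \<rho>"
proof -
  define A where "A = (group_algebra G :: ('f, 'a \<Rightarrow> 'f) module)"
  define e where "e = character_idempotent G n \<rho>"
  interpret A: ring A unfolding A_def by (rule group_algebra_ring)
  have rr: "representation G n \<rho>" and n: "n > 0"
    using r by (auto simp: irreducible_representation_def)
  have smult_0: "0 \<odot>\<^bsub>A\<^esub> a = \<zero>\<^bsub>A\<^esub>" and smult_1: "1 \<odot>\<^bsub>A\<^esub> a = a" for a
    by (simp_all add: A_def group_algebra_simps)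
  have eA: "e \<in> carrier A" by (simp add: e_def A_def character_idempotent_carrier)
  have act: "algebra_action G n \<rho> e = 1 \<cdot>\<^sub>m 1\<^sub>m n"
    using algebra_action_character_idempotent[OF r ord] by (auto simp: e_def intro!: eq_matI)
  have mult_e: "a \<otimes>\<^bsub>A\<^esub> e = w \<odot>\<^bsub>A\<^esub> e" if "algebra_action G n \<rho> a = w \<cdot>\<^sub>m 1\<^sub>m n" for a w
    using mult_character_idempotent[OF rr that] by (simp add: A_def e_def)
  have ci: "central_idempotent A e"
    unfolding central_idempotent_def
  proof (intro conjI ballI eA)
    show "e \<otimes>\<^bsub>A\<^esub> e = e" using mult_e[OF act] by (simp only: smult_1)
    show "e \<otimes>\<^bsub>A\<^esub> a = a \<otimes>\<^bsub>A\<^esub> e" for a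
      unfolding A_def e_def by (rule character_idempotent_central[OF rr])
  qed
  have e0: "e \<noteq> \<zero>\<^bsub>A\<^esub>"
  proof
    assume "e = \<zero>\<^bsub>A\<^esub>"
    then have "algebra_action G n \<rho> e = 0\<^sub>m n n"
      by (intro eq_matI) (simp_all add: algebra_action_def A_def group_algebra_simps)
    then have "(1 \<cdot>\<^sub>m 1\<^sub>m n) $$ (0, 0) = (0\<^sub>m n n $$ (0, 0) :: 'f)" using act by simp
    then show False using n by simp
  qed
  have scalar: "\<exists>w. algebra_action G n \<rho> a = w \<cdot>\<^sub>m 1\<^sub>m n" if "central_idempotent A a" for a
  proof (rule central_acts_as_scalar[OF r, of a])
    show "a \<otimes>\<^bsub>group_algebra G\<^esub> b = b \<otimes>\<^bsub>group_algebra G\<^esub> a" if "b \<in> carrier (group_algebra G)" for b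
      using that \<open>central_idempotent A a\<close> unfolding central_idempotent_def A_def by blast
  qed blast
  have prim: "primitive_central_idempotent A e"
    unfolding primitive_central_idempotent_def
  proof (intro conjI allI impI ci e0)
    fix e1 e2 assume e1: "central_idempotent A e1" and e2: "central_idempotent A e2"
      and o: "e1 \<otimes>\<^bsub>A\<^esub> e2 = \<zero>\<^bsub>A\<^esub>" and s: "e = e1 \<oplus>\<^bsub>A\<^esub> e2"
    have c: "e1 \<in> carrier A" "e2 \<in> carrier A" using e1 e2 by (auto simp: central_idempotent_def)
    obtain w where w: "algebra_action G n \<rho> e1 = w \<cdot>\<^sub>m 1\<^sub>m n" using scalar[OF e1] by blast
    have "e1 = e1 \<otimes>\<^bsub>A\<^esub> e"
      using e1 o c by (simp add: s A.r_distr central_idempotent_def)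
    then have e1_eq: "e1 = w \<odot>\<^bsub>A\<^esub> e" using mult_e[OF w] by simp
    have "e1 \<otimes>\<^bsub>A\<^esub> e1 = e1" using e1 by (simp add: central_idempotent_def)
    then have "algebra_action G n \<rho> e1 * algebra_action G n \<rho> e1 = algebra_action G n \<rho> e1"
      using algebra_action_mult[OF rr, of e1 e1] by (simp add: A_def)
    then have "((w \<cdot>\<^sub>m 1\<^sub>m n) * (w \<cdot>\<^sub>m 1\<^sub>m n)) $$ (0, 0) = (w \<cdot>\<^sub>m 1\<^sub>m n) $$ (0, 0)" using w by simp
    also have "(w \<cdot>\<^sub>m 1\<^sub>m n) * (w \<cdot>\<^sub>m 1\<^sub>m n) = (w * w) \<cdot>\<^sub>m 1\<^sub>m n"
      by (simp add: mult_smult_distrib[of _ n n _ n] smult_smult_mat)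
    finally have "w * w = w" using n by simp
    then consider "w = 0" | "w = 1" by (metis mult_cancel_left2)
    then show "e1 = \<zero>\<^bsub>A\<^esub> \<or> e2 = \<zero>\<^bsub>A\<^esub>"
    proof cases
      case 1 then show ?thesis using e1_eq smult_0 by simp
    next
      case 2
      then have "e1 \<oplus>\<^bsub>A\<^esub> e2 = e1 \<oplus>\<^bsub>A\<^esub> \<zero>\<^bsub>A\<^esub>" using e1_eq smult_1 s c by simp
      then show ?thesis using c A.r_neg1[of e1 e2] A.r_neg1[of e1 "\<zero>\<^bsub>A\<^esub>"] by simp
    qed
  qed
  have uniq: "f = e" if f: "primitive_central_idempotent A f" "algebra_action G n \<rho> f = 1\<^sub>m n" for f
  proof -
    have fc: "central_idempotent A f" using f(1) by (simp add: primitive_central_idempotent_def)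
    then have fA: "f \<in> carrier A" and ff: "f \<otimes>\<^bsub>A\<^esub> f = f"
      and fcomm: "\<And>a. a \<in> carrier A \<Longrightarrow> f \<otimes>\<^bsub>A\<^esub> a = a \<otimes>\<^bsub>A\<^esub> f"
      by (auto simp: central_idempotent_def)
    have fe: "f \<otimes>\<^bsub>A\<^esub> e = e" using mult_e[of f 1] f(2) by (simp add: smult_1)
    have ef: "e \<otimes>\<^bsub>A\<^esub> f = e" using fcomm[OF eA] fe by simp
    have ee: "e \<otimes>\<^bsub>A\<^esub> e = e" using ci by (simp add: central_idempotent_def)
    define d where "d = f \<ominus>\<^bsub>A\<^esub> e"
    have dA: "d \<in> carrier A" using fA eA by (simp add: d_def)
    have df: "d \<otimes>\<^bsub>A\<^esub> f = d" and de: "d \<otimes>\<^bsub>A\<^esub> e = \<zero>\<^bsub>A\<^esub>" and ed: "e \<otimes>\<^bsub>A\<^esub> d = \<zero>\<^bsub>A\<^esub>"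
      using fA eA by (simp_all add: d_def A.minus_eq A.l_distr A.r_distr A.l_minus A.r_minus ff fe ef ee A.r_neg)
    have "d \<otimes>\<^bsub>A\<^esub> d = d"
    proof -
      have "d \<otimes>\<^bsub>A\<^esub> (f \<ominus>\<^bsub>A\<^esub> e) = d \<ominus>\<^bsub>A\<^esub> \<zero>\<^bsub>A\<^esub>"
        using fA eA dA by (simp add: A.minus_eq A.r_distr A.r_minus df de)
      then show ?thesis using dA by (simp add: d_def A.minus_eq)
    qed
    moreover have "d \<otimes>\<^bsub>A\<^esub> a = a \<otimes>\<^bsub>A\<^esub> d" if a: "a \<in> carrier A" for a
      using fA eA a fcomm[OF a] ci
      by (simp add: d_def A.minus_eq A.l_distr A.r_distr A.l_minus A.r_minus central_idempotent_def)
    ultimately have dc: "central_idempotent A d" using dA unfolding central_idempotent_def by blast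
    have "f = e \<oplus>\<^bsub>A\<^esub> d" using fA eA 
      by (simp add: d_def A.minus_eq A.a_comm[of f "\<ominus>\<^bsub>A\<^esub> e"] A.r_neg2)
    then have "e = \<zero>\<^bsub>A\<^esub> \<or> d = \<zero>\<^bsub>A\<^esub>"
      using f(1) ci dc ed unfolding primitive_central_idempotent_def by blast
    then have "d = \<zero>\<^bsub>A\<^esub>" using e0 by simp
    then show ?thesis using fA eA by (simp add: d_def)
  qed
  have "(THE e. primitive_central_idempotent A e \<and> algebra_action G n \<rho> e = 1\<^sub>m n) = e"
    
  proof (rule the_equality)
    show "primitive_central_idempotent A e \<and> algebra_action G n \<rho> e = 1\<^sub>m n"
      using prim act by simp
  qed (use uniq in blast)
  then show ?thesis by (simp add: representation_idempotent_def A_def e_def)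
qed

end

section \<open>Normal subgroups of prime index and extension of representations\<close>

lemma pow_mat_add:
  fixes A :: "'f::comm_ring_1 mat"
  assumes "A \<in> carrier_mat n n"
  shows "A ^\<^sub>m (k + l) = A ^\<^sub>m k * A ^\<^sub>m l"
  using assms by (induction l) (simp_all add: square_mult_assoc[of _ n])

lemma pow_mat_smult:
  fixes A :: "'f::comm_ring_1 mat"
  assumes "A \<in> carrier_mat n n"
  shows "(c \<cdot>\<^sub>m A) ^\<^sub>m k = c ^ k \<cdot>\<^sub>m A ^\<^sub>m k"
  using assms by (induction k)
    (simp_all add: mult_smult_distrib[of _ n n _ n] mult_smult_assoc_mat[of _ n n _ n] smult_smult_mat)

lemma det_pow_mat:
  fixes A :: "'f::comm_ring_1 mat"
  assumes "A \<in> carrier_mat n n"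
  shows "det (A ^\<^sub>m k) = det A ^ k"
  using assms by (induction k) (simp_all add: det_mult[of _ n])

text \<open>The quotient enters only through these element-wise facts: powers of x reach every
  coset, and x has order p modulo H. The next lemma extracts them from the hypotheses on
  G/H.\<close>

locale prime_index_subgroup = finite_group +
  fixes H x p
  assumes normal_H: "H \<lhd> G" and prime_p: "prime (p :: nat)" and x_closed: "x \<in> carrier G"
    and decompose: "\<And>g. g \<in> carrier G \<Longrightarrow> \<exists>k::nat. \<exists>h\<in>H. g = x [^] k \<otimes> h"
    and x_pow_mem: "\<And>k::nat. x [^] k \<in> H \<longleftrightarrow> p dvd k"
    and order_G: "Coset.order G = p * card H"

text \<open>The coset of x generates a group of order p and hence has order p; statements about
  powers of the coset then translate into statements about powers of x.\<close>

lemma (in finite_group) prime_index_subgroupI: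
  assumes n: "H \<lhd> G" and p: "prime p" and c: "card (rcosets H) = p" and x: "x \<in> carrier G"
    and gen: "generate (G Mod H) {x <# H} = carrier (G Mod H)"
  shows "prime_index_subgroup G H x p"
proof -
  interpret N: normal H G by fact
  interpret Q: group "G Mod H" by (rule N.factorgroup_is_group)
  \<comment> \<open>The elements of the factor group are right cosets, while the hypothesis speaks
    of a left coset; normality identifies them.\<close>
  have xc: "x <# H = H #> x" using N.coset_eq x by simp
  have xQ: "x <# H \<in> carrier (G Mod H)" using x by (auto simp: xc FactGroup_def RCOSETS_def)
  have pow: "(x <# H) [^]\<^bsub>G Mod H\<^esub> k = H #> (x [^] k)" for k :: nat
  proof (induction k)
    case 0
    show ?case by (simp add: FactGroup_def coset_mult_one N.subset)
  next
    case (Suc k)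
    then show ?case using x by (simp add: xc FactGroup_def N.rcos_sum)
  qed
  have fin: "finite (carrier (G Mod H))"
    using finite_carrier by (auto simp: FactGroup_def RCOSETS_def)
  have ord: "Q.ord (x <# H) = p"
    using Q.generate_pow_card[OF xQ] gen c by (simp add: FactGroup_def)
  have "x [^] k \<in> H \<longleftrightarrow> p dvd k" for k :: nat
  proof -
    have "H #> (x [^] k) = H \<longleftrightarrow> x [^] k \<in> H"
      using coset_join1[OF _ _ N.is_subgroup] coset_join2[OF _ N.is_subgroup] x by blast
    moreover have "H #> (x [^] k) = H \<longleftrightarrow> Q.ord (x <# H) dvd k"
      using Q.pow_eq_id[OF xQ, of k] by (simp only: pow) (simp add: FactGroup_def)
    ultimately show ?thesis using ord by simp
  qed
  moreover have "\<exists>k::nat. \<exists>h\<in>H. g = x [^] k \<otimes> h" if g: "g \<in> carrier G" for g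
  proof -
    have "H #> g \<in> carrier (G Mod H)" using g by (auto simp: FactGroup_def RCOSETS_def)
    also have "\<dots> = {(x <# H) [^]\<^bsub>G Mod H\<^esub> k |k. k \<in> (UNIV :: nat set)}"
      using Q.generate_pow_on_finite_carrier[OF fin xQ] gen by simp
    finally obtain k :: nat where "H #> g = H #> (x [^] k)" by (auto simp: pow)
    moreover have "g \<in> H #> g" using g N.is_subgroup by (rule rcos_self)
    ultimately have "g \<in> H #> (x [^] k)" by simp
    also have "\<dots> = (x [^] k) <# H" using N.coset_eq x by simp
    finally show ?thesis by (auto simp: l_coset_def)
  qed
  moreover have "Coset.order G = p * card H"
    using lagrange[OF N.is_subgroup] c by simp
  ultimately show ?thesis
    using n p x by unfold_locales auto
qed

section \<open>Representations of G and of H\<close>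

context prime_index_subgroup
begin

sublocale N: normal H G by (rule normal_H)

abbreviation K where "K \<equiv> G\<lparr>carrier := H\<rparr>"

lemma group_K: "Group.group K"
  by (rule subgroup.subgroup_is_group[OF N.is_subgroup is_group])

lemma H_closed: "h \<in> H \<Longrightarrow> h \<in> carrier G"
  using N.subset by blast

sublocale K: finite_group K
  using group_K finite_carrier N.subset finite_subset
  by (auto simp: finite_group_def finite_group_axioms_def)

lemma K_inv: "h \<in> H \<Longrightarrow> inv\<^bsub>K\<^esub> h = inv h"
  by (rule m_inv_consistent[OF N.is_subgroup])

lemma conj_closed: "g \<in> carrier G \<Longrightarrow> h \<in> H \<Longrightarrow> g \<otimes> h \<otimes> inv g \<in> H"
  by (rule N.inv_op_closed2)

lemma conj_closed': "g \<in> carrier G \<Longrightarrow> h \<in> H \<Longrightarrow> inv g \<otimes> h \<otimes> g \<in> H"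
  by (rule N.inv_op_closed1)

lemma p_pos: "p > 0"
  using prime_p prime_gt_0_nat by blast

lemma representation_K_iff:
  "representation K n \<eta> \<longleftrightarrow> (\<forall>h\<in>H. \<eta> h \<in> carrier_mat n n) \<and> \<eta> \<one> = 1\<^sub>m n \<and>
    (\<forall>g\<in>H. \<forall>h\<in>H. \<eta> (g \<otimes> h) = \<eta> g * (\<eta> h :: 'f::field mat))"
  using K.representation_iff[of n \<eta>] by simp

lemma representation_restrict: "representation G n \<rho> \<Longrightarrow> representation K n \<rho>"
  unfolding representation_K_iff representation_iff using H_closed by blast

text \<open>Each factor M moved past \<eta> conjugates the argument by x. The rightmost factor moves
  first, so the induction hypothesis is applied at the conjugate of h.\<close>

lemma pow_conj:
  fixes \<eta> :: "'a \<Rightarrow> 'f::field mat"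
  assumes e: "\<And>h. h \<in> H \<Longrightarrow> \<eta> h \<in> carrier_mat n n" and M: "M \<in> carrier_mat n n"
    and Mc: "\<And>h. h \<in> H \<Longrightarrow> M * \<eta> h = \<eta> (x \<otimes> h \<otimes> inv x) * M" and h: "h \<in> H"
  shows "M ^\<^sub>m k * \<eta> h = \<eta> (x [^] k \<otimes> h \<otimes> inv (x [^] k)) * M ^\<^sub>m k"
  using h
proof (induction k arbitrary: h)
  case 0
  then show ?case using M e[OF 0] H_closed by simp
next
  case (Suc k)
  let ?h = "x \<otimes> h \<otimes> inv x"
  have h': "?h \<in> H" using conj_closed Suc.prems x_closed by blast
  have h'': "x [^] k \<otimes> ?h \<otimes> inv (x [^] k) \<in> H" using conj_closed h' x_closed by blast
  have "M ^\<^sub>m Suc k * \<eta> h = M ^\<^sub>m k * (\<eta> ?h * M)"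
    using Suc.prems M e by (simp add: square_mult_assoc[of _ n] Mc)
  also have "\<dots> = \<eta> (x [^] k \<otimes> ?h \<otimes> inv (x [^] k)) * M ^\<^sub>m k * M"
    using Suc.IH[OF h'] M e[OF h'] by (simp add: square_mult_assoc[of _ n, symmetric])
  also have "\<dots> = \<eta> (x [^] k \<otimes> ?h \<otimes> inv (x [^] k)) * M ^\<^sub>m Suc k"
    using M e[OF h''] by (simp add: square_mult_assoc[of _ n])
  also have "x [^] k \<otimes> ?h \<otimes> inv (x [^] k) = x [^] Suc k \<otimes> h \<otimes> inv (x [^] Suc k)"
    using x_closed H_closed[OF Suc.prems] by (simp add: m_assoc inv_mult_group)
  finally show ?case .
qed

text \<open>The exponent is determined only modulo p, and any choice will do: it is used through
  powers of p-th roots of unity, through divisibility by p and through \<open>extension\<close>,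
  none of which sees the choice.\<close>

definition coset_exp :: "'a \<Rightarrow> nat" where
  "coset_exp g = (SOME k. inv (x [^] k) \<otimes> g \<in> H)"

lemma coset_exp:
  assumes "g \<in> carrier G"
  shows "inv (x [^] coset_exp g) \<otimes> g \<in> H"
proof -
  obtain k h where kh: "h \<in> H" "g = x [^] (k::nat) \<otimes> h" using decompose[OF assms] by blast
  then have "inv (x [^] k) \<otimes> g \<in> H" using x_closed H_closed by (simp add: mult_inv_cancel)
  then show ?thesis unfolding coset_exp_def by (rule someI)
qed

definition extension :: "'f::field mat \<Rightarrow> ('a \<Rightarrow> 'f mat) \<Rightarrow> 'a \<Rightarrow> 'f mat" where
  "extension M \<eta> g = M ^\<^sub>m coset_exp g * \<eta> (inv (x [^] coset_exp g) \<otimes> g)"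

section \<open>The extension determined by a matrix that implements conjugation by
  \<open>x\<close>\<close>

context
  fixes \<eta> :: "'a \<Rightarrow> 'f::field mat" and n M
  assumes eta: "representation K n \<eta>" and M: "M \<in> carrier_mat n n"
    and Mp: "M ^\<^sub>m p = \<eta> (x [^] p)"
    and Mc: "\<And>h. h \<in> H \<Longrightarrow> M * \<eta> h = \<eta> (x \<otimes> h \<otimes> inv x) * M"
begin

lemma eta_carrier: "h \<in> H \<Longrightarrow> \<eta> h \<in> carrier_mat n n"
  and eta_one: "\<eta> \<one> = 1\<^sub>m n"
  and eta_mult: "g \<in> H \<Longrightarrow> h \<in> H \<Longrightarrow> \<eta> (g \<otimes> h) = \<eta> g * \<eta> h"
  using eta unfolding representation_K_iff by blast+

text \<open>Two decompositions differ by a power d of x lying in H, so p divides d, and iterating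
  \<open>Mp\<close> identifies the d-th power of M with \<eta> of the d-th power of x.\<close>

lemma extension_well_defined:
  assumes h: "h \<in> H" "h' \<in> H" and eq: "x [^] k \<otimes> h = x [^] l \<otimes> h'" and kl: "k \<le> (l::nat)"
  shows "M ^\<^sub>m k * \<eta> h = M ^\<^sub>m l * \<eta> h'"
proof -
  have c: "h \<in> carrier G" "h' \<in> carrier G" using h H_closed by auto
  obtain d where d: "l = k + d" using kl le_Suc_ex by blast
  have hd: "h = x [^] d \<otimes> h'"
  proof -
    have "x [^] k \<otimes> h = x [^] k \<otimes> (x [^] d \<otimes> h')"
      using eq c x_closed by (simp add: d nat_pow_mult[symmetric] m_assoc)
    then show ?thesis using c x_closed by simp
  qed
  then have "x [^] d = h \<otimes> inv h'" using c x_closed by (simp add: mult_inv_cancel)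
  then have "x [^] d \<in> H" using h N.m_inv_closed by simp
  then obtain q where q: "d = p * q" using x_pow_mem by blast
  have xp: "x [^] p \<in> H" using x_pow_mem by simp
  have "\<eta> ((x [^] p) [^] q) = M ^\<^sub>m (p * q) \<and> (x [^] p) [^] q \<in> H" for q :: nat
  proof (induction q)
    case 0
    then show ?case using M by (simp add: eta_one)
  next
    case (Suc q)
    then show ?case using xp
      by (simp add: eta_mult pow_mat_add[OF M] add.commute[of p] Mp)
  qed
  then have "\<eta> (x [^] d) = M ^\<^sub>m d" using x_closed by (simp add: q nat_pow_pow)
  then have "\<eta> h = M ^\<^sub>m d * \<eta> h'"
    using \<open>x [^] d \<in> H\<close> h by (simp add: hd eta_mult)
  then show ?thesis using M eta_carrier[OF h(2)]
    by (simp add: d pow_mat_add[OF M] square_mult_assoc[of _ n])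
qed

text \<open>Compares the chosen exponent with k; as \<open>extension_well_defined\<close> assumes an
  order of the two exponents, it is used in both directions.\<close>

lemma extension_eq:
  assumes h: "h \<in> H"
  shows "extension M \<eta> (x [^] k \<otimes> h) = M ^\<^sub>m k * \<eta> h"
proof -
  let ?g = "x [^] k \<otimes> h" and ?l = "coset_exp (x [^] k \<otimes> h)"
  have g: "?g \<in> carrier G" using h H_closed x_closed by simp
  have "x [^] ?l \<otimes> (inv (x [^] ?l) \<otimes> ?g) = x [^] k \<otimes> h"
    using g x_closed by (simp add: mult_inv_cancel)
  then show ?thesis
    unfolding extension_def
    using extension_well_defined[OF coset_exp[OF g] h] extension_well_defined[OF h coset_exp[OF g]]
    by (metis nat_le_linear)
qed

lemma extension_restrict: "h \<in> H \<Longrightarrow> extension M \<eta> h = \<eta> h"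
  using extension_eq[of h 0] M left_mult_one_mat[OF eta_carrier[of h]] H_closed by simp

text \<open>To multiply x^k h by x^l h', the element h is moved past x^l at the price of conjugating
  it; \<open>pow_conj\<close> says that the l-th power of M does the same on the matrix
  side.\<close>

lemma extension_representation: "representation G n (extension M \<eta>)"
  unfolding representation_iff
proof (intro conjI ballI)
  show "extension M \<eta> g \<in> carrier_mat n n" if "g \<in> carrier G" for g
    unfolding extension_def using M eta_carrier coset_exp[OF that] by simp
  show "extension M \<eta> \<one> = 1\<^sub>m n" using extension_restrict[of \<one>] eta_one by simp
  fix g g' assume g: "g \<in> carrier G" "g' \<in> carrier G"
  obtain k h where kh: "h \<in> H" "g = x [^] (k::nat) \<otimes> h" using decompose[OF g(1)] by blast
  obtain l h' where lh: "h' \<in> H" "g' = x [^] (l::nat) \<otimes> h'" using decompose[OF g(2)] by blast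
  let ?h = "inv (x [^] l) \<otimes> h \<otimes> x [^] l"
  have h: "?h \<in> H" using conj_closed'[OF _ kh(1)] x_closed by simp
  have c: "h \<in> carrier G" "h' \<in> carrier G" using kh lh H_closed by auto
  have "g \<otimes> g' = x [^] k \<otimes> (x [^] l \<otimes> inv (x [^] l)) \<otimes> h \<otimes> x [^] l \<otimes> h'"
    using kh lh c x_closed by (simp add: m_assoc)
  also have "\<dots> = x [^] (k + l) \<otimes> (?h \<otimes> h')"
    using c x_closed by (simp only: nat_pow_mult[symmetric] m_assoc m_closed inv_closed nat_pow_closed)
  finally have "extension M \<eta> (g \<otimes> g') = M ^\<^sub>m (k + l) * \<eta> (?h \<otimes> h')"
    using extension_eq[of "?h \<otimes> h'" "k + l"] h lh by simp
  also have "\<dots> = M ^\<^sub>m k * (M ^\<^sub>m l * \<eta> ?h) * \<eta> h'"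
    using M eta_carrier[OF h] eta_carrier[OF lh(1)]
    by (simp add: eta_mult[OF h lh(1)] pow_mat_add[OF M] square_mult_assoc[of _ n])
  also have "M ^\<^sub>m l * \<eta> ?h = \<eta> h * M ^\<^sub>m l"
  proof -
    have "x [^] l \<otimes> ?h \<otimes> inv (x [^] l) = h"
      using c x_closed by (simp add: m_assoc mult_inv_cancel)
    then show ?thesis using pow_conj[where \<eta>=\<eta> and n=n and M=M, OF eta_carrier M Mc h, of l] by simp
  qed
  also have "M ^\<^sub>m k * (\<eta> h * M ^\<^sub>m l) * \<eta> h' = (M ^\<^sub>m k * \<eta> h) * (M ^\<^sub>m l * \<eta> h')"
    using M eta_carrier[OF kh(1)] eta_carrier[OF lh(1)] by (simp add: square_mult_assoc[of _ n])
  also have "\<dots> = extension M \<eta> g * extension M \<eta> g'"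
    using extension_eq kh lh by simp
  finally show "extension M \<eta> (g \<otimes> g') = extension M \<eta> g * extension M \<eta> g'" .
qed

end

section \<open>Irreducibility under restriction and conjugation\<close>

lemma irreducible_of_restrict:
  fixes \<rho> :: "'a \<Rightarrow> 'f::field mat"
  assumes r: "representation G n \<rho>" and i: "irreducible_representation K n \<eta>"
    and eq: "\<And>h. h \<in> H \<Longrightarrow> \<rho> h = \<eta> h"
  shows "irreducible_representation G n \<rho>"
proof -
  have "\<forall>h\<in>H. \<forall>v\<in>W. \<eta> h *\<^sub>v v \<in> W" if "\<forall>g\<in>carrier G. \<forall>v\<in>W. \<rho> g *\<^sub>v v \<in> W" for W
    using that eq H_closed by metis
  then show ?thesis using i r unfolding irreducible_representation_def by simp
qed

lemma conjugate_representation_representation: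
  fixes \<eta> :: "'a \<Rightarrow> 'f::field mat"
  assumes "representation K n \<eta>" "g \<in> carrier G"
  shows "representation K n (conjugate_representation G g \<eta>)"
proof -
  have "g \<otimes> (h \<otimes> h') \<otimes> inv g = (g \<otimes> h \<otimes> inv g) \<otimes> (g \<otimes> h' \<otimes> inv g)" if "h \<in> H" "h' \<in> H" for h h'
    using that[THEN H_closed] assms(2) by (simp add: m_assoc mult_inv_cancel)
  then show ?thesis
    using assms conj_closed[OF assms(2)]
    by (simp add: representation_K_iff conjugate_representation_def)
qed

text \<open>Conjugation by g permutes H, so a representation and its conjugate take the same
  matrices as values and have the same stable subspaces.\<close>

lemma conjugate_representation_irreducible:
  fixes \<eta> :: "'a \<Rightarrow> 'f::field mat"
  assumes i: "irreducible_representation K n \<eta>" and g: "g \<in> carrier G"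
  shows "irreducible_representation K n (conjugate_representation G g \<eta>)"
proof -
  have "\<exists>h'\<in>H. h = g \<otimes> h' \<otimes> inv g" if "h \<in> H" for h
    using conj_closed'[OF g that] g H_closed[OF that]
    by (intro bexI[of _ "inv g \<otimes> h \<otimes> g"]) (simp_all add: m_assoc mult_inv_cancel)
  then have "(\<forall>h\<in>H. \<forall>v\<in>W. conjugate_representation G g \<eta> h *\<^sub>v v \<in> W) \<Longrightarrow> (\<forall>h\<in>H. \<forall>v\<in>W. \<eta> h *\<^sub>v v \<in> W)" for W
    unfolding conjugate_representation_def by metis
  then show ?thesis
    using i conjugate_representation_representation[OF _ g, of n \<eta>]
    unfolding irreducible_representation_def by simp
qed

end

section \<open>Block matrices and induced representations\<close>

text \<open>Splits an index into block number and position inside the block; products and traces of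
  block matrices rest on it.\<close>

lemma sum_div_mod:
  fixes f :: "nat \<Rightarrow> nat \<Rightarrow> 'f::comm_monoid_add"
  shows "(\<Sum>l<m * n. f (l div n) (l mod n)) = (\<Sum>k<m. \<Sum>c<n. f k c)"
proof -
  have "k * n + c < m * n" if "k < m" "c < n" for k c
  proof -
    have "k * n + c < Suc k * n" using that by simp
    also have "\<dots> \<le> m * n" using that by (intro mult_le_mono1) simp
    finally show ?thesis .
  qed
  then have "(\<Sum>l<m * n. f (l div n) (l mod n)) = (\<Sum>(k, c)\<in>{..<m} \<times> {..<n}. f k c)"
    by (intro sum.reindex_bij_witness[of _ "\<lambda>(k, c). k * n + c" "\<lambda>l. (l div n, l mod n)"])
      (auto simp: less_mult_imp_div_less intro!: mod_less_divisor gr0I)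
  then show ?thesis by (simp add: sum.cartesian_product)
qed

text \<open>All blocks are square of one size, which covers induced representations and direct sums
  alike; intertwiners between them can then be given and checked block by block.\<close>

definition block_mat :: "nat \<Rightarrow> nat \<Rightarrow> (nat \<Rightarrow> nat \<Rightarrow> 'f::comm_ring_1 mat) \<Rightarrow> 'f mat" where
  "block_mat m n B = mat (m * n) (m * n) (\<lambda>(r, s). B (r div n) (s div n) $$ (r mod n, s mod n))"

lemma block_mat_carrier [simp]: "block_mat m n B \<in> carrier_mat (m * n) (m * n)"
  by (simp add: block_mat_def)

lemma block_mat_dim [simp]: "dim_row (block_mat m n B) = m * n" "dim_col (block_mat m n B) = m * n"
  by (simp_all add: block_mat_def)

lemma div_mod_less:
  assumes "r < m * (n :: nat)"
  shows "r div n < m" "r mod n < n"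
proof -
  have "n > 0" using assms by (rule_tac gr0I) simp
  then show "r div n < m" "r mod n < n" using assms by (simp_all add: less_mult_imp_div_less)
qed

lemma block_mat_cong:
  assumes "\<And>i j. i < m \<Longrightarrow> j < m \<Longrightarrow> B i j = C i j"
  shows "block_mat m n B = block_mat m n C"
  by (rule eq_matI) (simp_all add: block_mat_def assms div_mod_less)

lemma block_mat_mult:
  assumes B: "\<And>i j. i < m \<Longrightarrow> j < m \<Longrightarrow> B i j \<in> carrier_mat n n"
    and C: "\<And>i j. i < m \<Longrightarrow> j < m \<Longrightarrow> C i j \<in> carrier_mat n n"
  shows "block_mat m n B * block_mat m n C = block_mat m n (\<lambda>i j. mat_sum n {..<m} (\<lambda>k. B i k * C k j))"
proof (rule eq_matI)
  fix r s assume "r < dim_row (block_mat m n (\<lambda>i j. mat_sum n {..<m} (\<lambda>k. B i k * C k j)))"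
    "s < dim_col (block_mat m n (\<lambda>i j. mat_sum n {..<m} (\<lambda>k. B i k * C k j)))"
  then have rs: "r < m * n" "s < m * n" by simp_all
  note d = div_mod_less[OF rs(1)] div_mod_less[OF rs(2)]
  have "(block_mat m n B * block_mat m n C) $$ (r, s) =
      (\<Sum>l<m * n. block_mat m n B $$ (r, l) * block_mat m n C $$ (l, s))"
    using rs by (intro index_mult_mat_sum) auto
  also have "\<dots> = (\<Sum>l<m * n. B (r div n) (l div n) $$ (r mod n, l mod n) *
      C (l div n) (s div n) $$ (l mod n, s mod n))"
    using rs by (intro sum.cong) (simp_all add: block_mat_def)
  also have "\<dots> = (\<Sum>k<m. \<Sum>c<n. B (r div n) k $$ (r mod n, c) * C k (s div n) $$ (c, s mod n))"
    by (rule sum_div_mod)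
  also have "\<dots> = (\<Sum>k<m. (B (r div n) k * C k (s div n)) $$ (r mod n, s mod n))"
    using d B C by (intro sum.cong refl index_mult_mat_sum[of _ n n _ n, symmetric]) auto
  also have "\<dots> = block_mat m n (\<lambda>i j. mat_sum n {..<m} (\<lambda>k. B i k * C k j)) $$ (r, s)"
    using rs d by (simp add: block_mat_def mat_sum_index)
  finally show "(block_mat m n B * block_mat m n C) $$ (r, s) =
      block_mat m n (\<lambda>i j. mat_sum n {..<m} (\<lambda>k. B i k * C k j)) $$ (r, s)" .
qed simp_all

text \<open>Permutation-like block matrices leave one nonzero term in each block of a product; this
  collapses the sum to that term.\<close>

lemma mat_sum_single:
  assumes "finite S" "s \<in> S" "f s \<in> carrier_mat n n" "\<And>t. t \<in> S \<Longrightarrow> t \<noteq> s \<Longrightarrow> f t = 0\<^sub>m n n"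
  shows "mat_sum n S f = f s"
proof (rule eq_matI)
  fix i j assume "i < dim_row (f s)" "j < dim_col (f s)"
  then have ij: "i < n" "j < n" using assms(3) by auto
  then have "mat_sum n S f $$ (i, j) = (\<Sum>t\<in>S. f t $$ (i, j))" by (simp add: mat_sum_index)
  also have "\<dots> = (\<Sum>t\<in>{s}. f t $$ (i, j))"
    using assms ij by (intro sum.mono_neutral_right) auto
  finally show "mat_sum n S f $$ (i, j) = f s $$ (i, j)" by simp
qed (use assms(3) in auto)

lemma block_mat_one: "block_mat m n (\<lambda>i j. if i = j then 1\<^sub>m n else 0\<^sub>m n n) = 1\<^sub>m (m * n)"
proof (rule eq_matI)
  fix r s assume "r < dim_row (1\<^sub>m (m * n) :: 'a mat)" "s < dim_col (1\<^sub>m (m * n) :: 'a mat)"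
  then have rs: "r < m * n" "s < m * n" by simp_all
  have "r = s \<longleftrightarrow> r div n = s div n \<and> r mod n = s mod n"
    by (metis div_mult_mod_eq)
  then show "block_mat m n (\<lambda>i j. if i = j then 1\<^sub>m n else 0\<^sub>m n n) $$ (r, s) = (1\<^sub>m (m * n) :: 'a mat) $$ (r, s)"
    using rs div_mod_less[OF rs(1)] div_mod_less[OF rs(2)] by (simp add: block_mat_def)
qed simp_all

lemma diag_block_mat_eq_block_mat:
  fixes D :: "nat \<Rightarrow> 'f::comm_ring_1 mat"
  assumes "\<And>i. i < m \<Longrightarrow> D i \<in> carrier_mat n n"
  shows "diag_block_mat (map D [0..<m]) = block_mat m n (\<lambda>i j. if i = j then D i else 0\<^sub>m n n)"
  using assms
proof (induction m)
  case 0
  then show ?case by (auto simp: block_mat_def)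
next
  case (Suc m)
  have IH: "diag_block_mat (map D [0..<m]) = block_mat m n (\<lambda>i j. if i = j then D i else 0\<^sub>m n n)"
    using Suc by simp
  have D: "D m \<in> carrier_mat n n" using Suc.prems by simp
  show ?case
  proof (rule eq_matI)
    fix r s assume "r < dim_row (block_mat (Suc m) n (\<lambda>i j. if i = j then D i else 0\<^sub>m n n))"
      "s < dim_col (block_mat (Suc m) n (\<lambda>i j. if i = j then D i else 0\<^sub>m n n))"
    then have rs: "r < Suc m * n" "s < Suc m * n" by simp_all
    note d = div_mod_less[OF rs(1)] div_mod_less[OF rs(2)]
    have n: "n > 0" using d by simp
    have ge: "q < m * n \<longleftrightarrow> q div n < m" for q using n by (simp add: div_less_iff_less_mult)
    have hi: "q div n = m \<Longrightarrow> q - m * n = q mod n" for q by (metis minus_div_mult_eq_mod)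
    have lt: "r div n < m \<or> r div n = m" "s div n < m \<or> s div n = m" using d by auto
    have "diag_block_mat (map D [0..<Suc m]) $$ (r, s) =
      (if r < m * n then if s < m * n then block_mat m n (\<lambda>i j. if i = j then D i else 0\<^sub>m n n) $$ (r, s) else 0
       else if s < m * n then 0 else D m $$ (r - m * n, s - m * n))"
      using rs D by (auto simp: diag_block_mat_last IH Let_def)
    also have "\<dots> = block_mat (Suc m) n (\<lambda>i j. if i = j then D i else 0\<^sub>m n n) $$ (r, s)"
      using lt rs d hi[of r] hi[of s] by (auto simp: block_mat_def ge)
    finally show "diag_block_mat (map D [0..<Suc m]) $$ (r, s) =
      block_mat (Suc m) n (\<lambda>i j. if i = j then D i else 0\<^sub>m n n) $$ (r, s)" .
  qed (use D in \<open>simp_all add: diag_block_mat_last IH Let_def\<close>)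
qed

lemma trace_block_mat:
  "(\<Sum>r<m * n. block_mat m n B $$ (r, r)) = (\<Sum>i<m. \<Sum>a<n. B i i $$ (a, a))"
proof -
  have "(\<Sum>r<m * n. block_mat m n B $$ (r, r)) = (\<Sum>r<m * n. B (r div n) (r div n) $$ (r mod n, r mod n))"
    by (intro sum.cong) (simp_all add: block_mat_def)
  also have "\<dots> = (\<Sum>i<m. \<Sum>a<n. B i i $$ (a, a))"
    using sum_div_mod[of "\<lambda>i a. B i i $$ (a, a)" n m] .
  finally show ?thesis .
qed

text \<open>For square matrices a one-sided inverse is two-sided, so an equivalence may be given by
  an intertwiner together with a left inverse.\<close>

lemma equivalent_representationsI:
  fixes \<rho> \<sigma> :: "'g \<Rightarrow> 'f::field mat"
  assumes "S \<in> carrier_mat n n" "S' \<in> carrier_mat n n" "S' * S = 1\<^sub>m n"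
    and "\<And>g. g \<in> carrier G \<Longrightarrow> \<rho> g \<in> carrier_mat n n" "\<And>g. g \<in> carrier G \<Longrightarrow> \<sigma> g \<in> carrier_mat n n"
    and "\<And>g. g \<in> carrier G \<Longrightarrow> S * \<rho> g = \<sigma> g * S"
  shows "equivalent_representations G \<rho> \<sigma>"
  unfolding equivalent_representations_def
proof (intro exI ballI)
  fix g assume g: "g \<in> carrier G"
  have "\<rho> g = S' * S * \<rho> g" using assms(3) left_mult_one_mat[OF assms(4)[OF g]] by simp
  also have "\<dots> = S' * \<sigma> g * S" using assms(1,2) assms(4-6)[OF g]
    by (simp add: square_mult_assoc[of _ n])
  finally show "similar_mat_wit (\<rho> g) (\<sigma> g) S' S"
    using assms(1-3) assms(4,5)[OF g] mat_mult_left_right_inverse[OF assms(2,1,3)]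
    by (intro similar_mat_witI[of _ _ n]) auto
qed

lemma equivalent_representationsE:
  assumes "equivalent_representations G \<rho> \<sigma>" "\<And>g. g \<in> carrier G \<Longrightarrow> \<rho> g \<in> carrier_mat n n"
    "carrier G \<noteq> {}"
  obtains P Q where "P \<in> carrier_mat n n" "Q \<in> carrier_mat n n" "P * Q = 1\<^sub>m n" "Q * P = 1\<^sub>m n"
    "\<And>g. g \<in> carrier G \<Longrightarrow> \<sigma> g \<in> carrier_mat n n"
    "\<And>g. g \<in> carrier G \<Longrightarrow> \<rho> g = P * \<sigma> g * Q"
proof -
  obtain P Q where PQ: "\<And>g. g \<in> carrier G \<Longrightarrow> similar_mat_wit (\<rho> g) (\<sigma> g) P Q"
    using assms(1) unfolding equivalent_representations_def by blast
  note D = similar_mat_witD2[OF assms(2) PQ]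
  show ?thesis using D assms(3) that[of P Q] by blast
qed

lemma character_equivalent:
  fixes \<rho> \<sigma> :: "'g \<Rightarrow> 'f::field mat"
  assumes "equivalent_representations G \<rho> \<sigma>" "\<And>g. g \<in> carrier G \<Longrightarrow> \<rho> g \<in> carrier_mat n n"
    and g: "g \<in> carrier G"
  shows "character n \<rho> g = character n \<sigma> g"
proof -
  have "carrier G \<noteq> {}" using g by blast
  then obtain P Q where PQ: "P \<in> carrier_mat n n" "Q \<in> carrier_mat n n" "Q * P = 1\<^sub>m n"
    "\<sigma> g \<in> carrier_mat n n" "\<rho> g = P * \<sigma> g * Q"
    using equivalent_representationsE[OF assms(1,2)] g by metis
  then have "character n \<rho> g = (\<Sum>i<n. (P * (\<sigma> g * Q)) $$ (i, i))"
    by (simp add: character_def square_mult_assoc[of _ n])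
  also have "\<dots> = (\<Sum>i<n. ((\<sigma> g * Q) * P) $$ (i, i))"
    using PQ by (intro trace_mult_commute) auto
  also have "\<dots> = character n \<sigma> g" using PQ by (simp add: character_def square_mult_assoc[of _ n])
  finally show ?thesis .
qed

lemma matrix_unit_mult_vec:
  fixes v :: "'f::comm_ring_1 vec"
  assumes "v \<in> carrier_vec n" "r < n" "s < n"
  shows "mat n n (\<lambda>(a, b). if a = r \<and> b = s then 1 else 0) *\<^sub>v v = v $ s \<cdot>\<^sub>v unit_vec n r"
proof (rule eq_vecI)
  fix i assume "i < dim_vec (v $ s \<cdot>\<^sub>v unit_vec n r)"
  then have i: "i < n" by simp
  have "(mat n n (\<lambda>(a, b). if a = r \<and> b = s then 1 else 0) *\<^sub>v v) $ i =
      (\<Sum>b<n. (if i = r \<and> b = s then 1 else 0) * v $ b)"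
    using assms i by (auto simp: scalar_prod_def atLeast0LessThan intro!: sum.cong)
  also have "\<dots> = (\<Sum>b<n. if b = s then if i = r then v $ s else 0 else 0)"
    by (intro sum.cong) auto
  also have "\<dots> = (v $ s \<cdot>\<^sub>v unit_vec n r) $ i" using assms i by simp
  finally show "(mat n n (\<lambda>(a, b). if a = r \<and> b = s then 1 else 0) *\<^sub>v v) $ i = (v $ s \<cdot>\<^sub>v unit_vec n r) $ i" .
qed simp

text \<open>The identity is the sum of the diagonal matrix units, and each of these sends v to a
  multiple of a unit vector.\<close>

lemma subspace_unit_vecs:
  fixes W :: "'f::field vec set"
  assumes "W \<subseteq> carrier_vec n" "0\<^sub>v n \<in> W" "\<forall>v\<in>W. \<forall>w\<in>W. v + w \<in> W" "\<forall>c. \<forall>v\<in>W. c \<cdot>\<^sub>v v \<in> W"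
    and u: "\<And>s. s < n \<Longrightarrow> unit_vec n s \<in> W"
  shows "W = carrier_vec n"
proof
  show "carrier_vec n \<subseteq> W"
  proof
    fix v :: "'f vec" assume v: "v \<in> carrier_vec n"
    let ?E = "\<lambda>s. mat n n (\<lambda>(a, b). if a = s \<and> b = s then 1 else 0) :: 'f mat"
    have "mat_sum n {..<n} ?E = 1\<^sub>m n"
    proof (rule eq_matI)
      fix i j assume "i < dim_row (1\<^sub>m n :: 'f mat)" "j < dim_col (1\<^sub>m n :: 'f mat)"
      then have ij: "i < n" "j < n" by auto
      then have "mat_sum n {..<n} ?E $$ (i, j) = (\<Sum>s<n. if s = i then if i = j then 1 else 0 else 0)"
        by (auto simp: mat_sum_index intro!: sum.cong)
      then show "mat_sum n {..<n} ?E $$ (i, j) = 1\<^sub>m n $$ (i, j)" using ij by simp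
    qed simp_all
    moreover have "mat_sum n {..<n} ?E *\<^sub>v v \<in> W"
      using assms v by (intro mat_sum_mult_vec_mem) (auto simp: matrix_unit_mult_vec)
    ultimately show "v \<in> W" using v by simp
  qed
qed (use assms in auto)

lemma induced_representation_eq_block_mat:
  "induced_representation G H ts n \<eta> g = block_mat (length ts) n (\<lambda>i j.
     if inv\<^bsub>G\<^esub> (ts ! i) \<otimes>\<^bsub>G\<^esub> g \<otimes>\<^bsub>G\<^esub> (ts ! j) \<in> H
     then \<eta> (inv\<^bsub>G\<^esub> (ts ! i) \<otimes>\<^bsub>G\<^esub> g \<otimes>\<^bsub>G\<^esub> (ts ! j)) else 0\<^sub>m n n)"
proof (rule eq_matI, goal_cases)
  case (1 r s)
  then have rs: "r < length ts * n" "s < length ts * n" by simp_all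
  then show ?case using div_mod_less[OF rs(1)] div_mod_less[OF rs(2)]
    by (simp add: induced_representation_def block_mat_def Let_def)
qed (simp_all add: induced_representation_def)

section \<open>Cosets and the block structure of the induced representation\<close>

locale prime_index_transversal = prime_index_subgroup +
  fixes ts
  assumes transversal: "left_transversal G H ts"
begin

lemma transversal_closed: "i < length ts \<Longrightarrow> ts ! i \<in> carrier G"
  using transversal nth_mem unfolding left_transversal_def by blast

lemma mem_l_coset_iff: "t \<in> carrier G \<Longrightarrow> g \<in> carrier G \<Longrightarrow> g \<in> t <# H \<longleftrightarrow> inv t \<otimes> g \<in> H"
proof
  assume t: "t \<in> carrier G" and g: "g \<in> carrier G"
  show "inv t \<otimes> g \<in> H" if "g \<in> t <# H"
    using that t H_closed by (auto simp: l_coset_def mult_inv_cancel)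
  show "g \<in> t <# H" if "inv t \<otimes> g \<in> H"
    unfolding l_coset_def using that t g by (auto simp: mult_inv_cancel intro!: bexI[of _ "inv t \<otimes> g"])
qed

lemma transversal_ex1: "g \<in> carrier G \<Longrightarrow> \<exists>!i. i < length ts \<and> inv (ts ! i) \<otimes> g \<in> H"
  using transversal mem_l_coset_iff transversal_closed unfolding left_transversal_def by metis

lemma transversal_eq_iff:
  assumes "i < length ts" "j < length ts"
  shows "inv (ts ! i) \<otimes> ts ! j \<in> H \<longleftrightarrow> i = j"
  using transversal_ex1[OF transversal_closed[OF assms(2)]] assms transversal_closed N.one_closed
  by (metis l_inv)

text \<open>Multiplication maps pairs of a position in the transversal and an element of H
  bijectively to the group, so counting both sides gives the index.\<close>

lemma length_transversal: "length ts = p"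
proof -
  have "bij_betw (\<lambda>(i, h). ts ! i \<otimes> h) ({..<length ts} \<times> H) (carrier G)"
  proof (rule bij_betw_imageI)
    show "inj_on (\<lambda>(i, h). ts ! i \<otimes> h) ({..<length ts} \<times> H)"
    proof (rule inj_onI, clarify)
      fix i h j k assume a: "i < length ts" "h \<in> H" "j < length ts" "k \<in> H" "ts ! i \<otimes> h = ts ! j \<otimes> k"
      have c: "h \<in> carrier G" "k \<in> carrier G" "ts ! i \<in> carrier G" "ts ! j \<in> carrier G"
        using a H_closed transversal_closed by auto
      have "inv (ts ! i) \<otimes> (ts ! i \<otimes> h) \<in> H" using a(2) c by (simp add: mult_inv_cancel)
      moreover have "inv (ts ! j) \<otimes> (ts ! i \<otimes> h) \<in> H" unfolding a(5) using a(4) c by (simp add: mult_inv_cancel)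
      ultimately have "i = j" using transversal_ex1[of "ts ! i \<otimes> h"] a c by auto
      then show "i = j \<and> h = k" using a c by simp
    qed
    show "(\<lambda>(i, h). ts ! i \<otimes> h) ` ({..<length ts} \<times> H) = carrier G"
    proof
      show "(\<lambda>(i, h). ts ! i \<otimes> h) ` ({..<length ts} \<times> H) \<subseteq> carrier G"
        using H_closed transversal_closed by auto
      show "carrier G \<subseteq> (\<lambda>(i, h). ts ! i \<otimes> h) ` ({..<length ts} \<times> H)"
      proof
        fix g assume g: "g \<in> carrier G"
        then obtain i where i: "i < length ts" "inv (ts ! i) \<otimes> g \<in> H" using transversal_ex1 by blast
        have "g = ts ! i \<otimes> (inv (ts ! i) \<otimes> g)"
          using g transversal_closed[OF i(1)] by (simp add: mult_inv_cancel)
        then show "g \<in> (\<lambda>(i, h). ts ! i \<otimes> h) ` ({..<length ts} \<times> H)"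
          using i by (auto intro!: image_eqI[of _ _ "(i, inv (ts ! i) \<otimes> g)"])
      qed
    qed
  qed
  then have "length ts * card H = p * card H"
    using bij_betw_same_card[of _ "{..<length ts} \<times> H" "carrier G"] order_G
    by (fastforce simp: Coset.order_def card_cartesian_product)
  moreover have "card H > 0"
    using N.one_closed finite_subset[OF N.subset finite_carrier] card_gt_0_iff by blast
  ultimately show ?thesis by simp
qed

text \<open>Left multiplication by g permutes the cosets, so each block column of the induced matrix
  has exactly one position where the block is taken from \<eta>.\<close>

lemma coset_block:
  assumes "g \<in> carrier G" "j < p"
  obtains k where "k < p" "inv (ts ! k) \<otimes> g \<otimes> ts ! j \<in> H"
    "\<And>l. l < p \<Longrightarrow> l \<noteq> k \<Longrightarrow> inv (ts ! l) \<otimes> g \<otimes> ts ! j \<notin> H"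
proof -
  have c: "ts ! j \<in> carrier G" using assms transversal_closed length_transversal by simp
  then have gc: "g \<otimes> ts ! j \<in> carrier G" using assms by simp
  have ex: "\<exists>!k. k < p \<and> inv (ts ! k) \<otimes> (g \<otimes> ts ! j) \<in> H"
    by (rule transversal_ex1[OF gc, unfolded length_transversal])
  obtain k where k: "k < p \<and> inv (ts ! k) \<otimes> (g \<otimes> ts ! j) \<in> H"
    and u: "\<forall>l. l < p \<and> inv (ts ! l) \<otimes> (g \<otimes> ts ! j) \<in> H \<longrightarrow> l = k"
    using ex by (rule ex1E)
  have eq: "inv (ts ! l) \<otimes> (g \<otimes> ts ! j) = inv (ts ! l) \<otimes> g \<otimes> ts ! j" if "l < p" for l
    using that c assms transversal_closed length_transversal by (simp add: m_assoc)
  show ?thesis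
  proof (rule that[of k])
    show "k < p" "inv (ts ! k) \<otimes> g \<otimes> ts ! j \<in> H" using k eq[of k] by auto
    show "inv (ts ! l) \<otimes> g \<otimes> ts ! j \<notin> H" if "l < p" "l \<noteq> k" for l
      using u that eq[of l] by auto
  qed
qed

context
  fixes \<eta> :: "'a \<Rightarrow> 'f::field mat" and n :: nat
  assumes eta: "representation K n \<eta>"
begin

abbreviation block where
  "block g i j \<equiv> (if inv (ts ! i) \<otimes> g \<otimes> ts ! j \<in> H then \<eta> (inv (ts ! i) \<otimes> g \<otimes> ts ! j) else 0\<^sub>m n n)"

lemmas eta_facts = eta[unfolded representation_K_iff]

lemma block_carrier: "block g i j \<in> carrier_mat n n"
  using eta_facts by simp

lemma induced_eq: "induced_representation G H ts n \<eta> g = block_mat p n (block g)"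
  using induced_representation_eq_block_mat[of G H ts n \<eta> g] by (simp add: length_transversal)

text \<open>Only the k with t_k^-1 g' t_j in H contributes. There t_k cancels in the product of the
  two arguments, and that product lies in H exactly when its first factor does.\<close>

lemma block_mult:
  assumes g: "g \<in> carrier G" "g' \<in> carrier G" and ij: "i < p" "j < p"
  shows "mat_sum n {..<p} (\<lambda>k. block g i k * block g' k j) = block (g \<otimes> g') i j"
proof -
  obtain k where k: "k < p" "inv (ts ! k) \<otimes> g' \<otimes> ts ! j \<in> H"
    "\<And>l. l < p \<Longrightarrow> l \<noteq> k \<Longrightarrow> inv (ts ! l) \<otimes> g' \<otimes> ts ! j \<notin> H"
    using coset_block[OF g(2) ij(2)] by blast
  have c: "ts ! i \<in> carrier G" "ts ! j \<in> carrier G" "ts ! k \<in> carrier G"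
    using ij k transversal_closed length_transversal by simp_all
  let ?a = "inv (ts ! i) \<otimes> g \<otimes> ts ! k" and ?b = "inv (ts ! k) \<otimes> g' \<otimes> ts ! j"
  have ab: "inv (ts ! i) \<otimes> (g \<otimes> g') \<otimes> ts ! j = ?a \<otimes> ?b"
    using c g by (simp add: m_assoc mult_inv_cancel)
  have iff: "?a \<otimes> ?b \<in> H \<longleftrightarrow> ?a \<in> H"
  proof
    assume "?a \<otimes> ?b \<in> H"
    then have "?a \<otimes> ?b \<otimes> inv ?b \<in> H" by (rule N.m_closed[OF _ N.m_inv_closed[OF k(2)]])
    then show "?a \<in> H" using c g by (simp add: mult_inv_cancel)
  qed (use k(2) in \<open>auto intro: N.m_closed\<close>)
  have "mat_sum n {..<p} (\<lambda>k. block g i k * block g' k j) = block g i k * block g' k j"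
  proof (rule mat_sum_single)
    show "block g i k * block g' k j \<in> carrier_mat n n"
      using block_carrier by (rule square_mult_carrier_mat) (rule block_carrier)
    show "block g i l * block g' l j = 0\<^sub>m n n" if "l \<in> {..<p}" "l \<noteq> k" for l
      using k(3)[of l] that right_mult_zero_mat[OF block_carrier[of i g l]] by simp
  qed (use k in simp_all)
  also have "\<dots> = block (g \<otimes> g') i j"
    unfolding ab iff using k(2) eta_facts by (simp add: left_mult_zero_mat[of _ n])
  finally show ?thesis .
qed

lemma induced_representation: "representation G (p * n) (induced_representation G H ts n \<eta>)"
  unfolding representation_iff
proof (intro conjI ballI)
  show "induced_representation G H ts n \<eta> \<one> = 1\<^sub>m (p * n)"
    unfolding induced_eq block_mat_one[symmetric]
  proof (rule block_mat_cong)
    fix i j assume ij: "i < p" "j < p"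
    then have "inv (ts ! i) \<otimes> \<one> \<otimes> ts ! j = inv (ts ! i) \<otimes> ts ! j" "ts ! j \<in> carrier G"
      using transversal_closed length_transversal by simp_all
    then show "block \<one> i j = (if i = j then 1\<^sub>m n else 0\<^sub>m n n)"
      using transversal_eq_iff[of i j] ij length_transversal eta_facts by auto
  qed
  fix g g' assume g: "g \<in> carrier G" "g' \<in> carrier G"
  show "induced_representation G H ts n \<eta> (g \<otimes> g') =
      induced_representation G H ts n \<eta> g * induced_representation G H ts n \<eta> g'"
    unfolding induced_eq
    by (subst block_mat_mult) (auto intro!: block_mat_cong simp: block_mult[OF g] block_carrier simp del: if_split)
qed (simp add: induced_eq)

text \<open>By normality an element of H fixes every coset, so its induced matrix is block diagonal
  with conjugates of \<eta> on the diagonal.\<close>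

lemma block_H:
  assumes h: "h \<in> H" and ij: "i < p" "j < p"
  shows "block h i j = (if i = j then \<eta> (inv (ts ! i) \<otimes> h \<otimes> ts ! i) else 0\<^sub>m n n)"
proof -
  have c: "ts ! i \<in> carrier G" "ts ! j \<in> carrier G" "h \<in> carrier G"
    using ij h H_closed transversal_closed length_transversal by simp_all
  let ?a = "inv (ts ! i) \<otimes> h \<otimes> ts ! i"
  have a: "?a \<in> H" using conj_closed'[OF c(1) h] .
  have "inv (ts ! i) \<otimes> h \<otimes> ts ! j = ?a \<otimes> (inv (ts ! i) \<otimes> ts ! j)"
    using c by (simp add: m_assoc mult_inv_cancel)
  moreover have "?a \<otimes> (inv (ts ! i) \<otimes> ts ! j) \<in> H \<longleftrightarrow> inv (ts ! i) \<otimes> ts ! j \<in> H"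
  proof
    assume "?a \<otimes> (inv (ts ! i) \<otimes> ts ! j) \<in> H"
    then have "inv ?a \<otimes> (?a \<otimes> (inv (ts ! i) \<otimes> ts ! j)) \<in> H" by (rule N.m_closed[OF N.m_inv_closed[OF a]])
    then show "inv (ts ! i) \<otimes> ts ! j \<in> H" using a c by (simp add: mult_inv_cancel)
  qed (use a in \<open>auto intro: N.m_closed\<close>)
  ultimately show ?thesis using transversal_eq_iff[of i j] ij length_transversal a by auto
qed

end

end

section \<open>The case of inequivalent conjugates\<close>

lemma equivalent_representations_sym:
  "equivalent_representations G \<rho> \<sigma> \<Longrightarrow> equivalent_representations G \<sigma> \<rho>"
  unfolding equivalent_representations_def by (blast intro: similar_mat_wit_sym)

lemma equivalent_representations_trans:
  "equivalent_representations G \<rho> \<sigma> \<Longrightarrow> equivalent_representations G \<sigma> \<tau> \<Longrightarrow>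
    equivalent_representations G \<rho> \<tau>"
  unfolding equivalent_representations_def by (blast intro: similar_mat_wit_trans)

lemma equivalent_representations_cong:
  assumes "\<And>g. g \<in> carrier G \<Longrightarrow> \<rho> g = \<rho>' g" "\<And>g. g \<in> carrier G \<Longrightarrow> \<sigma> g = \<sigma>' g"
  shows "equivalent_representations G \<rho> \<sigma> \<longleftrightarrow> equivalent_representations G \<rho>' \<sigma>'"
  unfolding equivalent_representations_def using assms by simp

section \<open>Which conjugates of \<eta> are equivalent\<close>

context prime_index_subgroup
begin

lemma K_carrier: "representation K n \<eta> \<Longrightarrow> h \<in> H \<Longrightarrow> \<eta> h \<in> carrier_mat n n"
  by (simp add: representation_K_iff)

lemma K_mult: "representation K n \<eta> \<Longrightarrow> g \<in> H \<Longrightarrow> h \<in> H \<Longrightarrow> \<eta> (g \<otimes> h) = \<eta> g * \<eta> h"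
  by (simp add: representation_K_iff)

lemma K_inverse:
  "representation K n \<eta> \<Longrightarrow> h \<in> H \<Longrightarrow> \<eta> (inv h) * \<eta> h = 1\<^sub>m n"
  "representation K n \<eta> \<Longrightarrow> h \<in> H \<Longrightarrow> \<eta> h * \<eta> (inv h) = 1\<^sub>m n"
  using representation_inv[OF group_K, of n \<eta> h] by (simp_all add: K_inv)

text \<open>Conjugating the a-conjugate further by g gives the conjugate by a g, so the same pair of
  matrices witnesses both equivalences.\<close>

lemma conjugate_shift:
  assumes e: "equivalent_representations K (conjugate_representation G a \<eta>) (conjugate_representation G b \<eta>)"
    and c: "a \<in> carrier G" "b \<in> carrier G" "g \<in> carrier G"
  shows "equivalent_representations K (conjugate_representation G (a \<otimes> g) \<eta>) (conjugate_representation G (b \<otimes> g) \<eta>)"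
proof -
  obtain P Q where PQ: "\<And>h. h \<in> H \<Longrightarrow>
      similar_mat_wit (conjugate_representation G a \<eta> h) (conjugate_representation G b \<eta> h) P Q"
    using e unfolding equivalent_representations_def by auto
  have "conjugate_representation G (u \<otimes> g) \<eta> h = conjugate_representation G u \<eta> (g \<otimes> h \<otimes> inv g)"
    if "h \<in> H" "u \<in> carrier G" for u h
    using that c H_closed by (simp add: conjugate_representation_def inv_mult_group m_assoc)
  then show ?thesis
    unfolding equivalent_representations_def using PQ conj_closed[OF c(3)] c
    by (intro exI[of _ P] exI[of _ Q]) simp
qed

text \<open>The intertwiner is \<open>\<eta> k\<close> itself.\<close>

lemma conjugate_by_H:
  fixes \<eta> :: "'a \<Rightarrow> 'f::field mat"
  assumes r: "representation K n \<eta>" and k: "k \<in> H" and a: "a \<in> carrier G"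
  shows "equivalent_representations K (conjugate_representation G a \<eta>) (conjugate_representation G (k \<otimes> a) \<eta>)"
proof (rule equivalent_representationsI[of "\<eta> k" n "\<eta> (inv k)"])
  have ka: "k \<otimes> a \<in> carrier G" using k a H_closed by simp
  show "\<eta> k \<in> carrier_mat n n" "\<eta> (inv k) \<in> carrier_mat n n" "\<eta> (inv k) * \<eta> k = 1\<^sub>m n"
    using k r by (simp_all add: K_carrier K_inverse)
  fix h assume "h \<in> carrier K"
  then have h: "h \<in> H" by simp
  show "conjugate_representation G a \<eta> h \<in> carrier_mat n n"
    "conjugate_representation G (k \<otimes> a) \<eta> h \<in> carrier_mat n n"
    using conj_closed[OF a h] conj_closed[OF ka h] r by (simp_all add: conjugate_representation_def K_carrier)
  have "k \<otimes> (a \<otimes> h \<otimes> inv a) = k \<otimes> a \<otimes> h \<otimes> inv (k \<otimes> a) \<otimes> k"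
    using H_closed[OF k] H_closed[OF h] a by (simp add: inv_mult_group m_assoc)
  then show "\<eta> k * conjugate_representation G a \<eta> h = conjugate_representation G (k \<otimes> a) \<eta> h * \<eta> k"
    using k conj_closed[OF a h] conj_closed[OF ka h]
    by (simp add: conjugate_representation_def K_mult[OF r, symmetric])
qed

lemma conjugate_one: "h \<in> H \<Longrightarrow> conjugate_representation G \<one> \<eta> h = \<eta> h"
  using H_closed by (simp add: conjugate_representation_def)

text \<open>The elements whose conjugate is equivalent to \<eta> contain H and are closed under
  products. Since p is prime, an element outside H has a power in the coset of x, so x would be
  among them.\<close>

lemma equivalent_conjugate_outside:
  fixes \<eta> :: "'a \<Rightarrow> 'f::field mat"
  assumes r: "representation K n \<eta>" and g: "g \<in> carrier G" "g \<notin> H"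
    and e: "equivalent_representations K (conjugate_representation G g \<eta>) (conjugate_representation G \<one> \<eta>)"
  shows "equivalent_representations K \<eta> (conjugate_representation G x \<eta>)"
proof -
  let ?E = "\<lambda>a b. equivalent_representations K (conjugate_representation G a \<eta>) (conjugate_representation G b \<eta>)"
  obtain k h where kh: "h \<in> H" "g = x [^] (k::nat) \<otimes> h" using decompose[OF g(1)] by blast
  have xk: "x [^] k \<in> carrier G" using x_closed by simp
  have "\<not> p dvd k" using g(2) kh x_pow_mem[of k] N.m_closed by blast
  let ?h = "x [^] k \<otimes> h \<otimes> inv (x [^] k)"
  have "g = ?h \<otimes> x [^] k" using kh H_closed x_closed by (simp add: mult_inv_cancel)
  then have "?E (x [^] k) g" using conjugate_by_H[OF r conj_closed[OF xk kh(1)] xk] by simp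
  then have k1: "?E (x [^] k) \<one>" using e equivalent_representations_trans by blast
  have km: "?E (x [^] (k * m)) \<one>" for m
  proof (induction m)
    case 0
    show ?case using conjugate_by_H[OF r N.one_closed one_closed] by simp
  next
    case (Suc m)
    have "?E (x [^] k \<otimes> x [^] (k * m)) (\<one> \<otimes> x [^] (k * m))"
      using x_closed by (intro conjugate_shift k1) simp_all
    then have "?E (x [^] (k * Suc m)) (x [^] (k * m))" using x_closed by (simp add: nat_pow_mult)
    then show ?case using Suc equivalent_representations_trans by blast
  qed
  have "coprime k p"
    using \<open>\<not> p dvd k\<close> prime_p by (metis coprime_commute prime_imp_coprime)
  moreover have "p \<noteq> 1" using prime_p by auto
  \<comment> \<open>An inverse m of k modulo p: the power of x with exponent k m then differs from x
    by an element of H.\<close>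
  ultimately obtain m q where mq: "k * m = p * q + 1" using coprime_bezout_strong by blast
  have "?E x (x [^] (p * q) \<otimes> x)"
    using x_closed x_pow_mem by (intro conjugate_by_H[OF r]) simp_all
  then have "?E x (x [^] (k * m))" using x_closed by (simp add: mq)
  then have "?E x \<one>" using km equivalent_representations_trans by blast
  then have "?E \<one> x" by (rule equivalent_representations_sym)
  moreover have "?E \<one> x \<longleftrightarrow> equivalent_representations K \<eta> (conjugate_representation G x \<eta>)"
    by (rule equivalent_representations_cong) (simp_all add: conjugate_one)
  ultimately show ?thesis by simp
qed

text \<open>Shifting both conjugates by the inverse of b reduces the claim to a comparison with
  \<eta> itself, where an element outside H is excluded.\<close>

lemma conjugates_inequivalent:
  fixes \<eta> :: "'a \<Rightarrow> 'f::field mat"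
  assumes r: "representation K n \<eta>" and ne: "\<not> equivalent_representations K \<eta> (conjugate_representation G x \<eta>)"
    and ab: "a \<in> carrier G" "b \<in> carrier G" "a \<otimes> inv b \<notin> H"
  shows "\<not> equivalent_representations K (conjugate_representation G a \<eta>) (conjugate_representation G b \<eta>)"
proof
  assume "equivalent_representations K (conjugate_representation G a \<eta>) (conjugate_representation G b \<eta>)"
  then have "equivalent_representations K (conjugate_representation G (a \<otimes> inv b) \<eta>) (conjugate_representation G \<one> \<eta>)"
    using conjugate_shift[of a \<eta> b "inv b"] ab by simp
  then show False using equivalent_conjugate_outside[OF r _ ab(3)] ab ne by simp
qed

lemma order_K: "Coset.order K = card H"
  by (simp add: Coset.order_def)

lemma of_nat_order_nonzero:
  assumes "of_nat (Coset.order G) \<noteq> (0 :: 'f::field)"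
  shows "of_nat p \<noteq> (0 :: 'f)" "of_nat (card H) \<noteq> (0 :: 'f)"
  using assms by (auto simp: order_G)

end

section \<open>The induced representation and its restriction to H\<close>

context prime_index_transversal
begin

text \<open>Restricted to H the diagonal blocks are pairwise inequivalent, so orthogonality gives
  elements of F[H] acting as matrix units inside one block. Applied to a nonzero vector of a stable
  subspace, they yield all unit vectors of a block; elements of G then carry these to the other
  blocks.\<close>

lemma induced_irreducible:
  fixes \<eta> :: "'a \<Rightarrow> 'f::alg_closed_field mat"
  assumes irr: "irreducible_representation K n \<eta>"
    and ne: "\<not> equivalent_representations K \<eta> (conjugate_representation G x \<eta>)"
    and ord: "of_nat (Coset.order G) \<noteq> (0 :: 'f)"
  shows "irreducible_representation G (p * n) (induced_representation G H ts n \<eta>)"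
proof -
  have r: "representation K n \<eta>" and n: "n > 0"
    using irr by (auto simp: irreducible_representation_def)
  let ?N = "p * n" and ?I = "induced_representation G H ts n \<eta>"
  have rI: "representation G ?N ?I" by (rule induced_representation[OF r])
  note tc = transversal_closed[unfolded length_transversal]
  define \<eta>' where "\<eta>' = (\<lambda>i. conjugate_representation G (inv (ts ! i)) \<eta>)"
  have \<eta>'_eq: "\<eta>' i h = \<eta> (inv (ts ! i) \<otimes> h \<otimes> ts ! i)" if "i < p" for i h
    using tc[OF that] by (simp add: \<eta>'_def conjugate_representation_def)
  have irr': "irreducible_representation K n (\<eta>' i)" if "i < p" for i
    unfolding \<eta>'_def using tc[OF that] by (intro conjugate_representation_irreducible[OF irr]) simp
  then have r': "representation K n (\<eta>' i)" if "i < p" for i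
    using that by (simp add: irreducible_representation_def)
  have ne': "\<not> equivalent_representations K (\<eta>' i) (\<eta>' j)" if ij: "i < p" "j < p" "i \<noteq> j" for i j
    unfolding \<eta>'_def using tc ij transversal_eq_iff[of i j] length_transversal
    by (intro conjugates_inequivalent[OF r ne]) simp_all
  have I_index: "?I h $$ (r, s) = (if r div n = s div n then \<eta>' (r div n) h $$ (r mod n, s mod n) else 0)"
    if "h \<in> H" "r < ?N" "s < ?N" for h r s
    using that div_mod_less[OF that(2)] div_mod_less[OF that(3)]
    unfolding induced_eq[OF r]
    by (simp add: block_mat_def block_H[OF r] \<eta>'_eq del: if_split)
  have unit: "\<exists>a. algebra_action K ?N ?I a = mat ?N ?N (\<lambda>(r, s). if r = i * n + a0 \<and> s = i * n + b0 then 1 else 0)"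
    if i: "i < p" "a0 < n" "b0 < n" for i a0 b0
  proof
    \<comment> \<open>Read off from orthogonality: the coefficient (a0, b0) pairs with (b0, a0) at
      the inverse, hence the transposed indices, and n / |H| normalises the surviving sum to
      1.\<close>
    define c where "c = (\<lambda>h. of_nat n / of_nat (card H) * \<eta>' i (inv h) $$ (b0, a0))"
    show "algebra_action K ?N ?I c = mat ?N ?N (\<lambda>(r, s). if r = i * n + a0 \<and> s = i * n + b0 then 1 else 0)"
    proof (rule eq_matI, goal_cases)
      case (1 r s)
      then have rs: "r < ?N" "s < ?N" by simp_all
      note d = div_mod_less[OF rs(1)] div_mod_less[OF rs(2)]
      have eq: "r = i * n + a0 \<longleftrightarrow> r div n = i \<and> r mod n = a0" "s = i * n + b0 \<longleftrightarrow> s div n = i \<and> s mod n = b0"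
        using i by (auto simp: div_mult_mod_eq)
      have "algebra_action K ?N ?I c $$ (r, s) = (\<Sum>h\<in>H. c h * ?I h $$ (r, s))"
        using rs by (simp add: algebra_action_def)
      also have "\<dots> = (if r div n = i \<and> s div n = i \<and> r mod n = a0 \<and> s mod n = b0 then 1 else 0)"
      proof (cases "r div n = s div n")
        case False
        then show ?thesis using rs by (auto simp: I_index intro!: sum.neutral)
      next
        case True
        have "(\<Sum>h\<in>H. c h * ?I h $$ (r, s)) = of_nat n / of_nat (card H) *
            (\<Sum>h\<in>H. \<eta>' (r div n) h $$ (r mod n, s mod n) * \<eta>' i (inv h) $$ (b0, a0))"
          using True rs by (simp add: I_index c_def sum_distrib_left mult_ac)
        also have "(\<Sum>h\<in>H. \<eta>' (r div n) h $$ (r mod n, s mod n) * \<eta>' i (inv h) $$ (b0, a0)) =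
            (\<Sum>h\<in>carrier K. \<eta>' (r div n) h $$ (r mod n, s mod n) * \<eta>' i (inv\<^bsub>K\<^esub> h) $$ (b0, a0))"
          by (simp add: K_inv)
        finally have S: "(\<Sum>h\<in>H. c h * ?I h $$ (r, s)) = of_nat n / of_nat (card H) *
            (\<Sum>h\<in>carrier K. \<eta>' (r div n) h $$ (r mod n, s mod n) * \<eta>' i (inv\<^bsub>K\<^esub> h) $$ (b0, a0))" .
        show ?thesis
        proof (cases "r div n = i")
          case False
          then show ?thesis
            using S K.schur_orthogonality_inequivalent[OF irr'[OF i(1)] r'[OF d(1)] ne'[OF d(1) i(1) False] d(2) d(4) i(3,2)]
            by simp
        next
          case True': True
          show ?thesis
            using S K.schur_orthogonality[OF irr'[OF i(1)] d(2) d(4) i(3,2)] True True' of_nat_order_nonzero(2)[OF ord]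
            by (auto simp: order_K)
        qed
      qed
      finally show ?case using rs eq by auto
    qed (simp_all add: algebra_action_def)
  qed
  show ?thesis
    unfolding irreducible_representation_iff
  proof (intro conjI allI impI rI)
    show "0 < p * n" using n p_pos by simp
    fix W :: "'f vec set"
    assume W: "W \<subseteq> carrier_vec ?N" "0\<^sub>v ?N \<in> W" "\<forall>v\<in>W. \<forall>w\<in>W. v + w \<in> W"
      "\<forall>c. \<forall>v\<in>W. c \<cdot>\<^sub>v v \<in> W" and inv: "\<forall>g\<in>carrier G. \<forall>v\<in>W. ?I g *\<^sub>v v \<in> W"
    have act: "algebra_action K ?N ?I a *\<^sub>v v \<in> W" if v: "v \<in> W" for a v
      unfolding K.algebra_action_eq_mat_sum[OF representation_restrict[OF rI]]
    proof (rule mat_sum_mult_vec_mem)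
      have Ic: "?I h \<in> carrier_mat ?N ?N" if "h \<in> carrier K" for h
        using representation_carrier[OF group_K representation_restrict[OF rI] that] .
      then show "a h \<cdot>\<^sub>m ?I h \<in> carrier_mat ?N ?N" if "h \<in> carrier K" for h using that by simp
      show "(a h \<cdot>\<^sub>m ?I h) *\<^sub>v v \<in> W" if h: "h \<in> carrier K" for h
      proof -
        have "(a h \<cdot>\<^sub>m ?I h) *\<^sub>v v = a h \<cdot>\<^sub>v (?I h *\<^sub>v v)"
          using Ic[OF h] v W(1) by (intro eq_vecI) auto
        then show ?thesis using W(4) inv v h H_closed by simp
      qed
    qed (use W v K.finite_carrier in auto)
    show "W = {0\<^sub>v ?N} \<or> W = carrier_vec ?N"
    proof (rule disjCI)
      assume "W \<noteq> carrier_vec ?N"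
      show "W = {0\<^sub>v ?N}"
      proof (rule ccontr)
        assume "W \<noteq> {0\<^sub>v ?N}"
        then obtain w where w: "w \<in> W" "w \<noteq> 0\<^sub>v ?N" using W(2) by blast
        then have wc: "w \<in> carrier_vec ?N" using W(1) by blast
        have "\<exists>s<?N. w $ s \<noteq> 0"
        proof (rule ccontr)
          assume "\<not> (\<exists>s<?N. w $ s \<noteq> 0)"
          then have "w = 0\<^sub>v ?N" using wc by (intro eq_vecI) auto
          then show False using w by simp
        qed
        then obtain s where s: "s < ?N" "w $ s \<noteq> 0" by blast
        define i b where "i = s div n" and "b = s mod n"
        have ib: "i < p" "b < n" "s = i * n + b"
          using div_mod_less[OF s(1)] by (simp_all add: i_def b_def)
        have less: "j * n + a < ?N" if "j < p" "a < n" for j a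
        proof -
          have "j * n + a < Suc j * n" using that by simp
          also have "\<dots> \<le> p * n" using that by (intro mult_le_mono1) simp
          finally show ?thesis .
        qed
        have u: "unit_vec ?N (i * n + a) \<in> W" if a: "a < n" for a
        proof -
          obtain c where c: "algebra_action K ?N ?I c =
              mat ?N ?N (\<lambda>(r, s). if r = i * n + a \<and> s = i * n + b then 1 else 0)"
            using unit[OF ib(1) a ib(2)] by blast
          \<comment> \<open>The matrix unit turns w into a unit vector scaled by the coordinate s of
            w; this coordinate is nonzero and can be divided out.\<close>
          have "w $ s \<cdot>\<^sub>v unit_vec ?N (i * n + a) \<in> W"
            using act[OF w(1), of c] matrix_unit_mult_vec[OF wc less[OF ib(1) a] s(1)] by (simp add: c ib(3))
          then have "inverse (w $ s) \<cdot>\<^sub>v (w $ s \<cdot>\<^sub>v unit_vec ?N (i * n + a)) \<in> W" using W(4) by blast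
          then show ?thesis using s(2) by (simp add: smult_smult_assoc)
        qed
        have "unit_vec ?N r \<in> W" if r_less: "r < ?N" for r
        proof -
          define j a where "j = r div n" and "a = r mod n"
          have ja: "j < p" "a < n" "r = j * n + a"
            using div_mod_less[OF r_less] by (simp_all add: j_def a_def)
          \<comment> \<open>Carries block i to block j by an identity matrix: in the block row of a
            representative t the argument is t^-1 t_j, which lies in H only for t = t_j and is then
            the unit element.\<close>
          let ?g = "ts ! j \<otimes> inv (ts ! i)"
          have g: "?g \<in> carrier G" using tc ja ib by simp
          have "?I ?g *\<^sub>v unit_vec ?N (i * n + a) = unit_vec ?N r"
          proof (rule eq_vecI)
            fix q assume "q < dim_vec (unit_vec ?N r :: 'f vec)"
            then have q: "q < ?N" by simp
            note d = div_mod_less[OF q]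
            have "(?I ?g *\<^sub>v unit_vec ?N (i * n + a)) $ q = ?I ?g $$ (q, i * n + a)"
              using q less[OF ib(1) ja(2)] representation_carrier[OF is_group rI g] by simp
            also have "inv (ts ! (q div n)) \<otimes> ?g \<otimes> ts ! i = inv (ts ! (q div n)) \<otimes> ts ! j"
              using tc d ja ib by (simp add: m_assoc)
            then have "?I ?g $$ (q, i * n + a) = (if q div n = j then 1\<^sub>m n else 0\<^sub>m n n) $$ (q mod n, a)"
              using q less[OF ib(1) ja(2)] ja(2) transversal_eq_iff[of "q div n" j] length_transversal d ja(1)
                tc[OF ja(1)] r
              by (auto simp: induced_eq[OF r] block_mat_def representation_K_iff)
            also have "\<dots> = unit_vec ?N r $ q"
            proof -
              have "q = r \<longleftrightarrow> q div n = j \<and> q mod n = a"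
                unfolding j_def a_def by (metis div_mult_mod_eq)
              then show ?thesis using d ja q r_less by auto
            qed
            finally show "(?I ?g *\<^sub>v unit_vec ?N (i * n + a)) $ q = unit_vec ?N r $ q" .
          qed (use representation_carrier[OF is_group rI g] in simp)
          then show ?thesis using inv g u[OF ja(2)] by metis
        qed
        then have "W = carrier_vec ?N" by (rule subspace_unit_vecs[OF W])
        then show False using \<open>W \<noteq> carrier_vec ?N\<close> by simp
      qed
    qed
  qed
qed

text \<open>The diagonal blocks are conjugates by inverses of the transversal, while the claim uses
  powers of x. Both run through all cosets, so a permutation \<sigma> of the blocks matches them,
  and each match is corrected by \<eta> of an element of H.\<close>

lemma restrict_induced:
  fixes \<eta> :: "'a \<Rightarrow> 'f::field mat"
  assumes r: "representation K n \<eta>"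
  shows "equivalent_representations K (induced_representation G H ts n \<eta>)
    (direct_sum_representation p (\<lambda>i. conjugate_representation G (x [^] i) \<eta>))"
proof -
  note tc = transversal_closed[unfolded length_transversal]
  \<comment> \<open>The inverse of t_i has the form x^k h; reducing k modulo p splits off a power of
    x^p, which lies in H.\<close>
  have "\<exists>k<p. x [^] k \<otimes> ts ! i \<in> H" if i: "i < p" for i
  proof -
    obtain k h where kh: "h \<in> H" "inv (ts ! i) = x [^] (k::nat) \<otimes> h" using decompose[of "inv (ts ! i)"] tc[OF i] by auto
    let ?u = "x [^] (p * (k div p))" and ?v = "x [^] (k mod p)"
    have u: "?u \<in> H" using x_pow_mem by simp
    have c: "?u \<in> carrier G" "?v \<in> carrier G" "h \<in> carrier G" "ts ! i \<in> carrier G"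
      using x_closed kh H_closed tc[OF i] by simp_all
    have xk: "x [^] k = ?v \<otimes> ?u" using x_closed by (simp add: nat_pow_mult)
    have "ts ! i = inv (?v \<otimes> ?u \<otimes> h)" using kh c xk by (metis inv_inv)
    then have "?v \<otimes> ts ! i = ?v \<otimes> (inv h \<otimes> inv ?u) \<otimes> inv ?v"
      using c by (simp add: inv_mult_group m_assoc)
    then have "?v \<otimes> ts ! i \<in> H"
      using conj_closed[OF c(2), of "inv h \<otimes> inv ?u"] kh u by simp
    then show ?thesis using p_pos by (intro exI[of _ "k mod p"]) simp
  qed
  then obtain \<sigma> where \<sigma>: "\<And>i. i < p \<Longrightarrow> \<sigma> i < p \<and> x [^] \<sigma> i \<otimes> ts ! i \<in> H" by metis
  define k where "k = (\<lambda>i. x [^] \<sigma> i \<otimes> ts ! i)"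
  have kH: "k i \<in> H" if "i < p" for i using \<sigma>[OF that] by (simp add: k_def)
  have \<sigma>_inj: "i = j" if ij: "i < p" "j < p" "\<sigma> i = \<sigma> j" for i j
  proof -
    have "inv (k i) \<otimes> k j \<in> H" using kH ij by simp
    moreover have "inv (k i) \<otimes> k j = inv (ts ! i) \<otimes> ts ! j"
      using ij(3) tc[OF ij(1)] tc[OF ij(2)] x_closed by (simp add: k_def inv_mult_group m_assoc mult_inv_cancel)
    ultimately show ?thesis using transversal_eq_iff[of i j] ij length_transversal by simp
  qed
  \<comment> \<open>The block permutation with its corrections; S' is its inverse.\<close>
  define S where "S = (\<lambda>l i. if l = \<sigma> i then \<eta> (k i) else 0\<^sub>m n n)"
  define S' where "S' = (\<lambda>i l. if l = \<sigma> i then \<eta> (inv (k i)) else 0\<^sub>m n n)"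
  have Sc: "S l i \<in> carrier_mat n n" "S' i l \<in> carrier_mat n n" if "i < p" for i l
    using kH[OF that] by (simp_all add: S_def S'_def K_carrier[OF r])
  let ?C = "\<lambda>i::nat. conjugate_representation G (x [^] i) \<eta>"
  have Cc: "?C i h \<in> carrier_mat n n" if "h \<in> H" for i :: nat and h
    using conj_closed[OF _ that, of "x [^] i"] x_closed by (simp add: conjugate_representation_def K_carrier[OF r])
  have D: "direct_sum_representation p ?C h = block_mat p n (\<lambda>i j. if i = j then ?C i h else 0\<^sub>m n n)"
    if "h \<in> H" for h
    unfolding direct_sum_representation_def using Cc[OF that] by (intro diag_block_mat_eq_block_mat) simp
  show ?thesis
  proof (rule equivalent_representationsI[of "block_mat p n S" "p * n" "block_mat p n S'"])
    show "block_mat p n S' * block_mat p n S = 1\<^sub>m (p * n)"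
      unfolding block_mat_one[symmetric]
    proof (subst block_mat_mult, goal_cases)
      case 3
      show ?case
      proof (rule block_mat_cong)
        fix i j assume ij: "i < p" "j < p"
        have "mat_sum n {..<p} (\<lambda>l. S' i l * S l j) = S' i (\<sigma> i) * S (\<sigma> i) j"
        proof (rule mat_sum_single)
          show "S' i (\<sigma> i) * S (\<sigma> i) j \<in> carrier_mat n n" using Sc ij by simp
          show "S' i l * S l j = 0\<^sub>m n n" if "l \<noteq> \<sigma> i" for l
            using that Sc(1)[OF ij(2), of l] by (simp add: S'_def left_mult_zero_mat[of _ n])
        qed (use \<sigma> ij in simp_all)
        also have "\<dots> = (if i = j then 1\<^sub>m n else 0\<^sub>m n n)"
        proof (cases "i = j")
          case True
          then show ?thesis using kH[OF ij(1)] by (simp add: S_def S'_def K_inverse[OF r])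
        next
          case False
          then have "\<sigma> i \<noteq> \<sigma> j" using \<sigma>_inj ij by blast
          then show ?thesis using False Sc(2)[OF ij(1), of "\<sigma> i"] by (simp add: S_def right_mult_zero_mat[of _ n n])
        qed
        finally show "mat_sum n {..<p} (\<lambda>l. S' i l * S l j) = (if i = j then 1\<^sub>m n else 0\<^sub>m n n)" .
      qed
    qed (use Sc in auto)
    fix h assume "h \<in> carrier K"
    then have h: "h \<in> H" by simp
    show "induced_representation G H ts n \<eta> h \<in> carrier_mat (p * n) (p * n)" by (simp add: induced_eq[OF r])
    show "direct_sum_representation p ?C h \<in> carrier_mat (p * n) (p * n)" using D[OF h] by simp
    let ?A = "\<lambda>i j. if i = j then \<eta> (inv (ts ! i) \<otimes> h \<otimes> ts ! i) else 0\<^sub>m n n"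
    let ?D = "\<lambda>i j. if i = j then ?C i h else 0\<^sub>m n n"
    have A: "induced_representation G H ts n \<eta> h = block_mat p n ?A"
      unfolding induced_eq[OF r] by (rule block_mat_cong) (rule block_H[OF r h])
    have Ac: "?A i j \<in> carrier_mat n n" if "i < p" for i j
      using conj_closed'[OF tc[OF that] h] by (cases "i = j") (simp_all add: K_carrier[OF r])
    have Dc: "?D i j \<in> carrier_mat n n" for i j
      using Cc[OF h, of i] by (cases "i = j") simp_all
    have "block_mat p n S * block_mat p n ?A = block_mat p n (\<lambda>l j. mat_sum n {..<p} (\<lambda>i. S l i * ?A i j))"
      using Sc Ac by (intro block_mat_mult)
    also have "\<dots> = block_mat p n (\<lambda>l j. mat_sum n {..<p} (\<lambda>i. ?D l i * S i j))"
    proof (rule block_mat_cong)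
      fix l j assume lj: "l < p" "j < p"
      have "mat_sum n {..<p} (\<lambda>i. S l i * ?A i j) = S l j * ?A j j"
      proof (rule mat_sum_single)
        show "S l j * ?A j j \<in> carrier_mat n n"
          using Sc(1)[OF lj(2)] Ac[OF lj(2)] by (rule square_mult_carrier_mat)
        show "S l i * ?A i j = 0\<^sub>m n n" if "i \<in> {..<p}" "i \<noteq> j" for i
          using that Sc(1)[of i l] by (simp add: right_mult_zero_mat[of _ n n])
      qed (use lj in simp_all)
      also have "\<dots> = ?D l l * S l j"
      proof (cases "l = \<sigma> j")
        case True
        have c: "h \<in> carrier G" "ts ! j \<in> carrier G" using H_closed h tc lj by auto
        have a: "inv (ts ! j) \<otimes> h \<otimes> ts ! j \<in> H" "x [^] l \<otimes> h \<otimes> inv (x [^] l) \<in> H"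
          using conj_closed'[OF c(2) h] conj_closed[OF _ h, of "x [^] l"] x_closed by simp_all
        \<comment> \<open>Conjugation by \<open>k j\<close> takes the argument of the j-th induced
          block to that of the l-th conjugate, so its image under \<eta> intertwines the two
          blocks.\<close>
        have "k j \<otimes> (inv (ts ! j) \<otimes> h \<otimes> ts ! j) = x [^] l \<otimes> h \<otimes> inv (x [^] l) \<otimes> k j"
          using c x_closed by (simp add: k_def True m_assoc mult_inv_cancel)
        then have "\<eta> (k j) * \<eta> (inv (ts ! j) \<otimes> h \<otimes> ts ! j) = \<eta> (x [^] l \<otimes> h \<otimes> inv (x [^] l)) * \<eta> (k j)"
          using a kH[OF lj(2)] by (simp add: K_mult[OF r, symmetric])
        then show ?thesis using True by (simp add: S_def conjugate_representation_def)
      next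
        case False
        then show ?thesis using Ac[OF lj(2), of j] Cc[OF h, of l]
          by (simp add: S_def left_mult_zero_mat[of _ n] right_mult_zero_mat[of _ n n])
      qed
      also have "\<dots> = mat_sum n {..<p} (\<lambda>i. ?D l i * S i j)"
      proof (rule mat_sum_single[symmetric])
        show "?D l l * S l j \<in> carrier_mat n n" using Dc Sc(1)[OF lj(2)] by (rule square_mult_carrier_mat)
        show "?D l i * S i j = 0\<^sub>m n n" if "i \<noteq> l" for i
          using that Sc(1)[OF lj(2), of i] by (simp add: left_mult_zero_mat[of _ n])
      qed (use lj in simp_all)
      finally show "mat_sum n {..<p} (\<lambda>i. S l i * ?A i j) = mat_sum n {..<p} (\<lambda>i. ?D l i * S i j)" .
    qed
    also have "\<dots> = block_mat p n ?D * block_mat p n S"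
      using Sc Dc by (intro block_mat_mult[symmetric])
    finally show "block_mat p n S * induced_representation G H ts n \<eta> h =
        direct_sum_representation p ?C h * block_mat p n S"
      using A D[OF h] by simp
  qed simp_all
qed

end

section \<open>Roots of unity and class sums\<close>

lemma root_of_unity_pow_mod:
  fixes \<zeta> :: "'f::field"
  assumes "\<zeta> ^ p = 1"
  shows "\<zeta> ^ k = \<zeta> ^ (k mod p)"
proof -
  have "\<zeta> ^ k = \<zeta> ^ (p * (k div p) + k mod p)" by simp
  also have "\<dots> = (\<zeta> ^ p) ^ (k div p) * \<zeta> ^ (k mod p)" by (simp only: power_add power_mult)
  finally show ?thesis using assms by simp
qed

lemma primitive_root_pow_eq_1_iff:
  fixes \<zeta> :: "'f::field"
  assumes "primitive_root_of_unity p \<zeta>" "p > 0"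
  shows "\<zeta> ^ k = 1 \<longleftrightarrow> p dvd k"
proof -
  have "\<zeta> ^ p = 1" using assms by (simp add: primitive_root_of_unity_def)
  then have "\<zeta> ^ k = \<zeta> ^ (k mod p)" by (rule root_of_unity_pow_mod)
  moreover have "\<zeta> ^ (k mod p) = 1 \<longleftrightarrow> k mod p = 0"
    using assms unfolding primitive_root_of_unity_def
    by (metis bot_nat_0.not_eq_extremum mod_less_divisor power_0)
  ultimately show ?thesis by (simp add: dvd_eq_mod_eq_0)
qed

lemma primitive_root_power:
  fixes \<zeta> :: "'f::field"
  assumes "primitive_root_of_unity p \<zeta>" "prime p" "\<not> p dvd k"
  shows "primitive_root_of_unity p (\<zeta> ^ k)"
proof -
  have iff: "\<zeta> ^ j = 1 \<longleftrightarrow> p dvd j" for j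
    using primitive_root_pow_eq_1_iff[OF assms(1)] prime_gt_0_nat[OF assms(2)] by blast
  have "\<not> p dvd k * j" if "0 < j" "j < p" for j
    using that assms(2,3) by (simp add: prime_dvd_mult_iff nat_dvd_not_less)
  then show ?thesis
    unfolding primitive_root_of_unity_def by (simp add: power_mult[symmetric] iff)
qed

lemma primitive_root_inj:
  fixes \<zeta> :: "'f::field"
  assumes "primitive_root_of_unity p \<zeta>"
  shows "inj_on (\<lambda>i. \<zeta> ^ i) {..<p}"
proof (rule linorder_inj_onI')
  fix i j assume "i \<in> {..<p}" "j \<in> {..<p}" and lt: "i < j"
  then have p: "p > 0" "j - i < p" "0 < j - i" by auto
  have "\<zeta> ^ p = 1" using assms by (simp add: primitive_root_of_unity_def)
  then have "\<zeta> \<noteq> 0" using p(1) by (auto simp: power_0_left)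
  have "\<zeta> ^ (j - i) \<noteq> 1" using assms p by (auto simp: primitive_root_of_unity_def)
  moreover have "\<zeta> ^ j = \<zeta> ^ i * \<zeta> ^ (j - i)" using lt by (simp add: power_add[symmetric])
  ultimately show "\<zeta> ^ i \<noteq> \<zeta> ^ j" using \<open>\<zeta> \<noteq> 0\<close> by simp
qed

lemma finite_roots_of_unity:
  assumes "p > 0"
  shows "finite {z :: 'f::field. z ^ p = 1}" "card {z :: 'f. z ^ p = 1} \<le> p"
proof -
  let ?P = "Polynomial.monom 1 p - 1 :: 'f poly"
  have deg: "degree ?P = p" and ne: "?P \<noteq> 0"
  proof -
    have "degree (1 :: 'f poly) < degree (Polynomial.monom 1 p :: 'f poly)" using assms by (simp add: Polynomial.degree_monom_eq)
    then show "degree ?P = p"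
      using degree_add_eq_left[of "- 1" "Polynomial.monom 1 p :: 'f poly"]
      by (simp add: Polynomial.degree_monom_eq)
    then show "?P \<noteq> 0" using assms by auto
  qed
  have "{z. z ^ p = 1} = {z. poly ?P z = 0}" by (simp add: Polynomial.poly_monom)
  then show "finite {z :: 'f. z ^ p = 1}" "card {z :: 'f. z ^ p = 1} \<le> p"
    using poly_roots_finite[OF ne] card_poly_roots_bound[OF ne] deg by simp_all
qed

text \<open>An injective choice of p roots exhausts them, as there are at most p. Two such
  enumerations can then be matched, which is the origin of the relabelling.\<close>

lemma bij_betw_roots_of_unity:
  fixes f :: "nat \<Rightarrow> 'f::field"
  assumes "p > 0" "inj_on f {..<p}" "\<And>i. i < p \<Longrightarrow> f i ^ p = 1"
  shows "bij_betw f {..<p} {z. z ^ p = 1}"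
proof -
  have "f ` {..<p} \<subseteq> {z. z ^ p = 1}" using assms(3) by auto
  moreover have "card (f ` {..<p}) = p" using card_image[OF assms(2)] by simp
  ultimately have "f ` {..<p} = {z. z ^ p = 1}"
    using finite_roots_of_unity[OF assms(1), where 'f='f] by (metis card_mono card_subset_eq le_antisym)
  then show ?thesis using assms(2) by (simp add: bij_betw_def)
qed

text \<open>A geometric sum. It drives both the orthogonality of the linear characters of G/H and
  the selection made by the averaging element.\<close>

lemma sum_powers_root_of_unity:
  fixes z :: "'f::field"
  assumes "z ^ p = 1"
  shows "(\<Sum>k<p. z ^ k) = (if z = 1 then of_nat p else 0)"
proof (cases "z = 1")
  case False
  have "(1 - z) * (\<Sum>k<p. z ^ k) = 1 - z ^ p" by (simp add: one_diff_power_eq)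
  then show ?thesis using assms False by simp
qed simp

text \<open>Any root of 1 + X + ... + X^(p-1) works. It differs from 1 because p is nonzero in the
  field, and a positive exponent below p is invertible modulo the prime p, so no smaller power is
  1.\<close>

lemma ex_primitive_root:
  assumes p: "prime p" and "of_nat p \<noteq> (0 :: 'f::alg_closed_field)"
  shows "\<exists>\<zeta> :: 'f. primitive_root_of_unity p \<zeta>"
proof -
  have "p > 1" using p prime_gt_1_nat by blast
  then obtain \<zeta> :: 'f where z: "(\<Sum>k\<le>p - 1. 1 * \<zeta> ^ k) = 0"
    using alg_closed[of "p - 1" "\<lambda>_. 1 :: 'f"] by auto
  have "{..p - 1} = {..<p}" using \<open>p > 1\<close> by auto
  then have z: "(\<Sum>k<p. \<zeta> ^ k) = 0" using z by simp
  have ne: "\<zeta> \<noteq> 1" using z assms(2) by auto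
  have "1 - \<zeta> ^ p = (1 - \<zeta>) * (\<Sum>k<p. \<zeta> ^ k)" by (rule one_diff_power_eq)
  then have zp: "\<zeta> ^ p = 1" using z by simp
  have "\<zeta> ^ k \<noteq> 1" if k: "0 < k" "k < p" for k
  proof
    assume zk: "\<zeta> ^ k = 1"
    have "\<not> p dvd k" using k by (simp add: nat_dvd_not_less)
    then have "coprime k p" using p by (metis coprime_commute prime_imp_coprime)
    then obtain m q where "k * m = p * q + 1" using coprime_bezout_strong \<open>p > 1\<close> by (metis less_irrefl)
    then have "(\<zeta> ^ k) ^ m = (\<zeta> ^ p) ^ q * \<zeta>" by (metis power_add power_mult power_one_right)
    then show False using zk zp ne by simp
  qed
  then show ?thesis using zp by (auto simp: primitive_root_of_unity_def)
qed

section \<open>Scalar actions and class sums\<close>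

context finite_group
begin

lemma group_algebra_mult_closed: "a \<otimes>\<^bsub>group_algebra G\<^esub> b \<in> carrier (group_algebra G)"
  by (simp add: group_algebra_mult_eq group_algebra_simps)

lemma group_algebra_mult_sum:
  "a \<otimes>\<^bsub>group_algebra G\<^esub> (\<lambda>g. \<Sum>i\<in>I. f i g) = (\<lambda>g. \<Sum>i\<in>I. (a \<otimes>\<^bsub>group_algebra G\<^esub> f i) g)"
  by (rule ext) (simp add: group_algebra_mult_eq sum_distrib_left sum.swap[of _ I])

lemma algebra_action_smult:
  "algebra_action G n \<rho> (c \<odot>\<^bsub>group_algebra G\<^esub> a) = c \<cdot>\<^sub>m algebra_action G n \<rho> a"
  by (rule eq_matI) (simp_all add: algebra_action_def group_algebra_simps sum_distrib_left mult.assoc)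

lemma algebra_action_sum_scalar:
  assumes "\<And>i. i \<in> I \<Longrightarrow> algebra_action G n \<rho> (f i) = w i \<cdot>\<^sub>m 1\<^sub>m n"
  shows "algebra_action G n \<rho> (\<lambda>g. \<Sum>i\<in>I. f i g) = (\<Sum>i\<in>I. w i) \<cdot>\<^sub>m 1\<^sub>m n"
proof (rule eq_matI, goal_cases)
  case (1 r s)
  then have rs: "r < n" "s < n" by simp_all
  have "algebra_action G n \<rho> (\<lambda>g. \<Sum>i\<in>I. f i g) $$ (r, s) = (\<Sum>i\<in>I. algebra_action G n \<rho> (f i) $$ (r, s))"
    using rs by (simp add: algebra_action_def sum_distrib_right sum.swap[of _ I])
  also have "\<dots> = ((\<Sum>i\<in>I. w i) \<cdot>\<^sub>m 1\<^sub>m n) $$ (r, s)"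
    using assms rs by (simp add: sum_distrib_right)
  finally show ?case .
qed (simp_all add: algebra_action_def)

lemma algebra_action_pow:
  fixes \<rho> :: "'a \<Rightarrow> 'f::field mat"
  assumes r: "representation G n \<rho>" and a: "algebra_action G n \<rho> a = w \<cdot>\<^sub>m 1\<^sub>m n"
  shows "algebra_action G n \<rho> (a [^]\<^bsub>group_algebra G\<^esub> (k::nat)) = w ^ k \<cdot>\<^sub>m 1\<^sub>m n"
proof -
  interpret A: ring "group_algebra G :: ('f, 'a \<Rightarrow> 'f) module" by (rule group_algebra_ring)
  show ?thesis
  proof (induction k)
    case 0
    show ?case using algebra_action_single[OF r one_closed] representation_one[OF is_group r]
      by (simp add: group_algebra_simps)
  next
    case (Suc k)
    then show ?case
      by (simp add: algebra_action_mult[OF r] a mult_smult_distrib[of _ n n _ n] smult_smult_mat mult.commute)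
  qed
qed

definition conjugates :: "'a \<Rightarrow> 'a set" where
  "conjugates y = (\<lambda>g. g \<otimes> y \<otimes> inv g) ` carrier G"

lemma class_sum_eq: "class_sum G y z = (if z \<in> conjugates y then 1 else 0)"
  by (auto simp: class_sum_def conjugates_def)

lemma conjugates_closed: "y \<in> carrier G \<Longrightarrow> conjugates y \<subseteq> carrier G"
  by (auto simp: conjugates_def)

text \<open>The products g h and h g are conjugate, so the indicator of a conjugacy class is a class
  function.\<close>

lemma class_sum_central:
  assumes y: "y \<in> carrier G"
  shows "class_sum G y \<otimes>\<^bsub>group_algebra G\<^esub> a = a \<otimes>\<^bsub>group_algebra G\<^esub> class_sum G y"
proof (rule class_function_central)
  have sub: "g \<otimes> h \<in> conjugates y \<Longrightarrow> h \<otimes> g \<in> conjugates y" if "g \<in> carrier G" "h \<in> carrier G" for g h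
  proof -
    assume "g \<otimes> h \<in> conjugates y"
    then obtain u where u: "u \<in> carrier G" "g \<otimes> h = u \<otimes> y \<otimes> inv u" by (auto simp: conjugates_def)
    have "h \<otimes> g = h \<otimes> (g \<otimes> h) \<otimes> inv h" using that by (simp add: m_assoc)
    also have "\<dots> = (h \<otimes> u) \<otimes> y \<otimes> inv (h \<otimes> u)" unfolding u(2) using that u(1) y by (simp add: m_assoc inv_mult_group)
    finally show "h \<otimes> g \<in> conjugates y" using that u(1) by (auto simp: conjugates_def)
  qed
  show "class_sum G y (g \<otimes> h) = class_sum G y (h \<otimes> g)" if "g \<in> carrier G" "h \<in> carrier G" for g h
    using sub[OF that] sub[OF that(2,1)] by (auto simp: class_sum_eq)
qed

text \<open>The fibres of the conjugation map at y are left cosets of the centraliser and have equal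
  size. This makes the class size nonzero in the field whenever |G| is.\<close>

lemma card_conjugates_dvd:
  assumes y: "y \<in> carrier G"
  shows "card (conjugates y) dvd Coset.order G"
proof -
  let ?f = "\<lambda>g. g \<otimes> y \<otimes> inv g"
  let ?S = "{g \<in> carrier G. ?f g = y}"
  have "card {g \<in> carrier G. ?f g = z} = card ?S" if z: "z \<in> conjugates y" for z
  proof -
    obtain u where u: "u \<in> carrier G" "z = ?f u" using z by (auto simp: conjugates_def)
    have "bij_betw (\<lambda>g. u \<otimes> g) ?S {g \<in> carrier G. ?f g = z}"
    proof (rule bij_betwI[of _ _ _ "\<lambda>g. inv u \<otimes> g"])
      show "(\<lambda>g. u \<otimes> g) \<in> ?S \<rightarrow> {g \<in> carrier G. ?f g = z}"
      proof
        fix g assume "g \<in> ?S"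
        then have g: "g \<in> carrier G" "g \<otimes> y \<otimes> inv g = y" by auto
        have "u \<otimes> g \<otimes> y \<otimes> inv (u \<otimes> g) = u \<otimes> (g \<otimes> y \<otimes> inv g) \<otimes> inv u"
          using g(1) u(1) y by (simp add: m_assoc inv_mult_group)
        then show "u \<otimes> g \<in> {g \<in> carrier G. ?f g = z}" using g u by simp
      qed
      show "(\<lambda>g. inv u \<otimes> g) \<in> {g \<in> carrier G. ?f g = z} \<rightarrow> ?S"
      proof
        fix g assume "g \<in> {g \<in> carrier G. ?f g = z}"
        then have g: "g \<in> carrier G" "g \<otimes> y \<otimes> inv g = u \<otimes> y \<otimes> inv u" using u by auto
        have "inv u \<otimes> g \<otimes> y \<otimes> inv (inv u \<otimes> g) = inv u \<otimes> (g \<otimes> y \<otimes> inv g) \<otimes> u"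
          using g(1) u(1) y by (simp add: m_assoc inv_mult_group)
        also have "\<dots> = y" unfolding g(2) using u(1) y by (simp add: m_assoc mult_inv_cancel)
        finally show "inv u \<otimes> g \<in> ?S" using g(1) u(1) by simp
      qed
    qed (use u in \<open>auto simp: mult_inv_cancel\<close>)
    then show ?thesis by (rule bij_betw_same_card[symmetric])
  qed
  then have "(\<Sum>z\<in>conjugates y. card {g \<in> carrier G. ?f g = z}) = card (conjugates y) * card ?S" by simp
  moreover have "(\<Sum>g\<in>carrier G. 1 :: nat) = (\<Sum>z\<in>conjugates y. \<Sum>g\<in>{g \<in> carrier G. ?f g = z}. 1)"
    unfolding conjugates_def by (rule sum.image_gen[OF finite_carrier])
  ultimately show ?thesis by (simp add: Coset.order_def)
qed

end

section \<open>The case of equivalent conjugates\<close>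

context prime_index_subgroup
begin

lemma root_power_well_defined:
  fixes \<zeta> :: "'f::field"
  assumes z: "\<zeta> ^ p = 1" and h: "h \<in> H" "h' \<in> H" and eq: "x [^] k \<otimes> h = x [^] l \<otimes> h'" and kl: "k \<le> (l::nat)"
  shows "\<zeta> ^ k = \<zeta> ^ l"
proof -
  have c: "h \<in> carrier G" "h' \<in> carrier G" using h H_closed by auto
  obtain d where d: "l = k + d" using kl le_Suc_ex by blast
  have "x [^] k \<otimes> h = x [^] k \<otimes> (x [^] d \<otimes> h')"
    using eq c x_closed by (simp add: d nat_pow_mult[symmetric] m_assoc)
  then have "h = x [^] d \<otimes> h'" using c x_closed by simp
  then have "x [^] d = h \<otimes> inv h'" using c x_closed by (simp add: mult_inv_cancel)
  then have "x [^] d \<in> H" using h N.m_inv_closed by simp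
  then obtain q where "d = p * q" using x_pow_mem by blast
  then show ?thesis using z by (simp add: d power_add power_mult)
qed

lemma root_coset_exp:
  fixes \<zeta> :: "'f::field"
  assumes z: "\<zeta> ^ p = 1" and h: "h \<in> H"
  shows "\<zeta> ^ coset_exp (x [^] (k::nat) \<otimes> h) = \<zeta> ^ k"
proof -
  let ?g = "x [^] k \<otimes> h" and ?l = "coset_exp (x [^] k \<otimes> h)"
  have g: "?g \<in> carrier G" using h H_closed x_closed by simp
  have "x [^] ?l \<otimes> (inv (x [^] ?l) \<otimes> ?g) = x [^] k \<otimes> h"
    using g x_closed by (simp add: mult_inv_cancel)
  then show ?thesis
    using root_power_well_defined[OF z coset_exp[OF g] h] root_power_well_defined[OF z h coset_exp[OF g]]
    by (metis nat_le_linear)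
qed

text \<open>The exponent itself is additive only modulo p; as an exponent of a p-th root of unity it
  gives a linear character of G.\<close>

lemma root_coset_exp_mult:
  fixes \<zeta> :: "'f::field"
  assumes z: "\<zeta> ^ p = 1" and g: "g \<in> carrier G" "g' \<in> carrier G"
  shows "\<zeta> ^ coset_exp (g \<otimes> g') = \<zeta> ^ coset_exp g * \<zeta> ^ coset_exp g'"
proof -
  obtain k h where kh: "h \<in> H" "g = x [^] (k::nat) \<otimes> h" using decompose[OF g(1)] by blast
  obtain l h' where lh: "h' \<in> H" "g' = x [^] (l::nat) \<otimes> h'" using decompose[OF g(2)] by blast
  let ?h = "inv (x [^] l) \<otimes> h \<otimes> x [^] l"
  have h: "?h \<in> H" using conj_closed'[OF _ kh(1)] x_closed by simp
  have c: "h \<in> carrier G" "h' \<in> carrier G" using kh lh H_closed by auto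
  have "g \<otimes> g' = x [^] k \<otimes> (x [^] l \<otimes> inv (x [^] l)) \<otimes> h \<otimes> x [^] l \<otimes> h'"
    using kh lh c x_closed by (simp add: m_assoc)
  also have "\<dots> = x [^] (k + l) \<otimes> (?h \<otimes> h')"
    using c x_closed by (simp only: nat_pow_mult[symmetric] m_assoc m_closed inv_closed nat_pow_closed)
  finally show ?thesis
    using root_coset_exp[OF z, of "?h \<otimes> h'" "k + l"] root_coset_exp[OF z kh(1), of k]
      root_coset_exp[OF z lh(1), of l] h lh kh by (simp add: power_add)
qed

lemma dvd_coset_exp_iff: "g \<in> carrier G \<Longrightarrow> p dvd coset_exp g \<longleftrightarrow> g \<in> H"
proof -
  assume g: "g \<in> carrier G"
  let ?k = "coset_exp g"
  have xk: "x [^] ?k \<in> carrier G" using x_closed by simp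
  have h: "inv (x [^] ?k) \<otimes> g \<in> H" by (rule coset_exp[OF g])
  have "g \<in> H" if "x [^] ?k \<in> H"
    using N.m_closed[OF that h] xk g by (simp add: mult_inv_cancel)
  moreover have "x [^] ?k \<in> H" if "g \<in> H"
  proof -
    have "g \<otimes> inv (inv (x [^] ?k) \<otimes> g) \<in> H" using that h by simp
    then show ?thesis using xk g by (simp add: inv_mult_group m_assoc[symmetric])
  qed
  ultimately show ?thesis using x_pow_mem by blast
qed

lemma extension_smult:
  fixes \<eta> :: "'a \<Rightarrow> 'f::field mat"
  assumes r: "representation K n \<eta>" and M: "M \<in> carrier_mat n n" and g: "g \<in> carrier G"
  shows "extension (c \<cdot>\<^sub>m M) \<eta> g = c ^ coset_exp g \<cdot>\<^sub>m extension M \<eta> g"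
  unfolding extension_def using M K_carrier[OF r coset_exp[OF g]]
  by (simp add: pow_mat_smult[OF M] mult_smult_assoc_mat[of _ n n _ n])

text \<open>The equivalence supplies Q implementing conjugation by x. Its p-th power and
  \<open>\<eta> (x [^] p)\<close> implement the same conjugation, so Schur's lemma makes them
  proportional; a p-th root of the inverse factor rescales Q.\<close>

lemma exists_extension_matrix:
  fixes \<eta> :: "'a \<Rightarrow> 'f::alg_closed_field mat"
  assumes irr: "irreducible_representation K n \<eta>"
    and eq: "equivalent_representations K \<eta> (conjugate_representation G x \<eta>)"
  obtains M where "M \<in> carrier_mat n n" "M ^\<^sub>m p = \<eta> (x [^] p)"
    "\<And>h. h \<in> H \<Longrightarrow> M * \<eta> h = \<eta> (x \<otimes> h \<otimes> inv x) * M"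
proof -
  have r: "representation K n \<eta>" and n: "n > 0" using irr by (auto simp: irreducible_representation_def)
  note rc = K_carrier[OF r]
  have "\<one> \<in> carrier K" by simp
  then have "carrier K \<noteq> {}" by blast
  then obtain P Q where PQ: "P \<in> carrier_mat n n" "Q \<in> carrier_mat n n" "P * Q = 1\<^sub>m n" "Q * P = 1\<^sub>m n"
    "\<And>h. h \<in> carrier K \<Longrightarrow> \<eta> h = P * conjugate_representation G x \<eta> h * Q"
    using equivalent_representationsE[OF eq representation_carrier[OF group_K r]] by metis
  have Qc: "Q * \<eta> h = \<eta> (x \<otimes> h \<otimes> inv x) * Q" if h: "h \<in> H" for h
  proof -
    have c: "\<eta> (x \<otimes> h \<otimes> inv x) \<in> carrier_mat n n" using conj_closed[OF x_closed h] rc by simp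
    have "Q * \<eta> h = Q * (P * \<eta> (x \<otimes> h \<otimes> inv x) * Q)"
      using PQ(5)[of h] h by (simp add: conjugate_representation_def)
    also have "\<dots> = (Q * P) * (\<eta> (x \<otimes> h \<otimes> inv x) * Q)"
      using PQ(1,2) c by (simp add: square_mult_assoc[of _ n])
    finally show ?thesis using PQ(2,4) c left_mult_one_mat[OF square_mult_carrier_mat[OF c PQ(2)]] by simp
  qed
  have xp: "x [^] p \<in> H" using x_pow_mem by simp
  let ?B = "\<eta> (inv (x [^] p))"
  have B: "?B \<in> carrier_mat n n" "\<eta> (x [^] p) \<in> carrier_mat n n" using xp rc by simp_all
  have Qp: "Q ^\<^sub>m p \<in> carrier_mat n n" using PQ by simp
  obtain s where s: "?B * Q ^\<^sub>m p = s \<cdot>\<^sub>m 1\<^sub>m n"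
  proof (rule schur_scalar[OF group_K irr])
    show "?B * Q ^\<^sub>m p \<in> carrier_mat n n" using B Qp by simp
    fix h assume "h \<in> carrier K"
    then have h: "h \<in> H" by simp
    let ?c = "x [^] p \<otimes> h \<otimes> inv (x [^] p)"
    have c: "?c \<in> H" using conj_closed[OF _ h] x_closed by simp
    have "?B * Q ^\<^sub>m p * \<eta> h = ?B * (\<eta> ?c * Q ^\<^sub>m p)"
      using B Qp rc[OF h] pow_conj[of \<eta> n Q, OF rc PQ(2) Qc h, of p] by (simp add: square_mult_assoc[of _ n])
    also have "\<dots> = \<eta> (inv (x [^] p) \<otimes> ?c) * Q ^\<^sub>m p"
      using B Qp rc[OF c] xp c by (simp add: K_mult[OF r] square_mult_assoc[of _ n])
    also have "inv (x [^] p) \<otimes> ?c = h \<otimes> inv (x [^] p)"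
      using x_closed H_closed[OF h] by (simp add: m_assoc mult_inv_cancel)
    also have "\<eta> (h \<otimes> inv (x [^] p)) * Q ^\<^sub>m p = \<eta> h * (?B * Q ^\<^sub>m p)"
      using B Qp rc[OF h] xp h by (simp add: K_mult[OF r] square_mult_assoc[of _ n])
    finally show "\<eta> h * (?B * Q ^\<^sub>m p) = ?B * Q ^\<^sub>m p * \<eta> h" by simp
  qed
  have Bi: "\<eta> (x [^] p) * ?B = 1\<^sub>m n" using K_inverse(2)[OF r xp] .
  have "Q ^\<^sub>m p = (\<eta> (x [^] p) * ?B) * Q ^\<^sub>m p" using Bi left_mult_one_mat[OF Qp] by simp
  also have "\<dots> = \<eta> (x [^] p) * (s \<cdot>\<^sub>m 1\<^sub>m n)" using B Qp s by (simp add: square_mult_assoc[of _ n])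
  also have "\<dots> = s \<cdot>\<^sub>m \<eta> (x [^] p)" using B by (simp add: mult_smult_distrib[of _ n n _ n])
  finally have Qs: "Q ^\<^sub>m p = s \<cdot>\<^sub>m \<eta> (x [^] p)" .
  \<comment> \<open>Q is invertible, so its p-th power has nonzero determinant.\<close>
  have "s \<noteq> 0"
  proof
    assume "s = 0"
    then have "det (Q ^\<^sub>m p) = 0" using Qs B n by (simp add: zero_power)
    moreover have "det Q * det P = 1" using PQ(1,2,4) det_mult[OF PQ(2,1)] by simp
    ultimately show False using det_pow_mat[OF PQ(2), of p] by auto
  qed
  obtain c where c: "c ^ p = inverse s" using nth_root_exists[OF p_pos] by blast
  show ?thesis
  proof (rule that[of "c \<cdot>\<^sub>m Q"])
    show "c \<cdot>\<^sub>m Q \<in> carrier_mat n n" using PQ by simp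
    show "(c \<cdot>\<^sub>m Q) ^\<^sub>m p = \<eta> (x [^] p)"
      using \<open>s \<noteq> 0\<close> by (simp add: pow_mat_smult[OF PQ(2)] Qs c smult_smult_mat)
    show "c \<cdot>\<^sub>m Q * \<eta> h = \<eta> (x \<otimes> h \<otimes> inv x) * (c \<cdot>\<^sub>m Q)" if h: "h \<in> H" for h
      using PQ(2) rc[OF h] rc[OF conj_closed[OF x_closed h]] Qc[OF h]
      by (simp add: mult_smult_assoc_mat[of _ n n _ n] mult_smult_distrib[of _ n n _ n])
  qed
qed

end

text \<open>The root \<zeta> fixed here only numbers the extensions; the root in the final formula
  is arbitrary, appears below as \<xi>, and is accommodated by a permutation of the labels.\<close>

locale invariant_representation = prime_index_transversal +
  fixes \<eta> :: "'a \<Rightarrow> 'f::alg_closed_field mat" and n M and \<zeta> :: 'f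
  assumes irr: "irreducible_representation K n \<eta>"
    and ord: "of_nat (Coset.order G) \<noteq> (0 :: 'f)"
    and M: "M \<in> carrier_mat n n" and Mp: "M ^\<^sub>m p = \<eta> (x [^] p)"
    and Mc: "\<And>h. h \<in> H \<Longrightarrow> M * \<eta> h = \<eta> (x \<otimes> h \<otimes> inv x) * M"
    and \<zeta>: "primitive_root_of_unity p \<zeta>"
begin

text \<open>Rescaling M by a p-th root of unity preserves both conditions on M, which produces p
  extensions from one.\<close>

definition ext :: "nat \<Rightarrow> 'a \<Rightarrow> 'f mat" where
  "ext i = extension (\<zeta> ^ i \<cdot>\<^sub>m M) \<eta>"

lemma rep: "representation K n \<eta>" and n_pos: "n > 0"
  using irr by (auto simp: irreducible_representation_def)

lemma \<zeta>_pow: "\<zeta> ^ p = 1"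
  using \<zeta> by (simp add: primitive_root_of_unity_def)

lemma \<zeta>_pow_pow: "(\<zeta> ^ i) ^ p = 1"
  using \<zeta>_pow by (metis mult.commute power_mult power_one)

lemma ext_conditions:
  shows "\<zeta> ^ i \<cdot>\<^sub>m M \<in> carrier_mat n n" "(\<zeta> ^ i \<cdot>\<^sub>m M) ^\<^sub>m p = \<eta> (x [^] p)"
    "\<And>h. h \<in> H \<Longrightarrow> (\<zeta> ^ i \<cdot>\<^sub>m M) * \<eta> h = \<eta> (x \<otimes> h \<otimes> inv x) * (\<zeta> ^ i \<cdot>\<^sub>m M)"
  using M K_carrier[OF rep] conj_closed[OF x_closed]
  by (simp_all add: pow_mat_smult[OF M] \<zeta>_pow_pow Mp Mc mult_smult_assoc_mat[of _ n n _ n] mult_smult_distrib[of _ n n _ n])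

lemma ext_representation: "representation G n (ext i)"
  unfolding ext_def by (rule extension_representation[OF rep ext_conditions])

lemma ext_restrict: "h \<in> H \<Longrightarrow> ext i h = \<eta> h"
  unfolding ext_def by (rule extension_restrict[OF rep ext_conditions])

lemma ext_irreducible: "irreducible_representation G n (ext i)"
  by (rule irreducible_of_restrict[OF ext_representation irr ext_restrict])

text \<open>Each extension is the zeroth one twisted by a power of a linear character of G/H, so
  statements about the family reduce to \<open>ext 0\<close> and roots of unity.\<close>

lemma ext_eq: "g \<in> carrier G \<Longrightarrow> ext i g = (\<zeta> ^ coset_exp g) ^ i \<cdot>\<^sub>m ext 0 g"
  by (simp add: ext_def extension_smult[OF rep M] power_mult[symmetric] mult.commute)

lemma ext_carrier: "g \<in> carrier G \<Longrightarrow> ext i g \<in> carrier_mat n n"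
  by (rule representation_carrier[OF is_group ext_representation])

lemma ext_restrict_equivalent: "equivalent_representations K (ext i) \<eta>"
  unfolding equivalent_representations_def
  using similar_mat_wit_refl[OF K_carrier[OF rep]] ext_restrict
  by (intro exI[of _ "1\<^sub>m n"] ballI) simp

lemma character_ext: "g \<in> carrier G \<Longrightarrow> character n (ext i) g = (\<zeta> ^ coset_exp g) ^ i * character n (ext 0) g"
  using ext_carrier[of g 0] unfolding character_def ext_eq[of g i] by (simp add: sum_distrib_left)

lemma root_outside: "g \<in> carrier G \<Longrightarrow> g \<notin> H \<Longrightarrow> primitive_root_of_unity p (\<zeta> ^ coset_exp g)"
  by (rule primitive_root_power[OF \<zeta> prime_p]) (simp add: dvd_coset_exp_iff)

lemma root_inside: "h \<in> H \<Longrightarrow> \<zeta> ^ coset_exp h = 1"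
  using primitive_root_pow_eq_1_iff[OF \<zeta> p_pos] dvd_coset_exp_iff[of h] H_closed by simp

text \<open>Orthogonality for G/H, with the sum taken over its linear characters at a fixed
  element.\<close>

lemma sum_roots:
  assumes g: "g \<in> carrier G"
  shows "(\<Sum>i<p. (\<zeta> ^ coset_exp g) ^ i) = (if g \<in> H then of_nat p else 0)"
proof -
  have "\<zeta> ^ coset_exp g = 1 \<longleftrightarrow> g \<in> H"
    using primitive_root_pow_eq_1_iff[OF \<zeta> p_pos] dvd_coset_exp_iff[OF g] by simp
  then show ?thesis using sum_powers_root_of_unity[OF \<zeta>_pow_pow, of "coset_exp g"] by simp
qed

text \<open>
  If the character vanished off \<open>H\<close>, then \<open>M\<close> would be orthogonal, for the trace form, to all
  matrices \<open>\<eta> h\<close>; by Schur orthogonality these span the full matrix algebra.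
\<close>

lemma exists_nonvanishing: "\<exists>y\<in>carrier G - H. character n (ext 0) y \<noteq> 0"
proof (rule ccontr)
  assume "\<not> (\<exists>y\<in>carrier G - H. character n (ext 0) y \<noteq> 0)"
  then have z: "character n (ext 0) y = 0" if "y \<in> carrier G" "y \<notin> H" for y using that by blast
  note rc = K_carrier[OF rep]
  have tr: "(\<Sum>a<n. \<Sum>b<n. M $$ (a, b) * \<eta> h $$ (b, a)) = 0" if h: "h \<in> H" for h
  proof -
    have "x \<otimes> h \<notin> H"
    proof
      assume "x \<otimes> h \<in> H"
      then have "x \<otimes> h \<otimes> inv h \<in> H" by (rule N.m_closed[OF _ N.m_inv_closed[OF h]])
      then have "x [^] (1::nat) \<in> H" using h H_closed x_closed by (simp add: mult_inv_cancel)
      then show False using x_pow_mem[of 1] prime_p by simp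
    qed
    then have "character n (ext 0) (x \<otimes> h) = 0" using z h H_closed x_closed by simp
    moreover have "ext 0 (x \<otimes> h) = M * \<eta> h"
      using extension_eq[OF rep M Mp Mc h, of 1] x_closed M by (simp add: ext_def)
    ultimately have "(\<Sum>a<n. (M * \<eta> h) $$ (a, a)) = 0" by (simp add: character_def)
    moreover have "(\<Sum>a<n. (M * \<eta> h) $$ (a, a)) = (\<Sum>a<n. \<Sum>b<n. M $$ (a, b) * \<eta> h $$ (b, a))"
      using M rc[OF h] by (intro sum.cong refl index_mult_mat_sum[of _ n n _ n]) auto
    ultimately show ?thesis by simp
  qed
  have "M $$ (k, l) = 0" if kl: "k < n" "l < n" for k l
  proof -
    \<comment> \<open>Orthogonality for H, contracted against M, leaves the single entry (k, l) of M
      times |H|.\<close>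
    have "(\<Sum>a<n. \<Sum>b<n. M $$ (a, b) * (of_nat n * (\<Sum>h\<in>carrier K. \<eta> h $$ (b, a) * \<eta> (inv\<^bsub>K\<^esub> h) $$ (k, l)))) =
        of_nat n * (\<Sum>h\<in>H. (\<Sum>a<n. \<Sum>b<n. M $$ (a, b) * \<eta> h $$ (b, a)) * \<eta> (inv h) $$ (k, l))"
      by (simp add: K_inv sum_distrib_left sum_distrib_right sum.swap[of _ H] mult_ac)
    also have "\<dots> = 0" by (simp add: tr)
    also have "(\<Sum>a<n. \<Sum>b<n. M $$ (a, b) * (of_nat n * (\<Sum>h\<in>carrier K. \<eta> h $$ (b, a) * \<eta> (inv\<^bsub>K\<^esub> h) $$ (k, l)))) =
        (\<Sum>a<n. \<Sum>b<n. if b = l then if a = k then M $$ (k, l) * of_nat (card H) else 0 else 0)"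
    proof (intro sum.cong refl)
      fix a b assume "a \<in> {..<n}" "b \<in> {..<n}"
      then have ab: "b < n" "a < n" by simp_all
      show "M $$ (a, b) * (of_nat n * (\<Sum>h\<in>carrier K. \<eta> h $$ (b, a) * \<eta> (inv\<^bsub>K\<^esub> h) $$ (k, l))) =
          (if b = l then if a = k then M $$ (k, l) * of_nat (card H) else 0 else 0)"
        unfolding K.schur_orthogonality[OF irr ab kl] order_K by auto
    qed
    finally show ?thesis using kl of_nat_order_nonzero(2)[OF ord] by simp
  qed
  then have "M = 0\<^sub>m n n" using M by (intro eq_matI) auto
  \<comment> \<open>A zero M contradicts \<open>Mp\<close>, whose right-hand side is invertible; p
    is positive, so the power of zero is zero.\<close>
  then have "M ^\<^sub>m p = 0\<^sub>m n n" using p_pos by (cases p) simp_all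
  then have "\<eta> (x [^] p) * \<eta> (inv (x [^] p)) = 0\<^sub>m n n"
    using Mp rc[of "inv (x [^] p)"] x_pow_mem[of p] by (simp add: left_mult_zero_mat[of _ n])
  then have "1\<^sub>m n = (0\<^sub>m n n :: 'f mat)" using K_inverse(2)[OF rep, of "x [^] p"] x_pow_mem[of p] by simp
  then have "(1\<^sub>m n :: 'f mat) $$ (0, 0) = 0\<^sub>m n n $$ (0, 0)" by simp
  then show False using n_pos by simp
qed

text \<open>At an element outside H with nonzero character the p character values are that value
  times distinct roots of unity.\<close>

lemma ext_inequivalent:
  assumes ij: "i < p" "j < p" "i \<noteq> j"
  shows "\<not> equivalent_representations G (ext i) (ext j)"
proof
  assume e: "equivalent_representations G (ext i) (ext j)"
  obtain y where y: "y \<in> carrier G" "y \<notin> H" "character n (ext 0) y \<noteq> 0" using exists_nonvanishing by blast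
  have "character n (ext i) y = character n (ext j) y"
    by (rule character_equivalent[OF e ext_carrier y(1)])
  then have "(\<zeta> ^ coset_exp y) ^ i = (\<zeta> ^ coset_exp y) ^ j" using y by (simp add: character_ext[of y i] character_ext[of y j])
  then show False using primitive_root_inj[OF root_outside[OF y(1,2)]] ij by (auto simp: inj_on_def)
qed

text \<open>In coordinates this is the map sending g \<otimes> v to \<open>ext k g\<close> applied
  to v, for all k at once; its inverse is a Fourier inversion over the linear characters of
  G/H.\<close>

lemma induced_equivalent_sum:
  "equivalent_representations G (induced_representation G H ts n \<eta>) (direct_sum_representation p ext)"
proof -
  note tc = transversal_closed[unfolded length_transversal]
  have pn: "of_nat p \<noteq> (0 :: 'f)" using of_nat_order_nonzero(1)[OF ord] .
  \<comment> \<open>Block (k, i) describes the images of the vectors t_i \<otimes> v in the k-th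
    extension; the factor 1 / p in S' normalises the Fourier inversion.\<close>
  define S where "S = (\<lambda>k i. ext k (ts ! i))"
  define S' where "S' = (\<lambda>i k. inverse (of_nat p) \<cdot>\<^sub>m ext k (inv (ts ! i)))"
  have Sc: "S k i \<in> carrier_mat n n" "S' i k \<in> carrier_mat n n" if "i < p" for i k
    using ext_carrier tc[OF that] by (simp_all add: S_def S'_def)
  have D: "direct_sum_representation p ext g = block_mat p n (\<lambda>i j. if i = j then ext i g else 0\<^sub>m n n)"
    if "g \<in> carrier G" for g
    unfolding direct_sum_representation_def using ext_carrier[OF that] by (rule diag_block_mat_eq_block_mat)
  show ?thesis
  proof (rule equivalent_representationsI[of "block_mat p n S" "p * n" "block_mat p n S'"])
    show "block_mat p n S' * block_mat p n S = 1\<^sub>m (p * n)"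
      unfolding block_mat_one[symmetric]
    proof (subst block_mat_mult, goal_cases)
      case 3
      show ?case
      proof (rule block_mat_cong)
        fix i j assume ij: "i < p" "j < p"
        let ?g = "inv (ts ! i) \<otimes> ts ! j"
        have g: "?g \<in> carrier G" and ti: "inv (ts ! i) \<in> carrier G" "ts ! j \<in> carrier G" using tc ij by simp_all
        \<comment> \<open>The dependence on k is confined to a power of one root of unity, so the
          sum over k is p or 0 according to whether t_i and t_j represent the same coset.\<close>
        have prod: "S' i k * S k j = (inverse (of_nat p) * (\<zeta> ^ coset_exp ?g) ^ k) \<cdot>\<^sub>m ext 0 ?g" for k
        proof -
          have "S' i k * S k j = inverse (of_nat p) \<cdot>\<^sub>m ext k ?g"
            unfolding S_def S'_def using ext_carrier[OF ti(1), of k] ext_carrier[OF ti(2), of k]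
            by (simp add: mult_smult_assoc_mat[of _ n n _ n] representation_mult[OF is_group ext_representation ti])
          then show ?thesis using ext_eq[OF g, of k] by (simp add: smult_smult_mat)
        qed
        show "mat_sum n {..<p} (\<lambda>k. S' i k * S k j) = (if i = j then 1\<^sub>m n else 0\<^sub>m n n)"
        proof (rule eq_matI, goal_cases)
          case (1 r s)
          then have rs: "r < n" "s < n" by (simp_all split: if_splits)
          have "mat_sum n {..<p} (\<lambda>k. S' i k * S k j) $$ (r, s) =
              (\<Sum>k<p. inverse (of_nat p) * (\<zeta> ^ coset_exp ?g) ^ k * ext 0 ?g $$ (r, s))"
            unfolding prod using rs ext_carrier[OF g, of 0] by (simp add: mat_sum_index)
          also have "\<dots> = inverse (of_nat p) * (\<Sum>k<p. (\<zeta> ^ coset_exp ?g) ^ k) * ext 0 ?g $$ (r, s)"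
            by (simp add: sum_distrib_left sum_distrib_right mult.assoc)
          also have "\<dots> = (if i = j then 1\<^sub>m n else 0\<^sub>m n n) $$ (r, s)"
            using sum_roots[OF g] transversal_eq_iff[of i j] ij length_transversal rs pn tc[OF ij(1)]
              representation_one[OF is_group ext_representation[of 0]] by auto
          finally show ?case .
        qed simp_all
      qed
    qed (use Sc in auto)
    fix g assume g: "g \<in> carrier G"
    show "induced_representation G H ts n \<eta> g \<in> carrier_mat (p * n) (p * n)" by (simp add: induced_eq[OF rep])
    show "direct_sum_representation p ext g \<in> carrier_mat (p * n) (p * n)" using D[OF g] by simp
    let ?A = "\<lambda>i j. if inv (ts ! i) \<otimes> g \<otimes> ts ! j \<in> H then \<eta> (inv (ts ! i) \<otimes> g \<otimes> ts ! j) else 0\<^sub>m n n"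
    let ?D = "\<lambda>i j. if i = j then ext i g else 0\<^sub>m n n"
    have Ac: "?A i j \<in> carrier_mat n n" for i j by (rule block_carrier[OF rep])
    have Dc: "?D i j \<in> carrier_mat n n" for i j using ext_carrier[OF g, of i] by (cases "i = j") simp_all
    have "block_mat p n S * block_mat p n ?A = block_mat p n (\<lambda>l j. mat_sum n {..<p} (\<lambda>i. S l i * ?A i j))"
      using Sc Ac by (intro block_mat_mult)
    also have "\<dots> = block_mat p n (\<lambda>l j. mat_sum n {..<p} (\<lambda>i. ?D l i * S i j))"
    proof (rule block_mat_cong)
      fix l j assume lj: "l < p" "j < p"
      obtain i where i: "i < p" "inv (ts ! i) \<otimes> g \<otimes> ts ! j \<in> H"
        "\<And>k. k < p \<Longrightarrow> k \<noteq> i \<Longrightarrow> inv (ts ! k) \<otimes> g \<otimes> ts ! j \<notin> H"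
        using coset_block[OF g lj(2)] by blast
      have c: "ts ! i \<in> carrier G" "ts ! j \<in> carrier G" using tc i lj by simp_all
      have a: "inv (ts ! i) \<otimes> g \<otimes> ts ! j \<in> carrier G" using i(2) H_closed by blast
      have "mat_sum n {..<p} (\<lambda>i. S l i * ?A i j) = S l i * ?A i j"
      proof (rule mat_sum_single)
        show "S l i * ?A i j \<in> carrier_mat n n"
          using Sc(1)[OF i(1)] Ac by (rule square_mult_carrier_mat)
        show "S l k * ?A k j = 0\<^sub>m n n" if "k \<in> {..<p}" "k \<noteq> i" for k
          using that Sc(1)[of k l] i(3)[of k] by (simp add: right_mult_zero_mat[of _ n n])
      qed (use i in simp_all)
      also have "\<dots> = ext l (ts ! i) * ext l (inv (ts ! i) \<otimes> g \<otimes> ts ! j)"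
        using i(2) by (simp add: S_def ext_restrict)
      also have "\<dots> = ext l (ts ! i \<otimes> (inv (ts ! i) \<otimes> g \<otimes> ts ! j))"
        by (rule representation_mult[OF is_group ext_representation c(1) a, symmetric])
      also have "ts ! i \<otimes> (inv (ts ! i) \<otimes> g \<otimes> ts ! j) = g \<otimes> ts ! j"
        using c g by (simp add: m_assoc mult_inv_cancel)
      also have "ext l (g \<otimes> ts ! j) = ?D l l * S l j"
        using representation_mult[OF is_group ext_representation g c(2)] by (simp add: S_def)
      also have "\<dots> = mat_sum n {..<p} (\<lambda>i. ?D l i * S i j)"
      proof (rule mat_sum_single[symmetric])
        show "?D l l * S l j \<in> carrier_mat n n" using Dc Sc(1)[OF lj(2)] by (rule square_mult_carrier_mat)
        show "?D l i * S i j = 0\<^sub>m n n" if "i \<noteq> l" for i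
          using that Sc(1)[OF lj(2), of i] by (simp add: left_mult_zero_mat[of _ n])
      qed (use lj in simp_all)
      finally show "mat_sum n {..<p} (\<lambda>i. S l i * ?A i j) = mat_sum n {..<p} (\<lambda>i. ?D l i * S i j)" .
    qed
    also have "\<dots> = block_mat p n ?D * block_mat p n S"
      using Sc Dc by (intro block_mat_mult[symmetric])
    finally show "block_mat p n S * induced_representation G H ts n \<eta> g =
        direct_sum_representation p ext g * block_mat p n S"
      using induced_eq[OF rep, of g] D[OF g] by simp
  qed simp_all
qed

lemma idempotent_eta: "representation_idempotent K n \<eta> = character_idempotent K n \<eta>"
  using K.representation_idempotent_eq[OF irr] of_nat_order_nonzero(2)[OF ord] by (simp add: order_K)

lemma idempotent_ext: "representation_idempotent G n (ext i) = character_idempotent G n (ext i)"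
  by (rule representation_idempotent_eq[OF ext_irreducible ord])

text \<open>Summing the twisted characters over i gives p times the character of \<eta> on H and 0
  elsewhere; the p cancels against |G| = p |H|.\<close>

lemma idempotent_eta_sum: "character_idempotent K n \<eta> = (\<lambda>g. \<Sum>i<p. character_idempotent G n (ext i) g)"
proof
  fix g
  show "character_idempotent K n \<eta> g = (\<Sum>i<p. character_idempotent G n (ext i) g)"
  proof (cases "g \<in> carrier G")
    case True
    have iH: "inv g \<in> H \<longleftrightarrow> g \<in> H" using True N.m_inv_closed by (metis inv_inv)
    have g': "inv g \<in> carrier G" using True by simp
    define z where "z = \<zeta> ^ coset_exp (inv g)"
    define c :: 'f where "c = of_nat n / of_nat (p * card H)"
    have e: "character_idempotent G n (ext i) g = c * (z ^ i * character n (ext 0) (inv g))" for i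
      using True by (simp only: character_idempotent_def order_G if_True c_def z_def character_ext[OF g', of i])
    have "(\<Sum>i<p. character_idempotent G n (ext i) g) = c * ((\<Sum>i<p. z ^ i) * character n (ext 0) (inv g))"
      by (simp only: e sum_distrib_left sum_distrib_right)
    also have "\<dots> = (if g \<in> H then of_nat n / of_nat (card H) * character n \<eta> (inv g) else 0)"
    proof (cases "g \<in> H")
      case True
      then have "character n (ext 0) (inv g) = character n \<eta> (inv g)"
        using iH by (simp add: character_def ext_restrict)
      moreover have "c * of_nat p = of_nat n / of_nat (card H)"
        using of_nat_order_nonzero(1)[OF ord] by (simp add: c_def)
      ultimately show ?thesis using sum_roots[OF g'] True iH by (simp add: z_def mult.assoc[symmetric])
    next
      case False
      then show ?thesis using sum_roots[OF g'] iH by (simp add: z_def)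
    qed
    also have "\<dots> = character_idempotent K n \<eta> g" by (simp add: character_idempotent_def order_K K_inv)
    finally show ?thesis by (rule sym)
  qed (auto simp: character_idempotent_def H_closed)
qed

text \<open>The idempotent is supported on H, where every extension agrees with \<eta>.\<close>

lemma ext_action_eta: "algebra_action G n (ext i) (character_idempotent K n \<eta>) = 1\<^sub>m n"
proof -
  have "algebra_action G n (ext i) (character_idempotent K n \<eta>) = algebra_action K n \<eta> (character_idempotent K n \<eta>)"
  proof (rule eq_matI, goal_cases)
    case (1 r s)
    then have rs: "r < n" "s < n" by (simp_all add: algebra_action_def)
    have "(\<Sum>g\<in>carrier G. character_idempotent K n \<eta> g * ext i g $$ (r, s)) =
        (\<Sum>g\<in>H. character_idempotent K n \<eta> g * ext i g $$ (r, s))"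
      using finite_carrier N.subset by (intro sum.mono_neutral_right) (auto simp: character_idempotent_def)
    also have "\<dots> = (\<Sum>g\<in>H. character_idempotent K n \<eta> g * \<eta> g $$ (r, s))"
      by (simp add: ext_restrict)
    finally show ?case using rs by (simp add: algebra_action_def)
  qed (simp_all add: algebra_action_def)
  also have "\<dots> = 1\<^sub>m n"
    using K.algebra_action_character_idempotent[OF irr] of_nat_order_nonzero(2)[OF ord] by (simp add: order_K)
  finally show ?thesis .
qed

text \<open>A linear character is constant on the class of y, so the scalar for \<open>ext i\<close>
  is that for \<open>ext 0\<close> times a power of a root of unity; taking traces relates w to the
  character at y.\<close>

lemma ext_action_class_sum:
  assumes y: "y \<in> carrier G"
  obtains w where "\<And>i. algebra_action G n (ext i) (class_sum G y) = ((\<zeta> ^ coset_exp y) ^ i * w) \<cdot>\<^sub>m 1\<^sub>m n"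
    "of_nat n * w = of_nat (card (conjugates y)) * character n (ext 0) y"
proof -
  obtain w where w: "algebra_action G n (ext 0) (class_sum G y) = w \<cdot>\<^sub>m 1\<^sub>m n"
    using central_acts_as_scalar[OF ext_irreducible class_sum_central[OF y]] by blast
  have conj: "\<zeta> ^ coset_exp z = \<zeta> ^ coset_exp y" "character n (ext 0) z = character n (ext 0) y"
    if z: "z \<in> conjugates y" for z
  proof -
    obtain u where u: "u \<in> carrier G" "z = u \<otimes> y \<otimes> inv u" using z by (auto simp: conjugates_def)
    have "\<zeta> ^ coset_exp z = \<zeta> ^ coset_exp y * (\<zeta> ^ coset_exp u * \<zeta> ^ coset_exp (inv u))"
      using u y by (simp add: root_coset_exp_mult[OF \<zeta>_pow])
    also have "\<zeta> ^ coset_exp u * \<zeta> ^ coset_exp (inv u) = 1"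
      using u root_inside[OF N.one_closed] by (simp add: root_coset_exp_mult[OF \<zeta>_pow, symmetric])
    finally show "\<zeta> ^ coset_exp z = \<zeta> ^ coset_exp y" by simp
    have "character n (ext 0) z = character n (ext 0) (inv u \<otimes> (u \<otimes> y))"
      unfolding u(2) using u y by (intro character_mult_commute[OF ext_representation]) simp_all
    then show "character n (ext 0) z = character n (ext 0) y" using u y by (simp add: mult_inv_cancel)
  qed
  have cs: "(\<Sum>g\<in>carrier G. class_sum G y g * f g) = (\<Sum>g\<in>conjugates y. f g)" for f :: "'a \<Rightarrow> 'f"
  proof -
    have "(\<Sum>g\<in>carrier G. class_sum G y g * f g) = (\<Sum>g\<in>conjugates y. class_sum G y g * f g)"
      using finite_carrier conjugates_closed[OF y] by (intro sum.mono_neutral_right) (auto simp: class_sum_eq)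
    then show ?thesis by (simp add: class_sum_eq)
  qed
  have "algebra_action G n (ext i) (class_sum G y) = ((\<zeta> ^ coset_exp y) ^ i * w) \<cdot>\<^sub>m 1\<^sub>m n" for i
  proof -
    have "algebra_action G n (ext i) (class_sum G y) =
        (\<zeta> ^ coset_exp y) ^ i \<cdot>\<^sub>m algebra_action G n (ext 0) (class_sum G y)"
    proof (rule eq_matI, goal_cases)
      case (1 r s)
      then have rs: "r < n" "s < n" by (simp_all add: algebra_action_def)
      have "ext i z $$ (r, s) = (\<zeta> ^ coset_exp y) ^ i * ext 0 z $$ (r, s)" if "z \<in> conjugates y" for z
      proof -
        have z: "z \<in> carrier G" using that conjugates_closed[OF y] by blast
        show ?thesis using ext_eq[OF z, of i] ext_carrier[OF z, of 0] rs conj(1)[OF that] by simp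
      qed
      then show ?case using rs by (simp add: algebra_action_def cs sum_distrib_left)
    qed (simp_all add: algebra_action_def)
    then show ?thesis by (simp add: w smult_smult_mat)
  qed
  moreover have "of_nat n * w = of_nat (card (conjugates y)) * character n (ext 0) y"
  proof -
    have "of_nat n * w = (\<Sum>a<n. algebra_action G n (ext 0) (class_sum G y) $$ (a, a))" by (simp add: w)
    also have "\<dots> = (\<Sum>a<n. \<Sum>g\<in>conjugates y. ext 0 g $$ (a, a))" by (simp add: algebra_action_def cs)
    also have "\<dots> = (\<Sum>g\<in>conjugates y. character n (ext 0) g)"
      by (subst sum.swap) (simp add: character_def)
    also have "\<dots> = of_nat (card (conjugates y)) * character n (ext 0) y" using conj(2) by simp
    finally show ?thesis .
  qed
  ultimately show ?thesis by (rule that)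
qed

text \<open>Multiplying the decomposition of the idempotent of \<eta> by a rescales each summand, so
  a product with this idempotent can be computed from p scalars.\<close>

lemma mult_eta_eqI:
  assumes "\<And>i. i < p \<Longrightarrow> algebra_action G n (ext i) a = w i \<cdot>\<^sub>m 1\<^sub>m n"
  shows "a \<otimes>\<^bsub>group_algebra G\<^esub> character_idempotent K n \<eta> = (\<lambda>g. \<Sum>i<p. w i * character_idempotent G n (ext i) g)"
proof -
  have "a \<otimes>\<^bsub>group_algebra G\<^esub> character_idempotent G n (ext i) = (\<lambda>g. w i * character_idempotent G n (ext i) g)"
    if "i < p" for i
    using mult_character_idempotent[OF ext_representation assms[OF that]] by (simp add: group_algebra_simps)
  then show ?thesis unfolding idempotent_eta_sum group_algebra_mult_sum by (intro ext sum.cong) simp_all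
qed

text \<open>The p-th power removes the roots of unity, so the p-th power of w serves all extensions
  at once. It is nonzero because the character at y is nonzero and the class size divides
  |G|.\<close>

lemma exists_class_sum_power:
  "\<exists>y\<in>carrier G - H. \<exists>l. l \<noteq> 0 \<and>
    class_sum G y [^]\<^bsub>group_algebra G\<^esub> p \<otimes>\<^bsub>group_algebra G\<^esub> character_idempotent K n \<eta> =
    l \<odot>\<^bsub>group_algebra G\<^esub> character_idempotent K n \<eta>"
proof -
  obtain y where y: "y \<in> carrier G" "y \<notin> H" "character n (ext 0) y \<noteq> 0" using exists_nonvanishing by blast
  obtain w where w: "\<And>i. algebra_action G n (ext i) (class_sum G y) = ((\<zeta> ^ coset_exp y) ^ i * w) \<cdot>\<^sub>m 1\<^sub>m n"
    "of_nat n * w = of_nat (card (conjugates y)) * character n (ext 0) y"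
    using ext_action_class_sum[OF y(1)] by blast
  obtain m where "Coset.order G = card (conjugates y) * m" using card_conjugates_dvd[OF y(1)] by (rule dvdE)
  then have "of_nat (card (conjugates y)) \<noteq> (0 :: 'f)" using ord by auto
  then have "w \<noteq> 0" using w(2) y(3) by auto
  have "((\<zeta> ^ coset_exp y) ^ i * w) ^ p = w ^ p" for i
    by (metis \<zeta>_pow_pow mult_1 power_mult power_mult_distrib)
  then have "algebra_action G n (ext i) (class_sum G y [^]\<^bsub>group_algebra G\<^esub> p) = w ^ p \<cdot>\<^sub>m 1\<^sub>m n" for i
    using algebra_action_pow[OF ext_representation w(1), of i p] by simp
  then have "class_sum G y [^]\<^bsub>group_algebra G\<^esub> p \<otimes>\<^bsub>group_algebra G\<^esub> character_idempotent K n \<eta> =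
      (\<lambda>g. \<Sum>i<p. w ^ p * character_idempotent G n (ext i) g)"
    by (rule mult_eta_eqI)
  also have "\<dots> = w ^ p \<odot>\<^bsub>group_algebra G\<^esub> character_idempotent K n \<eta>"
    by (simp add: idempotent_eta_sum group_algebra_simps sum_distrib_left)
  finally show ?thesis using y \<open>w \<noteq> 0\<close> by (intro bexI[of _ y] exI[of _ "w ^ p"]) simp_all
qed

text \<open>The element c acts on \<open>ext j\<close> by the root \<open>v j\<close>, so averaging
  the powers of \<open>\<xi> ^ i\<close> times c gives 1 where \<open>v j\<close> is the inverse of
  \<open>\<xi> ^ i\<close> and 0 elsewhere. The permutation solves this condition for j.\<close>

lemma averaging_class_sum:
  assumes y: "y \<in> carrier G" "y \<notin> H" and l: "l \<noteq> 0"
    and eq: "class_sum G y [^]\<^bsub>group_algebra G\<^esub> p \<otimes>\<^bsub>group_algebra G\<^esub> character_idempotent K n \<eta> =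
      l \<odot>\<^bsub>group_algebra G\<^esub> character_idempotent K n \<eta>"
    and mu: "\<mu> ^ p = l" and \<xi>: "primitive_root_of_unity p \<xi>"
    and c: "c = inverse \<mu> \<odot>\<^bsub>group_algebra G\<^esub> (class_sum G y \<otimes>\<^bsub>group_algebra G\<^esub> character_idempotent K n \<eta>)"
  shows "\<exists>\<pi>. bij_betw \<pi> {..<p} {..<p} \<and> (\<forall>i<p. character_idempotent G n (ext (\<pi> i)) =
    averaging_element (group_algebra G) p (\<xi> ^ i \<odot>\<^bsub>group_algebra G\<^esub> c) \<otimes>\<^bsub>group_algebra G\<^esub> character_idempotent K n \<eta>)"
proof -
  let ?A = "group_algebra G :: ('f, 'a \<Rightarrow> 'f) module"
  interpret A: ring ?A by (rule group_algebra_ring)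
  obtain w where w: "\<And>i. algebra_action G n (ext i) (class_sum G y) = ((\<zeta> ^ coset_exp y) ^ i * w) \<cdot>\<^sub>m 1\<^sub>m n"
    using ext_action_class_sum[OF y(1)] by blast
  \<comment> \<open>Evaluating the hypothesis in \<open>ext 0\<close> shows that l is the p-th power
    of w, so w / \<mu> is a p-th root of unity.\<close>
  have "algebra_action G n (ext 0) (class_sum G y [^]\<^bsub>?A\<^esub> p \<otimes>\<^bsub>?A\<^esub> character_idempotent K n \<eta>) = w ^ p \<cdot>\<^sub>m 1\<^sub>m n"
    using algebra_action_pow[OF ext_representation w, of 0 p]
    by (simp add: algebra_action_mult[OF ext_representation] ext_action_eta)
  moreover have "algebra_action G n (ext 0) (l \<odot>\<^bsub>?A\<^esub> character_idempotent K n \<eta>) = l \<cdot>\<^sub>m 1\<^sub>m n"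
    by (simp add: algebra_action_smult ext_action_eta)
  ultimately have "(w ^ p \<cdot>\<^sub>m 1\<^sub>m n) $$ (0, 0) = (l \<cdot>\<^sub>m 1\<^sub>m n :: 'f mat) $$ (0, 0)" using eq by simp
  then have wp: "w ^ p = l" using n_pos by simp
  have ne: "\<mu> \<noteq> 0" "w \<noteq> 0" using mu wp l p_pos by (auto simp: zero_power)
  define v where "v = (\<lambda>j. (\<zeta> ^ coset_exp y) ^ j * w / \<mu>)"
  have vp: "v j ^ p = 1" for j
  proof -
    have "((\<zeta> ^ coset_exp y) ^ j) ^ p = 1" by (metis \<zeta>_pow_pow power_mult)
    then show ?thesis using wp mu l by (simp add: v_def power_mult_distrib power_divide)
  qed
  have "inj_on v {..<p}"
    using primitive_root_inj[OF root_outside[OF y]] ne by (simp add: inj_on_def v_def)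
  then have v_bij: "bij_betw v {..<p} {z. z ^ p = 1}" using bij_betw_roots_of_unity[OF p_pos] vp by blast
  have \<xi>p: "\<xi> ^ p = 1" using \<xi> by (simp add: primitive_root_of_unity_def)
  have u_pow: "inverse (\<xi> ^ i) ^ p = 1" for i
    using \<xi>p by (metis inverse_1 mult.commute power_inverse power_mult power_one)
  have "inj_on (\<lambda>i. inverse (\<xi> ^ i)) {..<p}"
    using primitive_root_inj[OF \<xi>] by (simp add: inj_on_def)
  then have u_bij: "bij_betw (\<lambda>i. inverse (\<xi> ^ i)) {..<p} {z. z ^ p = 1}"
    using bij_betw_roots_of_unity[OF p_pos] u_pow by blast
  \<comment> \<open>Both \<open>v\<close> and the inverse powers of \<xi> enumerate all p-th roots
    of unity, so matching their values is a permutation of the labels.\<close>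
  define \<pi> where "\<pi> = (\<lambda>i. inv_into {..<p} v (inverse (\<xi> ^ i)))"
  have bij: "bij_betw \<pi> {..<p} {..<p}"
    using bij_betw_trans[OF u_bij bij_betw_inv_into[OF v_bij]] by (simp add: \<pi>_def comp_def)
  have \<pi>: "\<pi> i < p" "v (\<pi> i) = inverse (\<xi> ^ i)" if "i < p" for i
    using bij_betwE[OF bij] that bij_betw_inv_into_right[OF v_bij, of "inverse (\<xi> ^ i)"] u_pow
    by (auto simp: \<pi>_def)
  have act_c: "algebra_action G n (ext j) c = v j \<cdot>\<^sub>m 1\<^sub>m n" for j
    by (simp add: c algebra_action_smult algebra_action_mult[OF ext_representation] w ext_action_eta
        smult_smult_mat v_def divide_inverse mult.commute)
  have cA: "c \<in> carrier ?A"
    using group_algebra_mult_closed[of "class_sum G y" "character_idempotent K n \<eta>"] by (simp add: c group_algebra_simps)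
  have "character_idempotent G n (ext (\<pi> i)) =
      averaging_element ?A p (\<xi> ^ i \<odot>\<^bsub>?A\<^esub> c) \<otimes>\<^bsub>?A\<^esub> character_idempotent K n \<eta>" if i: "i < p" for i
  proof -
    let ?X = "\<xi> ^ i \<odot>\<^bsub>?A\<^esub> c"
    have X: "?X \<in> carrier ?A" using cA by (simp add: group_algebra_simps)
    have av: "averaging_element ?A p ?X = inverse (of_nat p) \<odot>\<^bsub>?A\<^esub> (\<lambda>g. \<Sum>k<p. (?X [^]\<^bsub>?A\<^esub> k) g)"
      unfolding averaging_element_def
      by (subst group_algebra_finsum) (simp_all only: finite_lessThan A.nat_pow_closed[OF X])
    have act: "algebra_action G n (ext j) (averaging_element ?A p ?X) = (if j = \<pi> i then 1 else 0) \<cdot>\<^sub>m 1\<^sub>m n"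
      if j: "j < p" for j
    proof -
      have "algebra_action G n (ext j) ?X = (\<xi> ^ i * v j) \<cdot>\<^sub>m 1\<^sub>m n"
        by (simp add: algebra_action_smult act_c smult_smult_mat)
      then have "algebra_action G n (ext j) (\<lambda>g. \<Sum>k<p. (?X [^]\<^bsub>?A\<^esub> k) g) = (\<Sum>k<p. (\<xi> ^ i * v j) ^ k) \<cdot>\<^sub>m 1\<^sub>m n"
        by (intro algebra_action_sum_scalar algebra_action_pow[OF ext_representation])
      then have *: "algebra_action G n (ext j) (averaging_element ?A p ?X) =
          (inverse (of_nat p) * (\<Sum>k<p. (\<xi> ^ i * v j) ^ k)) \<cdot>\<^sub>m 1\<^sub>m n"
        by (simp add: av algebra_action_smult smult_smult_mat)
      have "\<xi> \<noteq> 0" using \<xi>p p_pos by (auto simp: zero_power)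
      have "(\<xi> ^ i * v j) ^ p = 1"
        using vp \<xi>p by (metis mult.commute mult_1 power_mult power_mult_distrib power_one)
      moreover have "\<xi> ^ i * v j = 1 \<longleftrightarrow> j = \<pi> i"
      proof
        assume "\<xi> ^ i * v j = 1"
        then have "v j = v (\<pi> i)" using \<pi>(2)[OF i] by (simp add: inverse_unique)
        then show "j = \<pi> i" using v_bij j \<pi>(1)[OF i] by (auto simp: bij_betw_def inj_on_def)
      qed (use \<pi>(2)[OF i] \<open>\<xi> \<noteq> 0\<close> in simp)
      ultimately show ?thesis
        using sum_powers_root_of_unity[of "\<xi> ^ i * v j" p] of_nat_order_nonzero(1)[OF ord] * by simp
    qed
    have "averaging_element ?A p ?X \<otimes>\<^bsub>?A\<^esub> character_idempotent K n \<eta> =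
        (\<lambda>g. \<Sum>j<p. (if j = \<pi> i then 1 else 0) * character_idempotent G n (ext j) g)"
      by (rule mult_eta_eqI[OF act])
    also have "\<dots> = (\<lambda>g. \<Sum>j<p. if j = \<pi> i then character_idempotent G n (ext j) g else 0)"
      by (intro ext sum.cong) simp_all
    also have "\<dots> = character_idempotent G n (ext (\<pi> i))" using \<pi>(1)[OF i] by simp
    finally show ?thesis by simp
  qed
  then show ?thesis using bij by blast
qed

end

section \<open>The idempotent of the induced representation\<close>

context prime_index_transversal
begin

text \<open>By normality the induced character vanishes off H, and on H it is the sum of the
  conjugate characters. The quotient of the degree p n by |G| = p |H| reduces to n / |H|.\<close>

lemma induced_idempotent:
  fixes \<eta> :: "'a \<Rightarrow> 'f::alg_closed_field mat"
  assumes irr: "irreducible_representation K n \<eta>"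
    and ne: "\<not> equivalent_representations K \<eta> (conjugate_representation G x \<eta>)"
    and ord: "of_nat (Coset.order G) \<noteq> (0 :: 'f)"
  shows "representation_idempotent G (p * n) (induced_representation G H ts n \<eta>) =
    (\<Oplus>\<^bsub>group_algebra G\<^esub>i\<in>{..<p}. representation_idempotent K n (conjugate_representation G (x [^] i) \<eta>))"
proof -
  have r: "representation K n \<eta>" using irr by (simp add: irreducible_representation_def)
  let ?I = "induced_representation G H ts n \<eta>" and ?C = "\<lambda>i::nat. conjugate_representation G (x [^] i) \<eta>"
  have irrC: "irreducible_representation K n (?C i)" for i
    using x_closed by (intro conjugate_representation_irreducible[OF irr]) simp
  then have rC: "representation K n (?C i)" for i by (simp add: irreducible_representation_def)
  have idC: "representation_idempotent K n (?C i) = character_idempotent K n (?C i)" for i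
    using K.representation_idempotent_eq[OF irrC] of_nat_order_nonzero(2)[OF ord] by (simp add: order_K)
  have C_carrier: "character_idempotent K n (?C i) \<in> carrier (group_algebra G)" for i
    using H_closed by (auto simp: group_algebra_simps character_idempotent_def)
  have char_H: "character (p * n) ?I h = (\<Sum>i<p. character n (?C i) h)" if h: "h \<in> H" for h
  proof -
    have D: "direct_sum_representation p ?C h = block_mat p n (\<lambda>i j. if i = j then ?C i h else 0\<^sub>m n n)"
      unfolding direct_sum_representation_def
      by (rule diag_block_mat_eq_block_mat) (rule K_carrier[OF rC h])
    have "character (p * n) ?I h = character (p * n) (direct_sum_representation p ?C) h"
      using h by (intro character_equivalent[OF restrict_induced[OF r]]) (simp_all add: induced_eq[OF r])
    then show ?thesis by (simp add: character_def D trace_block_mat)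
  qed
  have char_out: "character (p * n) ?I g = 0" if g: "g \<in> carrier G" "g \<notin> H" for g
  proof -
    have "inv (ts ! i) \<otimes> g \<otimes> ts ! i \<notin> H" if i: "i < p" for i
    proof
      have t: "ts ! i \<in> carrier G" using i transversal_closed length_transversal by simp
      assume "inv (ts ! i) \<otimes> g \<otimes> ts ! i \<in> H"
      then have "ts ! i \<otimes> (inv (ts ! i) \<otimes> g \<otimes> ts ! i) \<otimes> inv (ts ! i) \<in> H" by (rule conj_closed[OF t])
      then show False using g t by (simp add: m_assoc mult_inv_cancel)
    qed
    then show ?thesis by (simp add: character_def induced_eq[OF r] trace_block_mat)
  qed
  have "character_idempotent G (p * n) ?I = (\<lambda>g. \<Sum>i<p. character_idempotent K n (?C i) g)"
  proof
    fix g
    show "character_idempotent G (p * n) ?I g = (\<Sum>i<p. character_idempotent K n (?C i) g)"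
    proof (cases "g \<in> carrier G")
      case True
      have iH: "inv g \<in> H \<longleftrightarrow> g \<in> H" using True N.m_inv_closed by (metis inv_inv)
      have "of_nat (p * n) / of_nat (p * card H) = (of_nat n / of_nat (card H) :: 'f)"
        using of_nat_order_nonzero(1)[OF ord] by simp
      then have e: "character_idempotent G (p * n) ?I g = of_nat n / of_nat (card H) * character (p * n) ?I (inv g)"
        using True by (simp only: character_idempotent_def order_G if_True)
      show ?thesis
      proof (cases "g \<in> H")
        case True
        then show ?thesis unfolding e using iH
          by (simp add: char_H character_idempotent_def order_K K_inv sum_distrib_left)
      next
        case False
        then show ?thesis unfolding e using iH True
          by (simp add: char_out character_idempotent_def)
      qed
    next
      case False
      then have "g \<notin> H" using H_closed by blast
      then show ?thesis using False by (simp add: character_idempotent_def)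
    qed
  qed
  then show ?thesis
    using representation_idempotent_eq[OF induced_irreducible[OF irr ne ord] ord]
    by (simp only: idC group_algebra_finsum[OF finite_lessThan C_carrier])
qed

end

theorem theorem4p1p2:
  fixes G :: "('g, 'm) monoid_scheme"
    and H :: "'g set"
    and x :: 'g
    and p n :: nat
    and ts :: "'g list"
    and \<eta> :: "'g \<Rightarrow> 'f::alg_closed_field mat"
  defines "K \<equiv> G\<lparr>carrier := H\<rparr>"
    and "A \<equiv> (group_algebra G :: ('f, 'g \<Rightarrow> 'f) module)"
    and "\<eta>_G \<equiv> induced_representation G H ts n \<eta>"
    and "e_\<eta> \<equiv> representation_idempotent (G\<lparr>carrier := H\<rparr>) n \<eta>"
  assumes "group G" and "finite (carrier G)"
    and "prime p"
    and "H \<lhd> G" and "card (rcosets\<^bsub>G\<^esub> H) = p"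
    and "x \<in> carrier G" and "generate (G Mod H) {x <#\<^bsub>G\<^esub> H} = carrier (G Mod H)"
    and "CHAR('f) = 0 \<or> coprime CHAR('f) (Coset.order G)"
    and "irreducible_representation K n \<eta>"
    and "left_transversal G H ts"
  shows
    "(\<not> equivalent_representations K \<eta> (conjugate_representation G x \<eta>) \<longrightarrow>
        irreducible_representation G (p * n) \<eta>_G \<and>
        equivalent_representations K \<eta>_G
          (direct_sum_representation p (\<lambda>i. conjugate_representation G (x [^]\<^bsub>G\<^esub> i) \<eta>)) \<and>
        representation_idempotent G (p * n) \<eta>_G =
          (\<Oplus>\<^bsub>A\<^esub>i\<in>{..<p}. representation_idempotent K n
                            (conjugate_representation G (x [^]\<^bsub>G\<^esub> i) \<eta>)))
     \<and>
     (equivalent_representations K \<eta> (conjugate_representation G x \<eta>) \<longrightarrow>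
       (\<exists>\<rho> :: nat \<Rightarrow> 'g \<Rightarrow> 'f mat.
          (\<forall>i<p. irreducible_representation G n (\<rho> i) \<and> equivalent_representations K (\<rho> i) \<eta>) \<and>
          (\<forall>i<p. \<forall>j<p. i \<noteq> j \<longrightarrow> \<not> equivalent_representations G (\<rho> i) (\<rho> j)) \<and>
          equivalent_representations G \<eta>_G (direct_sum_representation p \<rho>) \<and>
          e_\<eta> = (\<Oplus>\<^bsub>A\<^esub>i\<in>{..<p}. representation_idempotent G n (\<rho> i)) \<and>
          (\<exists>y\<in>carrier G - H. \<exists>l. l \<noteq> 0 \<and>
             class_sum G y [^]\<^bsub>A\<^esub> p \<otimes>\<^bsub>A\<^esub> e_\<eta> = l \<odot>\<^bsub>A\<^esub> e_\<eta>) \<and>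
          (\<forall>y\<in>carrier G - H. \<forall>l \<mu> \<zeta> c.
             l \<noteq> 0 \<longrightarrow>
             class_sum G y [^]\<^bsub>A\<^esub> p \<otimes>\<^bsub>A\<^esub> e_\<eta> = l \<odot>\<^bsub>A\<^esub> e_\<eta> \<longrightarrow>
             \<mu> ^ p = l \<longrightarrow>
             primitive_root_of_unity p \<zeta> \<longrightarrow>
             c = inverse \<mu> \<odot>\<^bsub>A\<^esub> (class_sum G y \<otimes>\<^bsub>A\<^esub> e_\<eta>) \<longrightarrow>
             (\<exists>\<pi>. bij_betw \<pi> {..<p} {..<p} \<and>
                (\<forall>i<p. representation_idempotent G n (\<rho> (\<pi> i)) =
                       averaging_element A p (\<zeta> ^ i \<odot>\<^bsub>A\<^esub> c) \<otimes>\<^bsub>A\<^esub> e_\<eta>)))))"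
proof -
  have fg: "finite_group G"
    using assms(5,6) by (simp add: finite_group_def finite_group_axioms_def)
  interpret prime_index_transversal G H x p ts
    using finite_group.prime_index_subgroupI[OF fg assms(8,7,9-11)] assms(14)
    by (simp add: prime_index_transversal_def prime_index_transversal_axioms_def)
  have irr: "irreducible_representation (G\<lparr>carrier := H\<rparr>) n \<eta>" using assms(13) by (simp add: K_def)
  \<comment> \<open>Either alternative for the characteristic makes |G| nonzero in the field, which
    is the form the lemmas above rely on.\<close>
  have ord: "of_nat (Coset.order G) \<noteq> (0 :: 'f)"
  proof
    assume "of_nat (Coset.order G) = (0 :: 'f)"
    then have dvd: "CHAR('f) dvd Coset.order G" by (simp add: of_nat_eq_0_iff_char_dvd)
    have "Coset.order G > 0" using order_gt_0_iff_finite finite_carrier by simp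
    then show False
    proof (cases "CHAR('f) = 0")
      case False
      then have "coprime CHAR('f) (Coset.order G)" using assms(12) by simp
      then have "is_unit CHAR('f)" using dvd by (rule coprime_common_divisor[OF _ dvd_refl])
      then show False by simp
    qed (use dvd in simp)
  qed
  show ?thesis
    unfolding K_def A_def \<eta>_G_def e_\<eta>_def
  proof (intro conjI impI)
    assume ne: "\<not> equivalent_representations (G\<lparr>carrier := H\<rparr>) \<eta> (conjugate_representation G x \<eta>)"
    show "irreducible_representation G (p * n) (induced_representation G H ts n \<eta>)"
      by (rule induced_irreducible[OF irr ne ord])
    show "representation_idempotent G (p * n) (induced_representation G H ts n \<eta>) =
        (\<Oplus>\<^bsub>group_algebra G\<^esub>i\<in>{..<p}. representation_idempotent (G\<lparr>carrier := H\<rparr>) n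
          (conjugate_representation G (x [^]\<^bsub>G\<^esub> i) \<eta>))"
      by (rule induced_idempotent[OF irr ne ord])
    show "equivalent_representations (G\<lparr>carrier := H\<rparr>) (induced_representation G H ts n \<eta>)
        (direct_sum_representation p (\<lambda>i. conjugate_representation G (x [^]\<^bsub>G\<^esub> i) \<eta>))"
      using irr by (intro restrict_induced) (simp add: irreducible_representation_def)
  next
    assume eq: "equivalent_representations (G\<lparr>carrier := H\<rparr>) \<eta> (conjugate_representation G x \<eta>)"
    have "\<exists>M. M \<in> carrier_mat n n \<and> M ^\<^sub>m p = \<eta> (x [^]\<^bsub>G\<^esub> p) \<and>
        (\<forall>h\<in>H. M * \<eta> h = \<eta> (x \<otimes>\<^bsub>G\<^esub> h \<otimes>\<^bsub>G\<^esub> inv\<^bsub>G\<^esub> x) * M)"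
      by (rule exists_extension_matrix[OF irr eq]) blast
    then obtain M where M: "M \<in> carrier_mat n n" "M ^\<^sub>m p = \<eta> (x [^]\<^bsub>G\<^esub> p)"
      "\<And>h. h \<in> H \<Longrightarrow> M * \<eta> h = \<eta> (x \<otimes>\<^bsub>G\<^esub> h \<otimes>\<^bsub>G\<^esub> inv\<^bsub>G\<^esub> x) * M"
      by blast
    \<comment> \<open>A root chosen once to number the extensions, independent of the root
      quantified in the claim.\<close>
    obtain \<zeta> :: 'f where \<zeta>: "primitive_root_of_unity p \<zeta>"
      using ex_primitive_root[OF assms(7) of_nat_order_nonzero(1)[OF ord]] by blast
    interpret I: invariant_representation G H x p ts \<eta> n M \<zeta>
      using irr ord M \<zeta> by unfold_locales
    let ?A = "group_algebra G :: ('f, 'g \<Rightarrow> 'f) module"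
    let ?e = "representation_idempotent (G\<lparr>carrier := H\<rparr>) n \<eta>"
    have e_sum: "?e = (\<Oplus>\<^bsub>?A\<^esub>i\<in>{..<p}. representation_idempotent G n (I.ext i))"
      by (simp only: I.idempotent_eta I.idempotent_ext I.idempotent_eta_sum
          group_algebra_finsum[OF finite_lessThan character_idempotent_carrier])
    show "\<exists>\<rho> :: nat \<Rightarrow> 'g \<Rightarrow> 'f mat.
          (\<forall>i<p. irreducible_representation G n (\<rho> i) \<and> equivalent_representations (G\<lparr>carrier := H\<rparr>) (\<rho> i) \<eta>) \<and>
          (\<forall>i<p. \<forall>j<p. i \<noteq> j \<longrightarrow> \<not> equivalent_representations G (\<rho> i) (\<rho> j)) \<and>
          equivalent_representations G (induced_representation G H ts n \<eta>) (direct_sum_representation p \<rho>) \<and>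
          ?e = (\<Oplus>\<^bsub>?A\<^esub>i\<in>{..<p}. representation_idempotent G n (\<rho> i)) \<and>
          (\<exists>y\<in>carrier G - H. \<exists>l. l \<noteq> 0 \<and>
             class_sum G y [^]\<^bsub>?A\<^esub> p \<otimes>\<^bsub>?A\<^esub> ?e = l \<odot>\<^bsub>?A\<^esub> ?e) \<and>
          (\<forall>y\<in>carrier G - H. \<forall>l \<mu> \<zeta> c.
             l \<noteq> 0 \<longrightarrow>
             class_sum G y [^]\<^bsub>?A\<^esub> p \<otimes>\<^bsub>?A\<^esub> ?e = l \<odot>\<^bsub>?A\<^esub> ?e \<longrightarrow>
             \<mu> ^ p = l \<longrightarrow>
             primitive_root_of_unity p \<zeta> \<longrightarrow>
             c = inverse \<mu> \<odot>\<^bsub>?A\<^esub> (class_sum G y \<otimes>\<^bsub>?A\<^esub> ?e) \<longrightarrow>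
             (\<exists>\<pi>. bij_betw \<pi> {..<p} {..<p} \<and>
                (\<forall>i<p. representation_idempotent G n (\<rho> (\<pi> i)) =
                       averaging_element ?A p (\<zeta> ^ i \<odot>\<^bsub>?A\<^esub> c) \<otimes>\<^bsub>?A\<^esub> ?e)))"
    proof (intro exI[of _ I.ext] conjI allI impI ballI)
      show "\<exists>y\<in>carrier G - H. \<exists>l. l \<noteq> 0 \<and>
             class_sum G y [^]\<^bsub>?A\<^esub> p \<otimes>\<^bsub>?A\<^esub> ?e = l \<odot>\<^bsub>?A\<^esub> ?e"
        using I.exists_class_sum_power unfolding I.idempotent_eta .
      fix y c and l \<mu> \<xi> :: 'f
      assume "y \<in> carrier G - H" "l \<noteq> 0"
        "class_sum G y [^]\<^bsub>?A\<^esub> p \<otimes>\<^bsub>?A\<^esub> ?e = l \<odot>\<^bsub>?A\<^esub> ?e" "\<mu> ^ p = l"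
        "primitive_root_of_unity p \<xi>" "c = inverse \<mu> \<odot>\<^bsub>?A\<^esub> (class_sum G y \<otimes>\<^bsub>?A\<^esub> ?e)"
      then show "\<exists>\<pi>. bij_betw \<pi> {..<p} {..<p} \<and>
                (\<forall>i<p. representation_idempotent G n (I.ext (\<pi> i)) =
                       averaging_element ?A p (\<xi> ^ i \<odot>\<^bsub>?A\<^esub> c) \<otimes>\<^bsub>?A\<^esub> ?e)"
        unfolding I.idempotent_eta I.idempotent_ext by (intro I.averaging_class_sum) auto
    qed (use I.ext_irreducible I.ext_restrict_equivalent I.ext_inequivalent I.induced_equivalent_sum e_sum in blast)+
  qed
qed

end
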